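(* Let $K$ be a field and let $K^\times \hookrightarrow U$ be an extension of abelian groups such that $(U/K^\times)[\ell^\infty]=1$ if $\operatorname{char} K=\ell>0$. Then the universal algebra $K\langle U\rangle$ is a field if and only if the extension $K^\times\hookrightarrow U$ is essential and, moreover, in case $U$ contains an element of order $4$ not in $K^\times$, one has $-4\notin U^4$ (i.e. there is no $x\in U$ with $x^4=-4$). In this case (i.e. when $K\langle U\rangle$ is a field): - if $U/K^\times$ is a $p$-group for a prime $p\ge 3$, then $(K\langle U\rangle^\times/K^\times)[p^\infty]=U/K^\times$; - if $U/K^\times$ is a $2$-group and $U$ contains no element of order $4$ not in $K$, then $(K\langle U\rangle^\times/K^\times)[2^\infty]=U/K^\times$.
   Context: All rings are commutative; $R^\times$ is the group of units of a ring $R$. For a multiplicatively written abelian group $G$ and a prime $p$, $G[p^\infty]=\{x\in G: x^{p^k}=1 \text{ for some } k\ge 1\}$. An extension $H\subseteq G$ of abelian groups is essential if every subgroup $F\subseteq G$ with $F\cap H=1$ is trivial. Universal algebra: let $K^\times\hookrightarrow U$ be an extension of abelian groups ($U$ an abelian group containing $K^\times$ as a subgroup), and put $D=U/K^\times$ (written additively). Choose representatives $x_d\in U$ of the classes $d\in D$. Then $K\langle U\rangle:=\bigoplus_{d\in D}Kx_d$ is the $K$-algebra with $K$-basis $(x_d)_{d\in D}$ and multiplication $x_dx_e=a_{d,e}x_{d+e}$, where $a_{d,e}\in K^\times$ is determined by this equation in $U$ (equivalently, $K\langle U\rangle=K\otimes_{\mathbb Z[K^\times]}\mathbb Z[U]$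 with group rings). It does not depend on the choices, is $D$-graded, and $U$ is identified with its group of homogeneous units via $u=ax_d\mapsto ax_d$ ($a\in K^\times$); in particular $U\subseteq K\langle U\rangle^\times$. *)

theory Defs
  imports "HOL-Algebra.Algebra" "HOL-Computational_Algebra.Primes"
begin

definition ring_char :: "('a, 'b) ring_scheme \<Rightarrow> nat" where
  "ring_char R =
     (if \<exists>n::nat. n > 0 \<and> add_pow R n \<one>\<^bsub>R\<^esub> = \<zero>\<^bsub>R\<^esub>
      then LEAST n::nat. n > 0 \<and> add_pow R n \<one>\<^bsub>R\<^esub> = \<zero>\<^bsub>R\<^esub> else 0)"

definition primary_part :: "('a, 'b) monoid_scheme \<Rightarrow> nat \<Rightarrow> 'a set" where
  "primary_part G p = {x \<in> carrier G. \<exists>k\<ge>1. x [^]\<^bsub>G\<^esub> (p ^ k) = \<one>\<^bsub>G\<^esub>}"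

definition p_group :: "nat \<Rightarrow> ('a, 'b) monoid_scheme \<Rightarrow> bool" where
  "p_group p G \<longleftrightarrow> group G \<and> (\<forall>x \<in> carrier G. \<exists>k. group.ord G x = p ^ k)"

definition essential_extension :: "'a set \<Rightarrow> ('a, 'b) monoid_scheme \<Rightarrow> bool" where
  "essential_extension H G \<longleftrightarrow>
     subgroup H G \<and> (\<forall>F. subgroup F G \<and> F \<inter> H = {\<one>\<^bsub>G\<^esub>} \<longrightarrow> F = {\<one>\<^bsub>G\<^esub>})"

text \<open>
  An extension of the multiplicative group of \<open>K\<close> by an abelian group \<open>U\<close> is given by an
  injective homomorphism \<open>\<iota>\<close> from the units of \<open>K\<close> to \<open>U\<close>; the subgroup of \<open>U\<close> that it
  identifies with the multiplicative group is its image.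
\<close>

definition base_units :: "('k, 'm) ring_scheme \<Rightarrow> ('k \<Rightarrow> 'u) \<Rightarrow> 'u set" where
  "base_units K \<iota> = \<iota> ` Units K"

text \<open>The grading group \<open>D\<close>, written multiplicatively; its elements are cosets in \<open>U\<close>.\<close>

definition grading_group ::
  "('k, 'm) ring_scheme \<Rightarrow> ('u, 'n) monoid_scheme \<Rightarrow> ('k \<Rightarrow> 'u) \<Rightarrow> 'u set monoid" where
  "grading_group K U \<iota> = U Mod base_units K \<iota>"

definition is_rep_system ::
  "('k, 'm) ring_scheme \<Rightarrow> ('u, 'n) monoid_scheme \<Rightarrow> ('k \<Rightarrow> 'u) \<Rightarrow> ('u set \<Rightarrow> 'u) \<Rightarrow> bool" where
  "is_rep_system K U \<iota> x \<longleftrightarrow> (\<forall>d \<in> carrier (grading_group K U \<iota>). x d \<in> d)"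

text \<open>
  Every \<open>u\<close> in \<open>U\<close> is uniquely \<open>\<iota> a \<otimes> x d\<close> with \<open>a\<close> a unit of \<open>K\<close> and \<open>d\<close> the coset of \<open>u\<close>;
  \<open>unit_coeff\<close> is this \<open>a\<close>.
\<close>

definition unit_coeff ::
  "('k, 'm) ring_scheme \<Rightarrow> ('u, 'n) monoid_scheme \<Rightarrow> ('k \<Rightarrow> 'u) \<Rightarrow> ('u set \<Rightarrow> 'u) \<Rightarrow> 'u \<Rightarrow> 'k" where
  "unit_coeff K U \<iota> x u =
     (THE a. a \<in> Units K \<and> u = \<iota> a \<otimes>\<^bsub>U\<^esub> x (base_units K \<iota> #>\<^bsub>U\<^esub> u))"

text \<open>
  An element of the universal algebra is its coefficient function with respect to the basis
  \<open>x d\<close>, extended by zero outside the grading group.  The element \<open>u = \<iota> a \<otimes> x d\<close> of \<open>U\<close> is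
  identified with the function that takes the value \<open>a\<close> at \<open>d\<close> and vanishes elsewhere.
\<close>

definition homog_unit ::
  "('k, 'm) ring_scheme \<Rightarrow> ('u, 'n) monoid_scheme \<Rightarrow> ('k \<Rightarrow> 'u) \<Rightarrow> ('u set \<Rightarrow> 'u)
     \<Rightarrow> 'u \<Rightarrow> ('u set \<Rightarrow> 'k)" where
  "homog_unit K U \<iota> x u =
     (\<lambda>d. if d = base_units K \<iota> #>\<^bsub>U\<^esub> u then unit_coeff K U \<iota> x u else \<zero>\<^bsub>K\<^esub>)"

text \<open>
  Multiplication extends \<open>x d \<cdot> x e = a\<^sub>d\<^sub>e x (d e)\<close> bilinearly, where \<open>a\<^sub>d\<^sub>e\<close> is the
  \<open>unit_coeff\<close> of \<open>x d \<otimes> x e\<close>.  The sum runs over the pairs of support points of the factors,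
  hence is finite.
\<close>

definition universal_algebra ::
  "('k, 'm) ring_scheme \<Rightarrow> ('u, 'n) monoid_scheme \<Rightarrow> ('k \<Rightarrow> 'u) \<Rightarrow> ('u set \<Rightarrow> 'u)
     \<Rightarrow> ('u set \<Rightarrow> 'k) ring" where
  "universal_algebra K U \<iota> x =
     \<lparr>carrier = {f. (\<forall>d. f d \<in> carrier K) \<and>
                    (\<forall>d. d \<notin> carrier (grading_group K U \<iota>) \<longrightarrow> f d = \<zero>\<^bsub>K\<^esub>) \<and>
                    finite {d. f d \<noteq> \<zero>\<^bsub>K\<^esub>}},
      monoid.mult = (\<lambda>f g h.
        finsum K (\<lambda>(d, e). f d \<otimes>\<^bsub>K\<^esub> g e \<otimes>\<^bsub>K\<^esub> unit_coeff K U \<iota> x (x d \<otimes>\<^bsub>U\<^esub> x e))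
          {(d, e). f d \<noteq> \<zero>\<^bsub>K\<^esub> \<and> g e \<noteq> \<zero>\<^bsub>K\<^esub> \<and> d \<otimes>\<^bsub>grading_group K U \<iota>\<^esub> e = h}),
      monoid.one = homog_unit K U \<iota> x \<one>\<^bsub>U\<^esub>,
      ring.zero = (\<lambda>d. \<zero>\<^bsub>K\<^esub>),
      ring.add = (\<lambda>f g d. f d \<oplus>\<^bsub>K\<^esub> g d)\<rparr>"

definition scalar_units ::
  "('k, 'm) ring_scheme \<Rightarrow> ('u, 'n) monoid_scheme \<Rightarrow> ('k \<Rightarrow> 'u) \<Rightarrow> ('u set \<Rightarrow> 'u)
     \<Rightarrow> ('u set \<Rightarrow> 'k) set" where
  "scalar_units K U \<iota> x = homog_unit K U \<iota> x ` base_units K \<iota>"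

text \<open>The unit group of the universal algebra modulo the multiplicative group of \<open>K\<close>.\<close>

definition unit_quotient ::
  "('k, 'm) ring_scheme \<Rightarrow> ('u, 'n) monoid_scheme \<Rightarrow> ('k \<Rightarrow> 'u) \<Rightarrow> ('u set \<Rightarrow> 'u)
     \<Rightarrow> ('u set \<Rightarrow> 'k) set monoid" where
  "unit_quotient K U \<iota> x = units_of (universal_algebra K U \<iota> x) Mod scalar_units K U \<iota> x"

text \<open>\<open>D\<close> viewed as a subgroup of \<open>unit_quotient\<close>: the classes of the elements of \<open>U\<close>.\<close>

definition homog_quotient ::
  "('k, 'm) ring_scheme \<Rightarrow> ('u, 'n) monoid_scheme \<Rightarrow> ('k \<Rightarrow> 'u) \<Rightarrow> ('u set \<Rightarrow> 'u)
     \<Rightarrow> ('u set \<Rightarrow> 'k) set set" where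
  "homog_quotient K U \<iota> x =
     (\<lambda>u. scalar_units K U \<iota> x #>\<^bsub>units_of (universal_algebra K U \<iota> x)\<^esub> homog_unit K U \<iota> x u)
       ` carrier U"

definition has_new_order_4 ::
  "('k, 'm) ring_scheme \<Rightarrow> ('u, 'n) monoid_scheme \<Rightarrow> ('k \<Rightarrow> 'u) \<Rightarrow> bool" where
  "has_new_order_4 K U \<iota> \<longleftrightarrow> (\<exists>u \<in> carrier U. group.ord U u = 4 \<and> u \<notin> base_units K \<iota>)"

text \<open>
  In characteristic 2 the element \<open>-4 = 0\<close> of \<open>K\<close> is not in the domain of \<open>\<iota>\<close>, so membership in
  \<open>U\<close> has to be required explicitly.
\<close>

definition minus_4_is_fourth_power ::
  "('k, 'm) ring_scheme \<Rightarrow> ('u, 'n) monoid_scheme \<Rightarrow> ('k \<Rightarrow> 'u) \<Rightarrow> bool" where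
  "minus_4_is_fourth_power K U \<iota> \<longleftrightarrow>
     \<ominus>\<^bsub>K\<^esub> (add_pow K (4::nat) \<one>\<^bsub>K\<^esub>) \<in> Units K \<and>
     (\<exists>u \<in> carrier U. u [^]\<^bsub>U\<^esub> (4::nat) = \<iota> (\<ominus>\<^bsub>K\<^esub> (add_pow K (4::nat) \<one>\<^bsub>K\<^esub>)))"

end

theory Submission
  imports Defs "Jordan_Normal_Form.Determinant"
begin

text \<open>
  If \<open>K\<langle>U\<rangle>\<close> is a field and \<open>F \<le> U\<close> meets the multiplicative group of \<open>K\<close> trivially, then for
  \<open>1 \<noteq> u \<in> F\<close> the geometric sums \<open>1 + u + \<dots> + u\<^sup>n\<^sup>-\<^sup>1\<close> have distinct classes as summands, which
  contradicts \<open>u - 1\<close> being a unit. If moreover \<open>i \<in> U\<close> is a square root of \<open>-1\<close> outside \<open>K\<close>, a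
  fourth root of \<open>-4\<close> is one of \<open>\<plusminus>1 \<plusminus> i\<close>, which is not homogeneous.

  Conversely, an element of \<open>K\<langle>U\<rangle>\<close> involves finitely many elements of \<open>U\<close>, and these are adjoined
  to \<open>K\<close> one at a time inside \<open>K\<langle>U\<rangle>\<close>. A single step adjoins \<open>\<alpha> \<in> U\<close> with \<open>\<alpha>\<^sup>p = a \<in> K\<close> and \<open>\<alpha> \<notin> K\<close>;
  essentiality says that \<open>a\<close> is not a \<open>p\<close>-th power in \<open>K\<close>. If the vectors \<open>\<alpha>\<^sup>i v\<close> with \<open>i < p\<close> were
  dependent, their span would have a dimension \<open>0 < n < p\<close>, and the determinant of \<open>\<alpha>\<close> on it would
  be an \<open>e \<in> K\<close> with \<open>e\<^sup>p = a\<^sup>n\<close>, so \<open>a\<close> would be a \<open>p\<close>-th power. Hence \<open>B = K[\<alpha>]\<close> is a field of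
  degree \<open>p\<close>. To iterate, one needs the extension generated by \<open>U\<close> over \<open>B\<close> to be essential, which
  comes down to showing that a \<open>\<beta> \<in> B\<close> whose \<open>q\<close>-th power is a monomial \<open>k\<alpha>\<^sup>j\<close> has the same \<open>q\<close>-th
  power as some monomial. For \<open>q \<noteq> p\<close> this follows by taking norms from \<open>B\<close> to \<open>K\<close>. For \<open>q = p\<close> norms
  reduce it to \<open>\<beta>\<^sup>p \<in> K\<close>, and then \<open>\<beta>\<close> is itself a monomial, because elements of \<open>B\<close> outside \<open>K\<close>
  with \<open>p\<close>-th power in \<open>K\<close> have trace \<open>0\<close>. The only exception occurs for \<open>p = q = 2\<close> when \<open>-a\<close> is a
  square, which puts a square root of \<open>-1\<close> into \<open>U\<close>; so such a root is adjoined first, and there the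
  exception is excluded by \<open>-4\<close> not being a fourth power. The statements on primary parts follow
  the same tower.
\<close>

section \<open>Determinants over commutative rings\<close>

text \<open>The ring in which everything happens is only known to be commutative; that it has no
  zero divisors is part of the conclusion. So the usual theory of minimal polynomials and degrees is
  not at hand, and all arguments are linear algebra over a subfield of a commutative ring.
  Multiplicativity of the determinant replaces the irreducibility of X^p - a. It is applied to the
  vectors \<alpha>^i b for every nonzero b in B, which makes multiplication by b injective;
  dimension does the rest.

  The number -4 comes from p = 2. If e^2 = -a, then (e + \<alpha>)^2 = 2 e \<alpha> is a monomial
  although e + \<alpha> is not. For \<alpha> = i and a = -1 this gives e^2 = 1 and (e + i)^4 = -4,
  so an element u of U with u^2 = y^2 (e + i)^2 satisfies (u/y)^4 = -4. For any other \<alpha> one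
  has (\<alpha>/e)^2 = -1; hence the invariant, kept along the tower, that square roots of -1 in U
  already lie in the base field.

  The characteristic enters through the trace, which is p times the constant coefficient: p must be
  invertible for a vanishing trace to say anything.\<close>

text \<open>
  The library determinant lives on a type of class \<open>comm_ring_1\<close>. Evaluating the free commutative
  ring on the type of elements of \<open>R\<close> transfers its multiplicativity to a ring given as a record.
\<close>

datatype 'a ring_term =
  Gen 'a | Nil_term | Unit_term | Neg_term "'a ring_term"
| Add_term "'a ring_term" "'a ring_term" | Mul_term "'a ring_term" "'a ring_term"

inductive ring_eqv :: "'a ring_term \<Rightarrow> 'a ring_term \<Rightarrow> bool" where
  eqv_refl: "ring_eqv s s"
| eqv_sym: "ring_eqv s t \<Longrightarrow> ring_eqv t s"
| eqv_trans: "ring_eqv s t \<Longrightarrow> ring_eqv t u \<Longrightarrow> ring_eqv s u"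
| eqv_neg: "ring_eqv s t \<Longrightarrow> ring_eqv (Neg_term s) (Neg_term t)"
| eqv_add: "ring_eqv s t \<Longrightarrow> ring_eqv s' t' \<Longrightarrow> ring_eqv (Add_term s s') (Add_term t t')"
| eqv_mul: "ring_eqv s t \<Longrightarrow> ring_eqv s' t' \<Longrightarrow> ring_eqv (Mul_term s s') (Mul_term t t')"
| add_assoc_term: "ring_eqv (Add_term (Add_term s t) u) (Add_term s (Add_term t u))"
| add_comm_term: "ring_eqv (Add_term s t) (Add_term t s)"
| add_zero_term: "ring_eqv (Add_term Nil_term s) s"
| add_neg_term: "ring_eqv (Add_term (Neg_term s) s) Nil_term"
| mul_assoc_term: "ring_eqv (Mul_term (Mul_term s t) u) (Mul_term s (Mul_term t u))"
| mul_comm_term: "ring_eqv (Mul_term s t) (Mul_term t s)"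
| mul_one_term: "ring_eqv (Mul_term Unit_term s) s"
| distrib_term: "ring_eqv (Mul_term (Add_term s t) u) (Add_term (Mul_term s u) (Mul_term t u))"

quotient_type 'a free_cring = "'a ring_term" / ring_eqv
  by (rule equivpI) (auto intro!: reflpI sympI transpI intro: ring_eqv.intros)

text \<open>Evaluation in the integers with all generators sent to 0. It is invariant under
  \<open>ring_eqv\<close> and separates \<open>Nil_term\<close> from \<open>Unit_term\<close>, which
  gives the axiom 0 \<noteq> 1 of \<open>comm_ring_1\<close>.\<close>

primrec int_value :: "'a ring_term \<Rightarrow> int" where
  "int_value (Gen a) = 0"
| "int_value Nil_term = 0"
| "int_value Unit_term = 1"
| "int_value (Neg_term s) = - int_value s"
| "int_value (Add_term s t) = int_value s + int_value t"
| "int_value (Mul_term s t) = int_value s * int_value t"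

lemma int_value_eqv: "ring_eqv s t \<Longrightarrow> int_value s = int_value t"
  by (induction rule: ring_eqv.induct) (auto simp: algebra_simps)

instantiation free_cring :: (type) comm_ring_1
begin
lift_definition zero_free_cring :: "'a free_cring" is Nil_term .
lift_definition one_free_cring :: "'a free_cring" is Unit_term .
lift_definition uminus_free_cring :: "'a free_cring \<Rightarrow> 'a free_cring" is Neg_term
  by (rule eqv_neg)
lift_definition plus_free_cring :: "'a free_cring \<Rightarrow> 'a free_cring \<Rightarrow> 'a free_cring" is Add_term
  by (rule eqv_add)
lift_definition times_free_cring :: "'a free_cring \<Rightarrow> 'a free_cring \<Rightarrow> 'a free_cring" is Mul_term
  by (rule eqv_mul)
definition minus_free_cring :: "'a free_cring \<Rightarrow> 'a free_cring \<Rightarrow> 'a free_cring" where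
  "minus_free_cring a b = a + - b"
instance
proof
  show "(0::'a free_cring) \<noteq> 1"
    by transfer (auto dest: int_value_eqv)
qed (simp add: minus_free_cring_def
  | (transfer, rule add_assoc_term add_comm_term add_zero_term add_neg_term
      mul_assoc_term mul_comm_term mul_one_term distrib_term))+
end

lift_definition free_gen :: "'a \<Rightarrow> 'a free_cring" is Gen .

text \<open>The generators range over a whole type, so those outside the carrier need a value inside
  it; zero serves as the default.\<close>

primrec term_value :: "('a, 'm) ring_scheme \<Rightarrow> 'a ring_term \<Rightarrow> 'a" where
  "term_value R (Gen a) = (if a \<in> carrier R then a else \<zero>\<^bsub>R\<^esub>)"
| "term_value R Nil_term = \<zero>\<^bsub>R\<^esub>"
| "term_value R Unit_term = \<one>\<^bsub>R\<^esub>"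
| "term_value R (Neg_term s) = \<ominus>\<^bsub>R\<^esub> term_value R s"
| "term_value R (Add_term s t) = term_value R s \<oplus>\<^bsub>R\<^esub> term_value R t"
| "term_value R (Mul_term s t) = term_value R s \<otimes>\<^bsub>R\<^esub> term_value R t"

text \<open>A representative is chosen because \<open>term_value R\<close> respects
  \<open>ring_eqv\<close> only when \<open>R\<close> is a commutative ring, which the definition
  cannot presuppose.\<close>

definition free_value :: "('a, 'm) ring_scheme \<Rightarrow> 'a free_cring \<Rightarrow> 'a" where
  "free_value R z = term_value R (rep_free_cring z)"

context cring
begin

lemma term_value_closed [simp]: "term_value R s \<in> carrier R"
  by (induction s) auto

lemma term_value_eqv: "ring_eqv s t \<Longrightarrow> term_value R s = term_value R t"
  by (induction rule: ring_eqv.induct) (simp_all add: a_assoc m_assoc l_neg l_distr, ((rule a_comm m_comm; simp))+)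

lemma free_value_closed [simp]: "free_value R z \<in> carrier R"
  by (simp add: free_value_def)

lemma free_value_abs: "free_value R (abs_free_cring s) = term_value R s"
  unfolding free_value_def
  by (rule term_value_eqv) (simp add: Quotient3_rep_abs[OF Quotient3_free_cring] eqv_refl)

lemma free_value_gen [simp]: "a \<in> carrier R \<Longrightarrow> free_value R (free_gen a) = a"
  by (simp add: free_gen.abs_eq free_value_abs)

lemma free_value_zero [simp]: "free_value R 0 = \<zero>"
  by (simp add: zero_free_cring.abs_eq free_value_abs)

lemma free_value_one [simp]: "free_value R 1 = \<one>"
  by (simp add: one_free_cring.abs_eq free_value_abs)

lemma free_value_minus [simp]: "free_value R (- z) = \<ominus> free_value R z"
  by (induction z rule: free_cring.abs_induct) (simp add: uminus_free_cring.abs_eq free_value_abs)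

lemma free_value_add [simp]: "free_value R (y + z) = free_value R y \<oplus> free_value R z"
  by (induction y rule: free_cring.abs_induct, induction z rule: free_cring.abs_induct)
    (simp add: plus_free_cring.abs_eq free_value_abs)

lemma free_value_mult [simp]: "free_value R (y * z) = free_value R y \<otimes> free_value R z"
  by (induction y rule: free_cring.abs_induct, induction z rule: free_cring.abs_induct)
    (simp add: times_free_cring.abs_eq free_value_abs)

lemma free_value_sum: "free_value R (sum f A) = (\<Oplus>i\<in>A. free_value R (f i))"
  by (induction A rule: infinite_finite_induct) auto

lemma free_value_prod: "free_value R (prod f A) = (\<Otimes>i\<in>A. free_value R (f i))"
  by (induction A rule: infinite_finite_induct) auto

lemma free_value_power: "free_value R (z ^ n) = free_value R z [^] n"
  by (induction n) (simp_all add: power_Suc2 del: power_Suc)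

lemma permutes_lessThan: "p permutes {..<n} \<Longrightarrow> i < n \<Longrightarrow> p i < (n::nat)"
  using permutes_in_image[of p "{..<n}" i] by simp

section \<open>Leibniz determinants and their evaluation from the free ring\<close>

definition cdet :: "nat \<Rightarrow> (nat \<Rightarrow> nat \<Rightarrow> 'a) \<Rightarrow> 'a" where
  "cdet n A = (\<Oplus>p\<in>{p. p permutes {..<n}}.
     (if evenperm p then \<one> else \<ominus> \<one>) \<otimes> (\<Otimes>i\<in>{..<n}. A i (p i)))"

lemma free_value_det:
  "free_value R (det (Matrix.mat n n (\<lambda>(i, j). E i j))) = cdet n (\<lambda>i j. free_value R (E i j))"
proof -
  have *: "(\<Prod>i = 0..<n. Matrix.mat n n (\<lambda>(i, j). E i j) $$ (i, p i)) = (\<Prod>i\<in>{..<n}. E i (p i))"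
    if "p permutes {..<n}" for p
    using permutes_lessThan[OF that] by (intro prod.cong) auto
  have "det (Matrix.mat n n (\<lambda>(i, j). E i j)) =
     (\<Sum>p\<in>{p. p permutes {..<n}}. signof p * (\<Prod>i\<in>{..<n}. E i (p i)))"
    using * by (simp add: det_def atLeast0LessThan)
  moreover have "free_value R (signof p) = (if evenperm p then \<one> else \<ominus> \<one>)" for p :: "nat \<Rightarrow> nat"
    by (simp add: sign_def)
  ultimately show ?thesis
    by (simp add: free_value_sum free_value_prod cdet_def)
qed

lemma cdet_gen:
  assumes "\<And>i j. i < n \<Longrightarrow> j < n \<Longrightarrow> A i j \<in> carrier R"
  shows "cdet n A = free_value R (det (Matrix.mat n n (\<lambda>(i, j). free_gen (A i j))))"
  unfolding free_value_det cdet_def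
  using assms by (intro finsum_cong' refl arg_cong2[of _ _ _ _ "(\<otimes>)"] finprod_cong')
    (auto simp: permutes_lessThan)

lemma cdet_cong:
  assumes "\<And>i j. i < n \<Longrightarrow> j < n \<Longrightarrow> A i j = B i j" "\<And>i j. i < n \<Longrightarrow> j < n \<Longrightarrow> B i j \<in> carrier R"
  shows "cdet n A = cdet n B"
  unfolding cdet_def
  using assms by (intro finsum_cong' refl arg_cong2[of _ _ _ _ "(\<otimes>)"] finprod_cong')
    (auto simp: permutes_lessThan intro!: m_closed finprod_closed)

lemma cdet_mult:
  assumes "\<And>i j. i < n \<Longrightarrow> j < n \<Longrightarrow> A i j \<in> carrier R" "\<And>i j. i < n \<Longrightarrow> j < n \<Longrightarrow> B i j \<in> carrier R"
  shows "cdet n (\<lambda>i j. \<Oplus>k\<in>{..<n}. A i k \<otimes> B k j) = cdet n A \<otimes> cdet n B"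
proof -
  let ?M = "\<lambda>A. Matrix.mat n n (\<lambda>(i, j). free_gen (A i j))"
  have "?M A * ?M B = Matrix.mat n n (\<lambda>(i, j). \<Sum>k<n. free_gen (A i k) * free_gen (B k j))"
    by (intro eq_matI) (auto simp: scalar_prod_def atLeast0LessThan)
  moreover have "cdet n A \<otimes> cdet n B = free_value R (det (?M A) * det (?M B))"
    using assms by (simp only: free_value_mult cdet_gen)
  moreover have "det (?M A) * det (?M B) = det (?M A * ?M B)"
    by (simp add: det_mult[OF mat_carrier mat_carrier])
  ultimately have "cdet n A \<otimes> cdet n B =
      free_value R (det (Matrix.mat n n (\<lambda>(i, j). \<Sum>k<n. free_gen (A i k) * free_gen (B k j))))"
    by simp
  also have "\<dots> = cdet n (\<lambda>i j. \<Oplus>k\<in>{..<n}. A i k \<otimes> B k j)"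
    unfolding free_value_det
    using assms by (intro cdet_cong) (auto simp: free_value_sum intro!: finsum_cong')
  finally show ?thesis by simp
qed

lemma cdet_scalar:
  assumes "c \<in> carrier R"
  shows "cdet n (\<lambda>i j. if i = j then c else \<zero>) = c [^] n"
proof -
  have "c [^] n = free_value R (det (free_gen c \<cdot>\<^sub>m 1\<^sub>m n))"
    using assms by (simp add: det_smult free_value_power)
  also have "free_gen c \<cdot>\<^sub>m 1\<^sub>m n = Matrix.mat n n (\<lambda>(i, j). if i = j then free_gen c else 0)"
    by (intro eq_matI) auto
  also have "free_value R (det \<dots>) = cdet n (\<lambda>i j. if i = j then c else \<zero>)"
    unfolding free_value_det using assms by (intro cdet_cong) auto
  finally show ?thesis by simp
qed

lemma finsum_in_subring:
  assumes S: "subring S R" and f: "\<And>i. i \<in> I \<Longrightarrow> f i \<in> S"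
  shows "(\<Oplus>i\<in>I. f i) \<in> S"
proof (cases "finite I")
  case True
  then show ?thesis using f
  proof (induction I rule: finite_induct)
    case (insert x F)
    then have "f \<in> F \<rightarrow> carrier R" "f x \<in> carrier R" using subringE(1)[OF S] by auto
    then show ?case using insert by (simp add: subringE(7)[OF S])
  qed (simp add: subringE(2)[OF S])
qed (simp add: finsum_infinite subringE(2)[OF S])

lemma finprod_in_subring:
  assumes S: "subring S R" and f: "\<And>i. i \<in> I \<Longrightarrow> f i \<in> S"
  shows "(\<Otimes>i\<in>I. f i) \<in> S"
proof (cases "finite I")
  case True
  then show ?thesis using f
  proof (induction I rule: finite_induct)
    case (insert x F)
    then have "f \<in> F \<rightarrow> carrier R" "f x \<in> carrier R" using subringE(1)[OF S] by auto
    then show ?case using insert by (simp add: subringE(6)[OF S])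
  qed (simp add: subringE(3)[OF S])
qed (simp add: subringE(3)[OF S])

lemma cdet_closed:
  assumes "subring S R" "\<And>i j. i < n \<Longrightarrow> j < n \<Longrightarrow> A i j \<in> S"
  shows "cdet n A \<in> S"
proof -
  have "\<ominus> \<one> \<in> S" using subringE(3,5)[OF assms(1)] by blast
  then show ?thesis unfolding cdet_def
    by (intro finsum_in_subring[OF assms(1)] subringE(6)[OF assms(1)] finprod_in_subring[OF assms(1)])
      (auto intro: assms(2) permutes_lessThan subringE(3)[OF assms(1)])
qed

text \<open>Exactly one permutation, the cycle \<open>q\<close> below, can contribute to the Leibniz
  sum. The sign of this cycle is left open.\<close>

lemma cdet_companion:
  assumes "a \<in> carrier R" "n > 0"
  shows "cdet n (\<lambda>i j. if i = Suc j then \<one> else if i = 0 \<and> Suc j = n then a else \<zero>) \<in> {a, \<ominus> a}"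
    (is "cdet n ?A \<in> _")
proof -
  let ?s = "\<lambda>p. if evenperm p then \<one> else \<ominus> \<one>"
  define q where "q i = (if i < n then (if i = 0 then n - 1 else i - 1) else i)" for i
  have q: "q permutes {..<n}"
    unfolding permutes_altdef
  proof
    have "q ` {..<n} \<subseteq> {..<n}" "inj_on q {..<n}" using assms(2) by (auto simp: q_def inj_on_def split: if_splits)
    then show "bij_betw q {..<n} {..<n}"
      by (simp add: bij_betw_def endo_inj_surj)
    show "{x. q x \<noteq> x} \<subseteq> {..<n}" by (auto simp: q_def split: if_splits)
  qed
  \<comment> \<open>Row \<open>i\<close> has its only possibly nonzero entry in column
    \<open>q i\<close>, so any other permutation meets a zero.\<close>
  have zero: "(\<Otimes>i\<in>{..<n}. ?A i (p i)) = \<zero>" if p: "p permutes {..<n}" "p \<noteq> q" for p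
  proof -
    obtain i where i: "p i \<noteq> q i" using p(2) by blast
    moreover have "p j = j" if "\<not> j < n" for j using p(1) that by (simp add: permutes_def)
    ultimately have "i < n" by (metis q_def)
    then have "p i < n" using permutes_in_image[OF p(1), of i] by simp
    then have "?A i (p i) = \<zero>" using i \<open>i < n\<close> by (auto simp: q_def split: if_splits)
    moreover have "{..<n} = insert i ({..<n} - {i})" using \<open>i < n\<close> by auto
    ultimately show ?thesis using assms by (subst \<open>{..<n} = _\<close>, subst finprod_insert) auto
  qed
  have one: "(\<Otimes>i\<in>{..<n}. ?A i (q i)) = a"
  proof -
    have "{..<n} = insert 0 {1..<n}" using assms(2) by auto
    moreover have "(\<Otimes>i\<in>{1..<n}. ?A i (q i)) = \<one>"
      by (rule finprod_one_eqI) (auto simp: q_def)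
    moreover have "?A 0 (q 0) = a" using assms by (auto simp: q_def)
    ultimately show ?thesis using assms by (simp del: One_nat_def add: finprod_insert)
  qed
  have "cdet n ?A = (\<Oplus>p\<in>{p. p permutes {..<n}}. if p = q then ?s q \<otimes> a else \<zero>)"
    unfolding cdet_def using assms one zero by (intro finsum_cong') (auto simp del: if_split simp: Pi_def)
  also have "\<dots> = ?s q \<otimes> a"
    using add.finprod_singleton_swap[of q "{p. p permutes {..<n}}" "\<lambda>_. ?s q \<otimes> a"] q assms
    by (simp add: finite_permutations finsum_singleton eq_commute)
  finally show ?thesis using assms by (auto simp: l_minus)
qed

end

section \<open>Linear algebra over a subfield\<close>

locale cring_subfield = cring R for R (structure) +
  fixes K assumes subfield: "subfield K R"
begin

lemma K_carrier [simp]: "k \<in> K \<Longrightarrow> k \<in> carrier R"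
  using subfieldE(3)[OF subfield] by blast

lemma K_subring: "subring K R"
  by (rule subfieldE(1)[OF subfield])

lemmas K_zero [simp] = subringE(2)[OF K_subring]
  and K_one [simp] = subringE(3)[OF K_subring]
  and K_neg [simp] = subringE(5)[OF K_subring]
  and K_mult [simp] = subringE(6)[OF K_subring]
  and K_add [simp] = subringE(7)[OF K_subring]

lemma one_neq_zero [simp]: "\<one> \<noteq> \<zero>" "\<zero> \<noteq> \<one>"
  using subfieldE(6)[OF subfield] by auto

lemma K_inv: "k \<in> K \<Longrightarrow> k \<noteq> \<zero> \<Longrightarrow> inv k \<in> K" "k \<in> K \<Longrightarrow> k \<noteq> \<zero> \<Longrightarrow> k \<otimes> inv k = \<one>"
  "k \<in> K \<Longrightarrow> k \<noteq> \<zero> \<Longrightarrow> inv k \<otimes> k = \<one>"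
  using subfield_m_inv[OF subfield, of k] by auto

lemma K_Units: "k \<in> K \<Longrightarrow> k \<noteq> \<zero> \<Longrightarrow> k \<in> Units R"
  using K_inv[of k] unfolding Units_def by (auto intro!: bexI[of _ "inv k"])

lemma K_pow [simp]: "k \<in> K \<Longrightarrow> k [^] (n::nat) \<in> K"
  by (induction n) auto

lemma K_minus [simp]: "k \<in> K \<Longrightarrow> l \<in> K \<Longrightarrow> k \<ominus> l \<in> K"
  by (simp add: a_minus_def)

lemma K_integral: "k \<in> K \<Longrightarrow> x \<in> carrier R \<Longrightarrow> k \<otimes> x = \<zero> \<Longrightarrow> k \<noteq> \<zero> \<Longrightarrow> x = \<zero>"
  by (metis K_Units Units_l_cancel r_null zero_closed K_carrier)

lemma K_finsum: "(\<And>i. i \<in> I \<Longrightarrow> f i \<in> K) \<Longrightarrow> (\<Oplus>i\<in>I. f i) \<in> K"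
  by (rule finsum_in_subring[OF K_subring])

section \<open>Linear combinations, spans and independence\<close>

definition lcomb :: "('i \<Rightarrow> 'a) \<Rightarrow> ('i \<Rightarrow> 'a) \<Rightarrow> 'i set \<Rightarrow> 'a" where
  "lcomb c v I = (\<Oplus>i\<in>I. c i \<otimes> v i)"

text \<open>Coefficient functions take values in \<open>K\<close> at every index, not only on
  \<open>I\<close>; this keeps closure conditions free of index restrictions, and values off
  \<open>I\<close> do not enter the sum.\<close>

definition lspan :: "('i \<Rightarrow> 'a) \<Rightarrow> 'i set \<Rightarrow> 'a set" where
  "lspan v I = {lcomb c v I |c. \<forall>i. c i \<in> K}"

definition lindep :: "('i \<Rightarrow> 'a) \<Rightarrow> 'i set \<Rightarrow> bool" where
  "lindep v I \<longleftrightarrow> (\<forall>c. (\<forall>i. c i \<in> K) \<longrightarrow> lcomb c v I = \<zero> \<longrightarrow> (\<forall>i\<in>I. c i = \<zero>))"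

lemma lindepD: "lindep v I \<Longrightarrow> (\<And>i. c i \<in> K) \<Longrightarrow> lcomb c v I = \<zero> \<Longrightarrow> i \<in> I \<Longrightarrow> c i = \<zero>"
  unfolding lindep_def by blast

lemma lcomb_closed [simp]: "(\<And>i. c i \<in> K) \<Longrightarrow> v \<in> I \<rightarrow> carrier R \<Longrightarrow> lcomb c v I \<in> carrier R"
  unfolding lcomb_def by (rule finsum_closed) auto

lemma lspanI: "(\<And>i. c i \<in> K) \<Longrightarrow> lcomb c v I \<in> lspan v I"
  unfolding lspan_def by blast

lemma lspanE:
  assumes "x \<in> lspan v I" obtains c where "\<And>i. c i \<in> K" "x = lcomb c v I"
  using assms unfolding lspan_def by blast

lemma lspan_carrier: "v \<in> I \<rightarrow> carrier R \<Longrightarrow> lspan v I \<subseteq> carrier R"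
  unfolding lspan_def by auto

lemma lcomb_add:
  assumes "\<And>i. c i \<in> K" "\<And>i. d i \<in> K" "v \<in> I \<rightarrow> carrier R"
  shows "lcomb (\<lambda>i. c i \<oplus> d i) v I = lcomb c v I \<oplus> lcomb d v I"
proof -
  have "lcomb (\<lambda>i. c i \<oplus> d i) v I = (\<Oplus>i\<in>I. c i \<otimes> v i \<oplus> d i \<otimes> v i)"
    unfolding lcomb_def using assms by (intro finsum_cong') (auto simp: l_distr Pi_iff)
  also have "\<dots> = lcomb c v I \<oplus> lcomb d v I"
    unfolding lcomb_def using assms by (intro finsum_addf) (auto simp: Pi_iff)
  finally show ?thesis .
qed

lemma lcomb_scale:
  assumes "\<And>i. c i \<in> K" "k \<in> carrier R" "v \<in> I \<rightarrow> carrier R"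
  shows "lcomb (\<lambda>i. k \<otimes> c i) v I = k \<otimes> lcomb c v I"
proof (cases "finite I")
  case True
  then show ?thesis unfolding lcomb_def using assms
    by (subst finsum_rdistr) (auto intro!: finsum_cong' simp: m_assoc Pi_iff)
qed (use assms in \<open>simp add: lcomb_def finsum_infinite\<close>)

lemma lspan_add: "v \<in> I \<rightarrow> carrier R \<Longrightarrow> x \<in> lspan v I \<Longrightarrow> y \<in> lspan v I \<Longrightarrow> x \<oplus> y \<in> lspan v I"
  by (elim lspanE, simp only: lcomb_add[symmetric]) (rule lspanI, simp)

lemma lspan_scale: "v \<in> I \<rightarrow> carrier R \<Longrightarrow> k \<in> K \<Longrightarrow> x \<in> lspan v I \<Longrightarrow> k \<otimes> x \<in> lspan v I"
  by (elim lspanE, simp only: lcomb_scale[symmetric] K_carrier) (rule lspanI, simp)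

lemma lcomb_zero: "v \<in> I \<rightarrow> carrier R \<Longrightarrow> lcomb (\<lambda>_. \<zero>) v I = \<zero>"
  unfolding lcomb_def by (rule add.finprod_one_eqI) (auto simp: Pi_iff)

lemma lspan_zero: "v \<in> I \<rightarrow> carrier R \<Longrightarrow> \<zero> \<in> lspan v I"
  using lspanI[of "\<lambda>_. \<zero>" v I] by (simp add: lcomb_zero)

lemma lspan_neg: "v \<in> I \<rightarrow> carrier R \<Longrightarrow> x \<in> lspan v I \<Longrightarrow> \<ominus> x \<in> lspan v I"
  using lspan_scale[of v I "\<ominus> \<one>" x] lspan_carrier[of v I] by (auto simp: l_minus subset_eq)

lemma lspan_finsum:
  assumes "v \<in> I \<rightarrow> carrier R" "\<And>j. j \<in> J \<Longrightarrow> f j \<in> lspan v I"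
  shows "(\<Oplus>j\<in>J. f j) \<in> lspan v I"
proof (cases "finite J")
  case True
  then show ?thesis using assms(2)
  proof (induction J rule: finite_induct)
    case (insert j J)
    then have "f \<in> J \<rightarrow> carrier R" "f j \<in> carrier R" using lspan_carrier[OF assms(1)] by auto
    then show ?case using insert assms(1) by (simp add: lspan_add)
  qed (simp add: lspan_zero assms(1))
qed (simp add: finsum_infinite lspan_zero assms(1))

lemma lcomb_delta:
  assumes "v \<in> I \<rightarrow> carrier R" "finite I" "j \<in> I" "k \<in> K"
  shows "lcomb (\<lambda>i. if i = j then k else \<zero>) v I = k \<otimes> v j"
proof -
  have "lcomb (\<lambda>i. if i = j then k else \<zero>) v I = (\<Oplus>i\<in>I. if j = i then k \<otimes> v i else \<zero>)"
    unfolding lcomb_def using assms by (intro finsum_cong') (auto simp: Pi_iff)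
  also have "\<dots> = k \<otimes> v j"
    using assms by (intro finsum_singleton) (auto simp: Pi_iff)
  finally show ?thesis .
qed

lemma lspan_base:
  assumes "v \<in> I \<rightarrow> carrier R" "finite I" "j \<in> I" shows "v j \<in> lspan v I"
proof -
  have "v j = lcomb (\<lambda>i. if i = j then \<one> else \<zero>) v I"
    using lcomb_delta[OF assms, of \<one>] assms by (simp add: Pi_iff)
  moreover have "lcomb (\<lambda>i. if i = j then \<one> else \<zero>) v I \<in> lspan v I"
    by (rule lspanI) simp
  ultimately show ?thesis by simp
qed

lemma lcomb_in:
  assumes "w \<in> J \<rightarrow> lspan v I" "v \<in> I \<rightarrow> carrier R" "\<And>i. c i \<in> K"
  shows "lcomb c w J \<in> lspan v I"
  unfolding lcomb_def using assms by (intro lspan_finsum) (auto intro: lspan_scale)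

lemma lcomb_unique:
  assumes "lindep v I" "v \<in> I \<rightarrow> carrier R" "\<And>i. c i \<in> K" "\<And>i. d i \<in> K"
    "lcomb c v I = lcomb d v I" "i \<in> I"
  shows "c i = d i"
proof -
  have cl: "lcomb d v I \<in> carrier R" using assms(2,4) by simp
  have "lcomb (\<lambda>i. c i \<oplus> \<ominus> \<one> \<otimes> d i) v I = lcomb c v I \<oplus> lcomb (\<lambda>i. \<ominus> \<one> \<otimes> d i) v I"
    using assms(2,3,4) by (intro lcomb_add) auto
  also have "lcomb (\<lambda>i. \<ominus> \<one> \<otimes> d i) v I = \<ominus> \<one> \<otimes> lcomb d v I"
    using assms(2,4) by (intro lcomb_scale) auto
  also have "lcomb c v I \<oplus> \<ominus> \<one> \<otimes> lcomb d v I = \<zero>"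
    unfolding assms(5) using cl by (simp add: l_minus r_neg)
  finally have "c i \<oplus> \<ominus> \<one> \<otimes> d i = \<zero>"
    by (rule lindepD[OF assms(1), rotated]) (use assms(3,4,6) in auto)
  moreover have "c i \<in> carrier R" "d i \<in> carrier R" using assms(3,4) by auto
  ultimately show ?thesis using r_right_minus_eq[of "c i" "d i"] by (simp add: l_minus a_minus_def)
qed

lemma lcomb_insert:
  assumes "finite I" "j \<notin> I" "v \<in> insert j I \<rightarrow> carrier R" "\<And>i. c i \<in> K"
  shows "lcomb c v (insert j I) = c j \<otimes> v j \<oplus> lcomb c v I"
  unfolding lcomb_def using assms by (subst finsum_insert) (auto simp: Pi_iff)

lemma lcomb_cong:
  assumes "\<And>i. i \<in> I \<Longrightarrow> c i = d i" "\<And>i. i \<in> I \<Longrightarrow> v i = w i" "\<And>i. d i \<in> K" "w \<in> I \<rightarrow> carrier R"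
  shows "lcomb c v I = lcomb d w I"
  unfolding lcomb_def using assms by (intro finsum_cong') (auto simp: Pi_iff)

lemma lindep_insert:
  assumes "lindep v I" "finite I" "j \<notin> I" "v \<in> insert j I \<rightarrow> carrier R" "v j \<notin> lspan v I"
  shows "lindep v (insert j I)"
  unfolding lindep_def
proof (intro allI impI)
  fix c assume c: "\<forall>i. c i \<in> K" "lcomb c v (insert j I) = \<zero>"
  have v: "v \<in> I \<rightarrow> carrier R" "v j \<in> carrier R" using assms(4) by auto
  have eq: "c j \<otimes> v j \<oplus> lcomb c v I = \<zero>" using c assms lcomb_insert by metis
  have cj: "c j = \<zero>"
  proof (rule ccontr)
    assume nz: "c j \<noteq> \<zero>"
    have "c j \<otimes> v j = \<ominus> lcomb c v I"
      using minus_equality[OF eq] c v by simp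
    then have "c j \<otimes> v j \<in> lspan v I" using c v by (simp add: lspan_neg lspanI)
    then have "inv (c j) \<otimes> (c j \<otimes> v j) \<in> lspan v I" using c nz v
      by (rule_tac lspan_scale) (auto simp: K_inv)
    moreover have "inv (c j) \<otimes> (c j \<otimes> v j) = v j"
      using c nz v by (subst m_assoc[symmetric]) (auto simp: K_inv)
    ultimately show False using assms(5) by simp
  qed
  then have "lcomb c v I = \<zero>" using eq c v by simp
  then show "\<forall>i\<in>insert j I. c i = \<zero>" using assms(1) c cj unfolding lindep_def by auto
qed

text \<open>Gaussian elimination, by induction on the spanning set. If some \<open>w k\<close>
  involves the new vector \<open>v x\<close>, subtracting multiples of it from the other
  \<open>w j\<close> clears \<open>v x\<close> there and costs one vector.\<close>

lemma lindep_card_le: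
  assumes "finite I" "finite J" "v \<in> I \<rightarrow> carrier R" "w \<in> J \<rightarrow> lspan v I" "lindep w J"
  shows "card J \<le> card I"
  using assms
proof (induction I arbitrary: J w rule: finite_induct)
  case empty
  have "J = {}"
  proof (rule ccontr)
    assume "J \<noteq> {}" then obtain j where j: "j \<in> J" by blast
    have w0: "w i = \<zero>" if "i \<in> J" for i using empty that by (auto simp: lspan_def lcomb_def Pi_iff)
    then have "lcomb (\<lambda>_. \<one>) w J = \<zero>" unfolding lcomb_def by (intro add.finprod_one_eqI) auto
    then show False using empty(4) j unfolding lindep_def by (metis K_one one_neq_zero(1))
  qed
  then show ?case by simp
next
  case (insert x I)
  have v: "v \<in> I \<rightarrow> carrier R" "v x \<in> carrier R" using insert.prems by auto
  have "\<exists>y a. y \<in> lspan v I \<and> a \<in> K \<and> w j = y \<oplus> a \<otimes> v x" if j: "j \<in> J" for j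
  proof -
    obtain c where c: "\<And>i. c i \<in> K" "w j = lcomb c v (insert x I)"
      by (rule lspanE[of "w j" v "insert x I"]) (use insert.prems(3) j in auto)
    then have "w j = lcomb c v I \<oplus> c x \<otimes> v x"
      using insert v lcomb_insert[of I x v c] by (simp add: a_comm)
    then show ?thesis using c lspanI by blast
  qed
  then obtain y a where ya: "\<And>j. j \<in> J \<Longrightarrow> y j \<in> lspan v I \<and> a j \<in> K \<and> w j = y j \<oplus> a j \<otimes> v x"
    by metis
  have yc: "\<And>j. j \<in> J \<Longrightarrow> y j \<in> carrier R" using ya lspan_carrier[OF v(1)] by blast
  show ?case
  proof (cases "\<forall>j\<in>J. a j = \<zero>")
    case True
    then have "w \<in> J \<rightarrow> lspan v I" using ya v yc by auto
    then show ?thesis using insert.IH[of J w] insert.prems insert.hyps v by auto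
  next
    case False
    then obtain k where k: "k \<in> J" "a k \<noteq> \<zero>" by blast
    have aK: "a j \<in> K" if "j \<in> J" for j using ya that by blast
    \<comment> \<open>The factor -a_j/a_k cancels the \<open>v x\<close> component of
      \<open>w j\<close>. The value zero off \<open>J\<close> keeps \<open>r\<close> with values in
      \<open>K\<close> everywhere.\<close>
    define r where "r j = (if j \<in> J then \<ominus> (a j \<otimes> inv (a k)) else \<zero>)" for j
    have r: "r j \<in> K" for j using aK k by (auto simp: r_def K_inv)
    define w' where "w' j = w j \<oplus> r j \<otimes> w k" for j
    have wc: "w \<in> J \<rightarrow> carrier R" using insert.prems lspan_carrier by blast
    have "w' j \<in> lspan v I" if j: "j \<in> J - {k}" for j
    proof -
      have "r j \<otimes> a k = \<ominus> a j" using j k aK by (simp add: r_def l_minus m_assoc K_inv)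
      then have 1: "r j \<otimes> (a k \<otimes> v x) = \<ominus> (a j \<otimes> v x)"
        using aK[OF k(1)] aK[of j] j v r by (simp add: m_assoc[symmetric] l_minus)
      have "w' j = (y j \<oplus> a j \<otimes> v x) \<oplus> (r j \<otimes> y k \<oplus> r j \<otimes> (a k \<otimes> v x))"
        using ya[of j] ya[OF k(1)] j k aK yc v r by (simp add: w'_def r_distr)
      also have "\<dots> = y j \<oplus> r j \<otimes> y k"
        unfolding 1 using j k aK yc v r by (simp add: a_ac r_neg1 r_neg2 r_neg)
      finally show ?thesis using ya j k r v by (auto intro: lspan_add lspan_scale)
    qed
    moreover have "lindep w' (J - {k})"
      unfolding lindep_def
    proof (intro allI impI)
      fix c assume c: "\<forall>i. c i \<in> K" "lcomb c w' (J - {k}) = \<zero>"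
      \<comment> \<open>A relation among the \<open>w' j\<close> is a relation among the
        \<open>w j\<close>; the multiples of \<open>w k\<close> hidden in them add up to the
        coefficient \<open>s\<close>.\<close>
      define s where "s = (\<Oplus>j\<in>J-{k}. c j \<otimes> r j)"
      have s: "s \<in> K" unfolding s_def using c r by (intro K_finsum) auto
      define d where "d j = (if j = k then s else c j)" for j
      have "lcomb c w' (J - {k}) = (\<Oplus>j\<in>J-{k}. c j \<otimes> w j \<oplus> c j \<otimes> r j \<otimes> w k)"
        unfolding lcomb_def w'_def using c r wc k
        by (intro finsum_cong') (auto simp: r_distr m_assoc Pi_iff)
      also have "\<dots> = lcomb c w (J - {k}) \<oplus> s \<otimes> w k"
        unfolding lcomb_def s_def using c r wc k insert.prems(1)
        by (subst finsum_addf) (auto simp: Pi_iff finsum_ldistr)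
      also have "lcomb c w (J - {k}) = lcomb d w (J - {k})"
        using c s wc by (intro lcomb_cong) (auto simp: d_def)
      also have "\<dots> \<oplus> s \<otimes> w k = lcomb d w (insert k (J - {k}))"
        using c s wc k insert.prems(1)
        by (subst lcomb_insert) (auto simp: d_def Pi_iff intro!: a_comm lcomb_closed)
      also have "insert k (J - {k}) = J" using k by blast
      finally have "lcomb d w J = \<zero>" using c by simp
      moreover have "d j \<in> K" for j using c s by (simp add: d_def)
      ultimately have "\<forall>j\<in>J. d j = \<zero>" using lindepD[OF insert.prems(4)] by blast
      then show "\<forall>i\<in>J - {k}. c i = \<zero>" unfolding d_def by (metis DiffE singletonI)
    qed
    ultimately have "card (J - {k}) \<le> card I"
      using insert.IH[of "J - {k}" w'] insert.prems(1) v by auto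
    then show ?thesis using k insert.prems(1) insert.hyps by simp
  qed
qed

text \<open>A vector of \<open>lspan v I\<close> outside \<open>lspan w I\<close> could be added to
  the family \<open>w\<close>, giving one independent vector more than \<open>lindep_card_le\<close>
  permits.\<close>

lemma lspan_eq_if_card:
  assumes "finite I" "v \<in> I \<rightarrow> carrier R" "w \<in> I \<rightarrow> lspan v I" "lindep w I"
  shows "lspan w I = lspan v I"
proof
  have wc: "w \<in> I \<rightarrow> carrier R" using assms lspan_carrier by blast
  show "lspan w I \<subseteq> lspan v I"
    using assms by (auto elim!: lspanE intro: lcomb_in)
  show "lspan v I \<subseteq> lspan w I"
  proof
    fix x assume x: "x \<in> lspan v I"
    show "x \<in> lspan w I"
    proof (rule ccontr)
      assume nx: "x \<notin> lspan w I"
      have xc: "x \<in> carrier R" using x lspan_carrier[OF assms(2)] by blast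
      \<comment> \<open>The option type supplies an index for the additional vector:
        \<open>None\<close> carries \<open>x\<close>.\<close>
      define w' where "w' j = (case j of None \<Rightarrow> x | Some i \<Rightarrow> w i)" for j
      have lc: "lcomb c w' (Some ` I) = lcomb (\<lambda>i. c (Some i)) w I" if "\<forall>i. c i \<in> K" for c
        unfolding lcomb_def using that wc
        by (subst finsum_reindex) (auto simp: w'_def Pi_iff intro!: finsum_cong')
      have "lindep w' (Some ` I)"
        using assms(4) unfolding lindep_def by (auto simp: lc)
      moreover have "lspan w' (Some ` I) \<subseteq> lspan w I"
        by (auto elim!: lspanE simp: lc intro!: lspanI)
      ultimately have "lindep w' (insert None (Some ` I))"
        using nx wc xc assms(1) by (intro lindep_insert) (auto simp: w'_def)
      then have "card (insert None (Some ` I)) \<le> card I"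
        using assms x by (intro lindep_card_le[of I _ v w']) (auto simp: w'_def)
      then show False using assms(1) by (simp add: card_image)
    qed
  qed
qed

end

lemma (in abelian_monoid) finsum_swap:
  assumes "finite A" "finite B" "\<And>i j. i \<in> A \<Longrightarrow> j \<in> B \<Longrightarrow> f i j \<in> carrier G"
  shows "(\<Oplus>i\<in>A. \<Oplus>j\<in>B. f i j) = (\<Oplus>j\<in>B. \<Oplus>i\<in>A. f i j)"
  using assms
proof (induction A rule: finite_induct)
  case empty
  show ?case by (simp add: add.finprod_one_eqI)
next
  case (insert x A)
  then have "(\<Oplus>i\<in>insert x A. \<Oplus>j\<in>B. f i j) = (\<Oplus>j\<in>B. f x j) \<oplus> (\<Oplus>j\<in>B. \<Oplus>i\<in>A. f i j)"
    by (subst finsum_insert) (auto intro!: finsum_closed)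
  also have "\<dots> = (\<Oplus>j\<in>B. f x j \<oplus> (\<Oplus>i\<in>A. f i j))"
    using insert by (intro finsum_addf[symmetric]) (auto intro!: finsum_closed)
  also have "\<dots> = (\<Oplus>j\<in>B. \<Oplus>i\<in>insert x A. f i j)"
    using insert by (intro finsum_cong') (auto intro!: finsum_closed)
  finally show ?case .
qed

context cring_subfield
begin

text \<open>The first vector lying in the span of its predecessors is selected. For a sequence of
  powers this makes the span of the predecessors stable under multiplication.\<close>

lemma lindep_least:
  fixes v :: "nat \<Rightarrow> 'a"
  assumes "\<not> lindep v {..<n}" "v \<in> {..<n} \<rightarrow> carrier R"
  obtains m where "m < n" "lindep v {..<m}" "v m \<in> lspan v {..<m}"
proof -
  have step: "lindep v {..<Suc m}" if "m < n" "lindep v {..<m}" "v m \<notin> lspan v {..<m}" for m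
    unfolding lessThan_Suc using assms that by (intro lindep_insert) (auto simp: Pi_iff)
  have "\<exists>m<n. lindep v {..<m} \<and> v m \<in> lspan v {..<m}"
  proof (rule ccontr)
    assume no: "\<not> ?thesis"
    have "m \<le> n \<Longrightarrow> lindep v {..<m}" for m
    proof (induction m)
      case (Suc m)
      then show ?case using step[of m] no by auto
    qed (simp add: lindep_def)
    then show False using assms(1) by blast
  qed
  then show ?thesis using that by blast
qed

section \<open>Coordinates and determinants of multiplication maps\<close>

definition coords :: "('i \<Rightarrow> 'a) \<Rightarrow> 'i set \<Rightarrow> 'a \<Rightarrow> 'i \<Rightarrow> 'a" where
  "coords v I x = (SOME c. (\<forall>i. c i \<in> K) \<and> x = lcomb c v I)"

lemma coords:
  assumes "x \<in> lspan v I"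
  shows "coords v I x i \<in> K" "lcomb (coords v I x) v I = x"
proof -
  have "\<exists>c. (\<forall>i. c i \<in> K) \<and> x = lcomb c v I"
    using assms by (auto simp: lspan_def)
  from someI_ex[OF this] have "(\<forall>i. coords v I x i \<in> K) \<and> x = lcomb (coords v I x) v I"
    unfolding coords_def .
  then show "coords v I x i \<in> K" "lcomb (coords v I x) v I = x" by auto
qed

lemma coords_lcomb:
  assumes "lindep v I" "v \<in> I \<rightarrow> carrier R" "\<And>i. c i \<in> K" "i \<in> I"
  shows "coords v I (lcomb c v I) i = c i"
proof -
  have "lcomb c v I \<in> lspan v I" using assms(3) by (rule lspanI)
  from lcomb_unique[OF assms(1,2) coords(1)[OF this] assms(3) coords(2)[OF this] assms(4)]
  show ?thesis .
qed

lemma mult_lcomb: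
  assumes "x \<in> carrier R" "\<And>i. c i \<in> K" "v \<in> I \<rightarrow> carrier R"
  shows "x \<otimes> lcomb c v I = lcomb c (\<lambda>i. x \<otimes> v i) I"
proof (cases "finite I")
  case True
  then show ?thesis unfolding lcomb_def using assms
    by (subst finsum_rdistr) (auto intro!: finsum_cong' simp: m_lcomm Pi_iff)
qed (use assms in \<open>simp add: lcomb_def finsum_infinite\<close>)

text \<open>
  \<open>stab v n\<close> consists of the elements whose multiplication maps the span of \<open>v 0, \<dots>, v (n - 1)\<close>
  into itself; for independent \<open>v\<close>, \<open>fnorm v n x\<close> is the determinant of this endomorphism.
\<close>

definition stab :: "(nat \<Rightarrow> 'a) \<Rightarrow> nat \<Rightarrow> 'a set" where
  "stab v n = {x \<in> carrier R. \<forall>j<n. x \<otimes> v j \<in> lspan v {..<n}}"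

definition fnorm :: "(nat \<Rightarrow> 'a) \<Rightarrow> nat \<Rightarrow> 'a \<Rightarrow> 'a" where
  "fnorm v n x = cdet n (\<lambda>i j. coords v {..<n} (x \<otimes> v j) i)"

lemma stab_lspan:
  assumes "v \<in> {..<n} \<rightarrow> carrier R" "x \<in> stab v n" "y \<in> lspan v {..<n}"
  shows "x \<otimes> y \<in> lspan v {..<n}"
proof -
  obtain c where c: "\<And>i. c i \<in> K" "y = lcomb c v {..<n}" using assms(3) by (rule lspanE) blast
  have "lcomb c (\<lambda>i. x \<otimes> v i) {..<n} \<in> lspan v {..<n}"
    using assms c by (intro lcomb_in) (auto simp: stab_def)
  then show ?thesis using c assms by (simp add: mult_lcomb stab_def)
qed

lemma stab_mult:
  assumes "v \<in> {..<n} \<rightarrow> carrier R" "x \<in> stab v n" "y \<in> stab v n"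
  shows "x \<otimes> y \<in> stab v n"
proof -
  have "x \<in> carrier R" "y \<in> carrier R" using assms by (auto simp: stab_def)
  moreover have "x \<otimes> (y \<otimes> v j) \<in> lspan v {..<n}" if "j < n" for j
    using assms that by (rule_tac stab_lspan) (auto simp: stab_def)
  ultimately show ?thesis using assms(1) by (auto simp: stab_def m_assoc Pi_iff)
qed

lemma stab_scalar:
  assumes "v \<in> {..<n} \<rightarrow> carrier R" "c \<in> K" "x \<in> carrier R" "\<And>j. j < n \<Longrightarrow> x \<otimes> v j = c \<otimes> v j"
  shows "x \<in> stab v n"
  using assms by (auto simp: stab_def intro!: lspan_scale lspan_base)

lemma stab_pow:
  assumes "v \<in> {..<n} \<rightarrow> carrier R" "x \<in> stab v n"
  shows "x [^] (k::nat) \<in> stab v n"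
  using assms by (induction k) (auto intro: stab_mult stab_scalar[of v n \<one>] simp: Pi_iff)

lemma fnorm_closed:
  assumes "x \<in> stab v n" shows "fnorm v n x \<in> K"
  unfolding fnorm_def using assms
  by (intro cdet_closed[OF K_subring]) (auto simp: stab_def coords)

text \<open>Composition of multiplications corresponds to the product of their matrices, because
  coordinates with respect to an independent family are unique; \<open>cdet_mult\<close> then
  applies.\<close>

lemma fnorm_mult:
  assumes "v \<in> {..<n} \<rightarrow> carrier R" "lindep v {..<n}" "x \<in> stab v n" "y \<in> stab v n"
  shows "fnorm v n (x \<otimes> y) = fnorm v n x \<otimes> fnorm v n y"
proof -
  let ?m = "\<lambda>x i j. coords v {..<n} (x \<otimes> v j) i"
  have xy: "x \<in> carrier R" "y \<in> carrier R" using assms by (auto simp: stab_def)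
  have mK: "?m z i j \<in> K" if "z \<in> stab v n" "j < n" for z i j
    using that by (auto simp: stab_def coords)
  have mv: "z \<otimes> v j = lcomb (\<lambda>i. ?m z i j) v {..<n}" if "z \<in> stab v n" "j < n" for z j
    using that by (simp add: stab_def coords)
  have "?m (x \<otimes> y) i j = (\<Oplus>k\<in>{..<n}. ?m x i k \<otimes> ?m y k j)" if ij: "i < n" "j < n" for i j
  proof -
    define s where "s i = (\<Oplus>k\<in>{..<n}. ?m x i k \<otimes> ?m y k j)" for i
    have s: "s i \<in> K" for i unfolding s_def using mK assms ij by (intro K_finsum) auto
    have "x \<otimes> y \<otimes> v j = x \<otimes> lcomb (\<lambda>i. ?m y i j) v {..<n}"
      unfolding mv[OF assms(4) ij(2), symmetric] using ij assms xy by (simp add: m_assoc Pi_iff)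
    also have "\<dots> = lcomb (\<lambda>i. ?m y i j) (\<lambda>k. x \<otimes> v k) {..<n}"
      using assms xy ij by (intro mult_lcomb) (auto simp: mK)
    also have "\<dots> = (\<Oplus>k\<in>{..<n}. ?m y k j \<otimes> (\<Oplus>i\<in>{..<n}. ?m x i k \<otimes> v i))"
      unfolding lcomb_def[of _ "\<lambda>k. x \<otimes> v k"]
      using mv[OF assms(3), unfolded lcomb_def] mK assms ij xy
      by (intro finsum_cong' refl arg_cong2[of _ _ _ _ "(\<otimes>)"])
        (auto simp: Pi_iff intro!: finsum_closed m_closed)
    also have "\<dots> = (\<Oplus>k\<in>{..<n}. \<Oplus>i\<in>{..<n}. ?m x i k \<otimes> ?m y k j \<otimes> v i)"
      using assms mK ij
      by (intro finsum_cong') (auto simp: finsum_rdistr Pi_iff m_ac intro!: finsum_cong' finsum_closed m_closed)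
    also have "\<dots> = (\<Oplus>i\<in>{..<n}. \<Oplus>k\<in>{..<n}. ?m x i k \<otimes> ?m y k j \<otimes> v i)"
      using assms mK ij by (intro finsum_swap) (auto simp: Pi_iff)
    also have "\<dots> = lcomb s v {..<n}"
      unfolding lcomb_def s_def using assms mK ij
      by (intro finsum_cong') (auto simp: finsum_ldistr Pi_iff intro!: finsum_closed m_closed)
    finally have eq: "x \<otimes> y \<otimes> v j = lcomb s v {..<n}" .
    have "coords v {..<n} (lcomb s v {..<n}) i = s i"
      by (rule coords_lcomb[OF assms(2,1) s]) (use ij in simp)
    then show ?thesis unfolding eq by (simp only: s_def)
  qed
  then have "fnorm v n (x \<otimes> y) = cdet n (\<lambda>i j. \<Oplus>k\<in>{..<n}. ?m x i k \<otimes> ?m y k j)"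
    unfolding fnorm_def using mK assms by (intro cdet_cong) (auto intro!: finsum_closed)
  also have "\<dots> = fnorm v n x \<otimes> fnorm v n y"
    unfolding fnorm_def using mK assms by (intro cdet_mult) auto
  finally show ?thesis .
qed

text \<open>The element need not be a scalar itself, it only has to act as one on the given vectors.
  \<open>pow_lindep\<close> uses this form, where \<theta>^p equals c merely after multiplication by
  v.\<close>

lemma fnorm_scalar:
  assumes "v \<in> {..<n} \<rightarrow> carrier R" "lindep v {..<n}" "c \<in> K" "\<And>j. j < n \<Longrightarrow> x \<otimes> v j = c \<otimes> v j"
  shows "fnorm v n x = c [^] n"
proof -
  have "coords v {..<n} (x \<otimes> v j) i = (if i = j then c else \<zero>)" if "i < n" "j < n" for i j
    using coords_lcomb[of v "{..<n}" "\<lambda>i. if i = j then c else \<zero>" i]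
      lcomb_delta[of v "{..<n}" j c] assms that by auto
  then have "fnorm v n x = cdet n (\<lambda>i j. if i = j then c else \<zero>)"
    unfolding fnorm_def using assms(3) by (intro cdet_cong) auto
  then show ?thesis using assms(3) by (simp add: cdet_scalar)
qed

lemma fnorm_pow:
  assumes "v \<in> {..<n} \<rightarrow> carrier R" "lindep v {..<n}" "x \<in> stab v n"
  shows "fnorm v n (x [^] (k::nat)) = fnorm v n x [^] k"
proof (induction k)
  case 0
  show ?case using fnorm_scalar[of v n \<one> \<one>] assms by simp
qed (use assms in \<open>simp add: fnorm_mult stab_pow\<close>)

lemma fnorm_companion:
  assumes "v \<in> {..<n} \<rightarrow> carrier R" "lindep v {..<n}" "n > 0" "a \<in> K"
    "\<And>j. Suc j < n \<Longrightarrow> x \<otimes> v j = v (Suc j)" "x \<otimes> v (n - 1) = a \<otimes> v 0"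
  shows "fnorm v n x \<in> {a, \<ominus> a}"
proof -
  have "coords v {..<n} (x \<otimes> v j) i = (if i = Suc j then \<one> else if i = 0 \<and> Suc j = n then a else \<zero>)"
    if "i < n" "j < n" for i j
  proof (cases "Suc j < n")
    case True
    then show ?thesis
      using coords_lcomb[of v "{..<n}" "\<lambda>i. if i = Suc j then \<one> else \<zero>" i]
        lcomb_delta[of v "{..<n}" "Suc j" \<one>] assms that by (auto simp: Pi_iff)
  next
    case False
    then have j: "j = n - 1" "Suc j = n" using that by auto
    then show ?thesis
      using coords_lcomb[of v "{..<n}" "\<lambda>i. if i = 0 then a else \<zero>" i]
        lcomb_delta[of v "{..<n}" 0 a] assms that by auto
  qed
  then have "fnorm v n x = cdet n (\<lambda>i j. if i = Suc j then \<one> else if i = 0 \<and> Suc j = n then a else \<zero>)"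
    unfolding fnorm_def using assms(4) by (intro cdet_cong) auto
  then show ?thesis using cdet_companion[of a n] assms by simp
qed

lemma Units_neq_zero: "u \<in> Units R \<Longrightarrow> u \<noteq> \<zero>"
  using Units_l_inv[of \<zero>] Units_inv_closed[of \<zero>] by auto

text \<open>With m s = p t + 1 one has c = c^(ms) / c^(pt) = (e^s / c^t)^p.\<close>

lemma root_of_coprime:
  assumes "c \<in> K" "e \<in> K" "e [^] p = c [^] m" "coprime m (p::nat)" "m > 0" "p > 0"
  shows "\<exists>d\<in>K. d [^] p = c"
proof (cases "c = \<zero>")
  case True
  then show ?thesis using assms by (intro bexI[of _ \<zero>]) (auto simp: nat_pow_zero)
next
  case False
  obtain s t where st: "m * s = p * t + 1" using bezout_nat[of m p] assms by auto
  have cu: "c [^] t \<in> Units R" using K_Units[OF assms(1) False] by (rule Units_pow_closed)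
  define d where "d = e [^] s \<otimes> inv (c [^] t)"
  have d: "d \<in> K" using assms K_inv(1)[of "c [^] t"] Units_neq_zero[OF cu] by (auto simp: d_def)
  have "d \<otimes> c [^] t = e [^] s" using cu assms by (simp add: d_def m_assoc)
  then have "d [^] p \<otimes> c [^] (t * p) = e [^] (s * p)"
    using d assms by (simp add: nat_pow_pow[symmetric] nat_pow_distrib[symmetric])
  also have "\<dots> = (e [^] p) [^] s"
    using nat_pow_pow[of e p s] assms(2) by (simp add: mult.commute)
  also have "\<dots> = c [^] (m * s)" unfolding assms(3) using assms(1) by (simp add: nat_pow_pow)
  also have "\<dots> = c \<otimes> c [^] (t * p)" unfolding st using assms by (simp add: nat_pow_mult[symmetric] mult.commute m_comm)
  finally have "d [^] p = c"
    using Units_l_cancel[of "c [^] (t * p)" "d [^] p" c] Units_pow_closed[OF K_Units[OF assms(1) False]]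
      d assms(1) by (simp add: m_comm)
  then show ?thesis using d by blast
qed

text \<open>The generality in \<open>v\<close> matters: \<open>v = \<one>\<close> yields a basis of
  the extension, while an arbitrary nonzero \<open>v\<close> in the extension shows that
  multiplication by \<open>v\<close> is injective, although \<open>R\<close> may have zero
  divisors.\<close>

lemma pow_lindep:
  fixes p :: nat
  assumes p: "Factorial_Ring.prime p" and th: "\<theta> \<in> carrier R" and v: "v \<in> carrier R" "v \<noteq> \<zero>"
    and c: "c \<in> K" "\<theta> [^] p \<otimes> v = c \<otimes> v" "\<not> (\<exists>d\<in>K. d [^] p = c)"
  shows "lindep (\<lambda>i. \<theta> [^] i \<otimes> v) {..<p}"
proof (rule ccontr)
  let ?v = "\<lambda>i::nat. \<theta> [^] i \<otimes> v"
  have vc: "?v \<in> I \<rightarrow> carrier R" for I using th v by auto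
  assume "\<not> lindep ?v {..<p}"
  then obtain m where m: "m < p" "lindep ?v {..<m}" "?v m \<in> lspan ?v {..<m}"
    using lindep_least[of ?v p] vc by blast
  have "m \<noteq> 0"
  proof
    assume "m = 0"
    then have "v \<in> lspan ?v {}" using m(3) v by simp
    then show False using v by (auto simp: lspan_def lcomb_def)
  qed
  have suc: "\<theta> \<otimes> ?v j = ?v (Suc j)" for j
    using th v by (simp add: m_assoc[symmetric] nat_pow_comm m_comm)
  have "\<theta> \<in> stab ?v m"
    unfolding stab_def
  proof (intro CollectI conjI allI impI th)
    fix j assume "j < m"
    then have "Suc j < m \<or> Suc j = m" by auto
    then show "\<theta> \<otimes> ?v j \<in> lspan ?v {..<m}"
      unfolding suc using m(3) lspan_base[of ?v "{..<m}" "Suc j", OF vc] by auto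
  qed
  moreover have "\<theta> [^] p \<otimes> ?v j = c \<otimes> ?v j" for j
  proof -
    have "\<theta> [^] p \<otimes> ?v j = \<theta> [^] j \<otimes> (\<theta> [^] p \<otimes> v)" using th v by (simp add: m_lcomm)
    then show ?thesis using th v c by (simp add: m_lcomm)
  qed
  then have "fnorm ?v m (\<theta> [^] p) = c [^] m"
    by (intro fnorm_scalar[OF vc m(2) c(1)])
  ultimately have "fnorm ?v m \<theta> [^] p = c [^] m" "fnorm ?v m \<theta> \<in> K"
    using fnorm_pow[OF vc m(2), of \<theta> p] by (simp_all add: fnorm_closed)
  moreover have "coprime m p"
    using p m(1) \<open>m \<noteq> 0\<close> by (metis coprime_commute nat_dvd_not_less not_gr0 prime_imp_coprime_nat)
  ultimately have "\<exists>d\<in>K. d [^] p = c"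
    using root_of_coprime c(1) \<open>m \<noteq> 0\<close> m(1) by (metis gr0I not_less_zero)
  then show False using c(3) by simp
qed

end

section \<open>Adjoining a root of prime degree\<close>

lemma (in cring) subfield_criterion:
  assumes "subring S R" "\<one> \<noteq> \<zero>" "\<And>x. x \<in> S \<Longrightarrow> x \<noteq> \<zero> \<Longrightarrow> \<exists>y\<in>S. x \<otimes> y = \<one>"
  shows "subfield S R"
proof (rule subfieldI)
  show "subcring S R" by (rule subcringI'[OF assms(1)])
  have S: "S \<subseteq> carrier R" by (rule subringE(1)[OF assms(1)])
  show "Units (R\<lparr>carrier := S\<rparr>) = S - {\<zero>}"
  proof (intro equalityI subsetI)
    fix x assume "x \<in> Units (R\<lparr>carrier := S\<rparr>)"
    then obtain y where "x \<in> S" "y \<in> S" "x \<otimes> y = \<one>" by (auto simp: Units_def)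
    then show "x \<in> S - {\<zero>}" using S assms(2) by auto
  next
    fix x assume x: "x \<in> S - {\<zero>}"
    then obtain y where "y \<in> S" "x \<otimes> y = \<one>" using assms(3)[of x] by auto
    then show "x \<in> Units (R\<lparr>carrier := S\<rparr>)"
      using x S m_comm[of y x] by (auto simp: Units_def intro!: bexI[of _ y])
  qed
qed

section \<open>Traces and their independence of the basis\<close>

context cring_subfield
begin

lemma coords_linear:
  assumes "lindep v I" "v \<in> I \<rightarrow> carrier R" "finite I" "u \<in> J \<rightarrow> lspan v I" "finite J"
    "\<And>j. c j \<in> K" "i \<in> I"
  shows "coords v I (lcomb c u J) i = (\<Oplus>j\<in>J. c j \<otimes> coords v I (u j) i)"
proof -
  have uK: "coords v I (u j) i \<in> K" if "j \<in> J" for i j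
    using coords(1)[of "u j" v I] that assms(4) by blast
  define d where "d i = (\<Oplus>j\<in>J. c j \<otimes> coords v I (u j) i)" for i
  have d: "d i \<in> K" for i unfolding d_def using uK assms(6) by (intro K_finsum) auto
  have "lcomb c u J = (\<Oplus>j\<in>J. \<Oplus>i\<in>I. c j \<otimes> coords v I (u j) i \<otimes> v i)"
  proof -
    have "c j \<otimes> u j = (\<Oplus>i\<in>I. c j \<otimes> coords v I (u j) i \<otimes> v i)" if j: "j \<in> J" for j
    proof -
      have "u j \<in> lspan v I" using assms(4) j by blast
      then have "c j \<otimes> u j = c j \<otimes> (\<Oplus>i\<in>I. coords v I (u j) i \<otimes> v i)"
        using coords(2)[of "u j" v I] by (simp add: lcomb_def)
      also have "\<dots> = (\<Oplus>i\<in>I. c j \<otimes> (coords v I (u j) i \<otimes> v i))"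
        using assms uK[OF j] by (intro finsum_rdistr) (auto simp: Pi_iff)
      also have "\<dots> = (\<Oplus>i\<in>I. c j \<otimes> coords v I (u j) i \<otimes> v i)"
        using assms uK[OF j] by (intro finsum_cong') (auto simp: Pi_iff m_assoc)
      finally show ?thesis .
    qed
    then show ?thesis unfolding lcomb_def
      using assms uK by (intro finsum_cong') (auto simp: Pi_iff intro!: finsum_closed)
  qed
  also have "\<dots> = (\<Oplus>i\<in>I. \<Oplus>j\<in>J. c j \<otimes> coords v I (u j) i \<otimes> v i)"
    using assms uK by (intro finsum_swap) (auto simp: Pi_iff)
  also have "\<dots> = lcomb d v I"
    unfolding lcomb_def d_def using assms uK
    by (intro finsum_cong') (auto simp: finsum_ldistr Pi_iff intro!: finsum_closed m_closed)
  finally have "coords v I (lcomb c u J) i = d i"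
    using coords_lcomb[OF assms(1,2) d assms(7)] by simp
  then show ?thesis by (simp only: d_def)
qed

definition ftrace :: "(nat \<Rightarrow> 'a) \<Rightarrow> nat \<Rightarrow> 'a \<Rightarrow> 'a" where
  "ftrace v n x = (\<Oplus>i\<in>{..<n}. coords v {..<n} (x \<otimes> v i) i)"

text \<open>Both traces equal one double sum that mixes the coordinates of the \<open>v i\<close> in
  terms of \<open>w\<close> with those of the \<open>x \<otimes> w k\<close> in terms of
  \<open>v\<close>; this is the identity tr(PQ) = tr(QP).\<close>

lemma ftrace_basis_change:
  assumes v: "lindep v {..<n}" "v \<in> {..<n} \<rightarrow> carrier R"
    and w: "lindep w {..<n}" "w \<in> {..<n} \<rightarrow> carrier R"
    and vw: "lspan w {..<n} = lspan v {..<n}" and x: "x \<in> stab v n"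
  shows "ftrace v n x = ftrace w n x"
proof -
  let ?I = "{..<n}"
  have xc: "x \<in> carrier R" using x by (simp add: stab_def)
  have inV: "v i \<in> lspan v ?I" "w i \<in> lspan v ?I" if "i < n" for i
    using lspan_base[of v ?I i] lspan_base[of w ?I i] that v w vw by auto
  have xV: "x \<otimes> y \<in> lspan v ?I" if "y \<in> lspan v ?I" for y
    using stab_lspan[OF v(2) x that] .
  have cK: "coords w ?I y i \<in> K" "coords v ?I y i \<in> K" if "y \<in> lspan v ?I" for y i
    using coords(1)[of y w] coords(1)[of y v] that vw by auto
  have "ftrace v n x = (\<Oplus>i\<in>?I. \<Oplus>k\<in>?I. coords w ?I (v i) k \<otimes> coords v ?I (x \<otimes> w k) i)"
    unfolding ftrace_def
  proof (intro finsum_cong' refl)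
    fix i assume i: "i \<in> ?I"
    have "x \<otimes> v i = x \<otimes> lcomb (coords w ?I (v i)) w ?I"
      using coords(2)[of "v i" w ?I] inV vw i by simp
    also have "\<dots> = lcomb (coords w ?I (v i)) (\<lambda>k. x \<otimes> w k) ?I"
      using xc cK(1)[OF inV(1)] i w by (intro mult_lcomb) auto
    finally show "coords v ?I (x \<otimes> v i) i = (\<Oplus>k\<in>?I. coords w ?I (v i) k \<otimes> coords v ?I (x \<otimes> w k) i)"
      using coords_linear[OF v _, of "\<lambda>k. x \<otimes> w k" ?I "coords w ?I (v i)" i] xV inV cK i by auto
  qed (use xV inV cK in \<open>auto intro!: finsum_closed\<close>)
  also have "\<dots> = (\<Oplus>k\<in>?I. \<Oplus>i\<in>?I. coords w ?I (v i) k \<otimes> coords v ?I (x \<otimes> w k) i)"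
    using xV inV cK by (intro finsum_swap) auto
  also have "\<dots> = ftrace w n x"
    unfolding ftrace_def
  proof (intro finsum_cong' refl)
    fix k assume k: "k \<in> ?I"
    have "coords w ?I (x \<otimes> w k) k = coords w ?I (lcomb (coords v ?I (x \<otimes> w k)) v ?I) k"
      using coords(2)[of "x \<otimes> w k" v ?I] xV inV k by simp
    also have "\<dots> = (\<Oplus>i\<in>?I. coords v ?I (x \<otimes> w k) i \<otimes> coords w ?I (v i) k)"
      using coords_linear[OF w, of v ?I "coords v ?I (x \<otimes> w k)" k] xV inV cK vw k by auto
    also have "\<dots> = (\<Oplus>i\<in>?I. coords w ?I (v i) k \<otimes> coords v ?I (x \<otimes> w k) i)"
      using xV inV cK k by (intro finsum_cong') (auto simp: m_comm)
    finally show "(\<Oplus>i\<in>?I. coords w ?I (v i) k \<otimes> coords v ?I (x \<otimes> w k) i) = coords w ?I (x \<otimes> w k) k"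
      by simp
  qed (use xV inV cK vw in auto)
  finally show ?thesis .
qed

end

section \<open>The extension of prime degree generated by a root of an element that is not a p-th
  power\<close>

locale pure_extension = cring_subfield R K for R (structure) and K +
  fixes \<alpha> a and p :: nat
  assumes prime: "Factorial_Ring.prime p" and alpha [simp]: "\<alpha> \<in> carrier R"
    and alpha_pow: "\<alpha> [^] p = a" and a [simp]: "a \<in> K"
    and no_root: "\<And>d. d \<in> K \<Longrightarrow> d [^] p \<noteq> a"
begin

lemma p_gt_1: "p > 1" "p > 0" "p \<ge> 2"
  using prime_gt_1_nat[OF prime] by auto

lemma a_nonzero: "a \<noteq> \<zero>"
  using no_root[of \<zero>] p_gt_1 by (simp add: nat_pow_zero)

abbreviation powers :: "nat \<Rightarrow> 'a" where "powers \<equiv> \<lambda>i. \<alpha> [^] i"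

definition B :: "'a set" where "B = lspan powers {..<p}"

lemma powers_carrier: "powers \<in> I \<rightarrow> carrier R"
  by simp

lemma lindep_powers: "lindep powers {..<p}"
proof -
  have "lindep (\<lambda>i. \<alpha> [^] i \<otimes> \<one>) {..<p}"
    using no_root by (intro pow_lindep[where c = a] prime) (auto simp: alpha_pow)
  then show ?thesis by simp
qed

lemma B_carrier [simp]: "x \<in> B \<Longrightarrow> x \<in> carrier R"
  using lspan_carrier[OF powers_carrier] unfolding B_def by blast

lemma B_add [simp]: "x \<in> B \<Longrightarrow> y \<in> B \<Longrightarrow> x \<oplus> y \<in> B"
  and B_neg [simp]: "x \<in> B \<Longrightarrow> \<ominus> x \<in> B"
  and B_scale: "k \<in> K \<Longrightarrow> x \<in> B \<Longrightarrow> k \<otimes> x \<in> B"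
  unfolding B_def by (auto intro: lspan_add lspan_neg lspan_scale powers_carrier)

lemma alpha_pow_mod: "\<alpha> [^] (n::nat) = a [^] (n div p) \<otimes> \<alpha> [^] (n mod p)"
proof -
  have "\<alpha> [^] n = \<alpha> [^] (p * (n div p) + n mod p)" by simp
  also have "\<dots> = (\<alpha> [^] p) [^] (n div p) \<otimes> \<alpha> [^] (n mod p)"
    by (simp only: nat_pow_mult nat_pow_pow alpha)
  finally show ?thesis by (simp add: alpha_pow)
qed

lemma alpha_pow_B [simp]: "\<alpha> [^] (n::nat) \<in> B"
proof -
  have "\<alpha> [^] (n mod p) \<in> B" unfolding B_def using p_gt_1
    by (intro lspan_base[where v = powers]) auto
  then show ?thesis by (subst alpha_pow_mod) (auto intro: B_scale)
qed

lemma alpha_B [simp]: "\<alpha> \<in> B"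
  using alpha_pow_B[of 1] by simp

lemma one_B [simp]: "\<one> \<in> B"
  using alpha_pow_B[of 0] by simp

lemma K_B [simp]: "k \<in> K \<Longrightarrow> k \<in> B"
  using B_scale[of k \<one>] by simp

lemma B_stab: "x \<in> B \<Longrightarrow> x \<in> stab powers p"
proof -
  assume x: "x \<in> B"
  then obtain c where c: "\<And>i. c i \<in> K" "x = lcomb c powers {..<p}"
    unfolding B_def by (rule lspanE) blast
  have "x \<otimes> \<alpha> [^] j \<in> B" for j :: nat
  proof -
    have "x \<otimes> \<alpha> [^] j = lcomb c (\<lambda>i. \<alpha> [^] j \<otimes> \<alpha> [^] i) {..<p}"
      using c by (simp add: mult_lcomb[of "\<alpha> [^] j", symmetric] m_comm[of _ "\<alpha> [^] j"])
    also have "\<dots> = lcomb c (\<lambda>i. \<alpha> [^] (j + i)) {..<p}" by (simp add: nat_pow_mult)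
    finally show ?thesis
      using lcomb_in[of "\<lambda>i. \<alpha> [^] (j + i)" "{..<p}" powers "{..<p}" c] c
      by (simp add: B_def[symmetric])
  qed
  then show ?thesis using x unfolding stab_def B_def[symmetric] by simp
qed

lemma B_mult [simp]: "x \<in> B \<Longrightarrow> y \<in> B \<Longrightarrow> x \<otimes> y \<in> B"
  using stab_lspan[OF powers_carrier B_stab] unfolding B_def[symmetric] .

lemma B_subring: "subring B R"
  by (rule subringI) auto

text \<open>For nonzero b in B the p vectors \<alpha>^i b are independent elements of B, so they
  span B by dimension. In particular 1 is a combination of them, hence a multiple of b.\<close>

lemma B_subfield: "subfield B R"
proof (rule subfield_criterion[OF B_subring])
  fix b assume b: "b \<in> B" "b \<noteq> \<zero>"
  let ?w = "\<lambda>i. \<alpha> [^] i \<otimes> b"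
  have "lindep ?w {..<p}"
    using no_root b by (intro pow_lindep[where c = a] prime) (auto simp: alpha_pow)
  moreover have "?w \<in> {..<p} \<rightarrow> lspan powers {..<p}"
    unfolding B_def[symmetric] using b by auto
  ultimately have "lspan ?w {..<p} = B"
    unfolding B_def by (intro lspan_eq_if_card) auto
  then have "\<one> \<in> lspan ?w {..<p}" by simp
  then obtain c where c: "\<And>i. c i \<in> K" "\<one> = lcomb c ?w {..<p}" by (rule lspanE) blast
  have "lcomb c ?w {..<p} = lcomb c (\<lambda>i. b \<otimes> \<alpha> [^] i) {..<p}"
    using c b by (intro lcomb_cong) (auto simp: m_comm)
  also have "\<dots> = b \<otimes> lcomb c powers {..<p}" using c b by (simp add: mult_lcomb)
  finally show "\<exists>y\<in>B. b \<otimes> y = \<one>" using c lspanI[of c powers "{..<p}"] unfolding B_def by auto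
qed simp

sublocale B: cring_subfield R B
  by (intro cring_subfield.intro cring_subfield_axioms.intro is_cring B_subfield)

definition N :: "'a \<Rightarrow> 'a" where "N x = fnorm powers p x"

lemma N_closed [simp]: "x \<in> B \<Longrightarrow> N x \<in> K"
  unfolding N_def by (intro fnorm_closed B_stab)

lemma N_mult: "x \<in> B \<Longrightarrow> y \<in> B \<Longrightarrow> N (x \<otimes> y) = N x \<otimes> N y"
  unfolding N_def by (intro fnorm_mult powers_carrier lindep_powers B_stab)

lemma N_pow: "x \<in> B \<Longrightarrow> N (x [^] (k::nat)) = N x [^] k"
  unfolding N_def by (intro fnorm_pow powers_carrier lindep_powers B_stab)

lemma N_scalar: "k \<in> K \<Longrightarrow> N k = k [^] p"
  unfolding N_def by (intro fnorm_scalar powers_carrier lindep_powers) auto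

text \<open>Multiplication by \<alpha> has a companion matrix. The sign (-1)^(p-1) stays open: for
  odd p a minus sign can be moved into a p-th power.\<close>

lemma N_alpha: "N \<alpha> \<in> {a, \<ominus> a}"
  unfolding N_def
proof (intro fnorm_companion powers_carrier lindep_powers)
  show "\<alpha> \<otimes> \<alpha> [^] (p - 1) = a \<otimes> \<alpha> [^] (0::nat)"
    using alpha_pow p_gt_1 nat_pow_Suc[of \<alpha> "p - 1"] by (simp add: m_comm)
qed (use p_gt_1 in \<open>auto simp: m_comm\<close>)

end

section \<open>Roots inside B of elements of K\<close>

lemma coprime_less_prime: "Factorial_Ring.prime (p::nat) \<Longrightarrow> 0 < m \<Longrightarrow> m < p \<Longrightarrow> coprime m p"
  by (metis coprime_commute nat_dvd_not_less prime_imp_coprime_nat)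

text \<open>Once the m-th power of \<zeta> depends on the lower ones, their span is a ring. The
  hypothesis \<open>cancel\<close> stands in for the missing domain property of \<open>R\<close>; it
  makes multiplication by b injective on a space of finite dimension, hence surjective.\<close>

lemma (in cring_subfield) simple_subfield:
  fixes \<zeta> :: 'a and m :: nat
  defines "g \<equiv> \<lambda>i::nat. \<zeta> [^] i"
  assumes z: "\<zeta> \<in> carrier R" and m: "m > 0" "lindep g {..<m}" "\<zeta> [^] m \<in> lspan g {..<m}"
    and cancel: "\<And>b x. b \<in> lspan g {..<m} \<Longrightarrow> b \<noteq> \<zero> \<Longrightarrow> x \<in> lspan g {..<m} \<Longrightarrow> b \<otimes> x = \<zero> \<Longrightarrow> x = \<zero>"
  shows "subfield (lspan g {..<m}) R" "\<zeta> \<in> stab g m" "lspan g {..<m} \<subseteq> stab g m"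
    "K \<subseteq> lspan g {..<m}" "\<zeta> \<in> lspan g {..<m}"
proof -
  let ?F = "lspan g {..<m}"
  have g: "g \<in> I \<rightarrow> carrier R" for I using z by (simp add: g_def)
  have gc [simp]: "g i \<in> carrier R" for i using z by (simp add: g_def)
  have Fc: "x \<in> carrier R" if "x \<in> ?F" for x using lspan_carrier[OF g] that by blast
  have gF: "g i \<in> ?F" if "i \<le> m" for i
    using lspan_base[OF g, of "{..<m}" i] m(3) that by (cases "i = m") (auto simp: g_def)
  show stab: "\<zeta> \<in> stab g m"
    using z gF[of "Suc _"] by (auto simp: stab_def g_def m_comm)
  have gF': "g i \<in> ?F" for i
  proof (induction i)
    case (Suc i)
    then show ?case using stab_lspan[OF g stab] z by (simp add: g_def m_comm)
  qed (use gF[of 0] in auto)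
  show sub: "?F \<subseteq> stab g m"
  proof
    fix x assume x: "x \<in> ?F"
    then obtain c where c: "\<And>i. c i \<in> K" "x = lcomb c g {..<m}" by (rule lspanE) blast
    have "x \<otimes> g j \<in> ?F" for j
    proof -
      have "x \<otimes> g j = lcomb c (\<lambda>i. g j \<otimes> g i) {..<m}"
        using c g by (simp add: mult_lcomb[of "g j", symmetric] m_comm[of _ "g j"])
      also have "\<dots> = lcomb c (\<lambda>i. g (j + i)) {..<m}" using z by (simp add: g_def nat_pow_mult)
      finally show ?thesis using lcomb_in[of "\<lambda>i. g (j + i)" "{..<m}" g "{..<m}" c] c g gF' by auto
    qed
    then show "x \<in> stab g m" using Fc[OF x] by (simp add: stab_def)
  qed
  have one: "\<one> \<in> ?F" using gF'[of 0] by (simp add: g_def)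
  have mult: "x \<otimes> y \<in> ?F" if "x \<in> ?F" "y \<in> ?F" for x y
    using stab_lspan[OF g] sub that by blast
  show "K \<subseteq> ?F"
  proof
    fix k assume "k \<in> K"
    then show "k \<in> ?F" using lspan_scale[OF g _ one, of k] by simp
  qed
  show "\<zeta> \<in> ?F" using gF'[of 1] z by (simp add: g_def)
  have "subring ?F R"
    using Fc one mult by (intro subringI) (auto intro: lspan_add[OF g] lspan_neg[OF g])
  then show "subfield ?F R"
  proof (rule subfield_criterion)
    fix b assume b: "b \<in> ?F" "b \<noteq> \<zero>"
    let ?w = "\<lambda>i. b \<otimes> g i"
    have eq: "lcomb c ?w {..<m} = b \<otimes> lcomb c g {..<m}" if "\<And>i. c i \<in> K" for c
      using mult_lcomb[OF Fc[OF b(1)] that g] by simp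
    have "lindep ?w {..<m}"
      unfolding lindep_def
    proof (intro allI impI)
      fix c assume c: "\<forall>i. c i \<in> K" "lcomb c ?w {..<m} = \<zero>"
      then have "lcomb c g {..<m} = \<zero>"
        using cancel[OF b, of "lcomb c g {..<m}"] by (auto simp: eq intro: lspanI)
      then show "\<forall>i\<in>{..<m}. c i = \<zero>" using c m(2) unfolding lindep_def by blast
    qed
    moreover have "?w \<in> {..<m} \<rightarrow> ?F" using mult[OF b(1) gF'] by auto
    ultimately have "lspan ?w {..<m} = ?F" by (intro lspan_eq_if_card g) auto
    then obtain c where "\<And>i. c i \<in> K" "\<one> = lcomb c ?w {..<m}" using one by (metis lspanE)
    then show "\<exists>y\<in>?F. b \<otimes> y = \<one>" using eq[of c] lspanI[of c g] by auto
  qed simp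
qed

lemma (in cring) geometric_sum:
  assumes "y \<in> carrier R"
  shows "(y \<ominus> \<one>) \<otimes> (\<Oplus>k\<in>{..<n::nat}. y [^] k) = y [^] n \<ominus> \<one>"
proof (induction n)
  case 0
  show ?case using assms by (simp add: a_minus_def r_neg)
next
  case (Suc n)
  let ?s = "\<Oplus>k\<in>{..<n}. y [^] k"
  have s: "?s \<in> carrier R" using assms by simp
  have "(\<Oplus>k\<in>{..<Suc n}. y [^] k) = y [^] n \<oplus> ?s"
    unfolding lessThan_Suc using assms by (subst finsum_insert) auto
  then have "(y \<ominus> \<one>) \<otimes> (\<Oplus>k\<in>{..<Suc n}. y [^] k) = (y \<ominus> \<one>) \<otimes> y [^] n \<oplus> (y [^] n \<ominus> \<one>)"
    using r_distr[of "y [^] n" ?s "y \<ominus> \<one>"] assms s Suc.IH by (simp only: nat_pow_closed minus_closed one_closed)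
  also have "(y \<ominus> \<one>) \<otimes> y [^] n = y \<otimes> y [^] n \<oplus> \<ominus> (y [^] n)"
    using assms by (simp add: a_minus_def l_distr l_minus)
  also have "y \<otimes> y [^] n \<oplus> \<ominus> (y [^] n) \<oplus> (y [^] n \<ominus> \<one>) = y [^] Suc n \<ominus> \<one>"
    using assms by (simp add: a_minus_def a_assoc r_neg1 m_comm[of y])
  finally show ?case .
qed

context pure_extension
begin

text \<open>If \<gamma>^p is not a p-th power in K, \<open>pow_lindep\<close> applies. Otherwise
  \<gamma> = \<zeta> d with \<zeta>^p = 1 and \<zeta> outside K, and \<zeta> would generate a field
  F of degree m with 1 \<le> m < p inside B. This is impossible, as B has prime degree; the degree
  formula is replaced by comparing powers of \<alpha> over F and over K.\<close>

lemma lindep_powers_of_root: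
  assumes g: "\<gamma> \<in> B" "\<gamma> \<notin> K" "\<gamma> [^] p \<in> K"
  shows "lindep (\<lambda>i. \<gamma> [^] i) {..<p}"
proof (cases "\<exists>d\<in>K. d [^] p = \<gamma> [^] p")
  case False
  then have "lindep (\<lambda>i. \<gamma> [^] i \<otimes> \<one>) {..<p}"
    using g by (intro pow_lindep[where c = "\<gamma> [^] p"] prime) auto
  then show ?thesis using g by simp
next
  case True
  then obtain d where d: "d \<in> K" "d [^] p = \<gamma> [^] p" by blast
  have gu: "\<gamma> \<in> Units R" using g K_zero by (intro B.K_Units) auto
  have dnz: "d \<noteq> \<zero>"
    using d Units_neq_zero[OF Units_pow_closed[OF gu, of p]] p_gt_1 by (auto simp: nat_pow_zero)
  define \<zeta> where "\<zeta> = \<gamma> \<otimes> inv d"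
  have id: "inv d \<in> K" "d \<otimes> inv d = \<one>" using K_inv d dnz by auto
  have zB: "\<zeta> \<in> B" using g id by (simp add: \<zeta>_def)
  have zg: "\<zeta> \<otimes> d = \<gamma>" using g id d by (simp add: \<zeta>_def m_assoc m_comm[of "inv d"])
  have zK: "\<zeta> \<notin> K" using zg g(2) d(1) by auto
  have zp: "\<zeta> [^] p = \<one>"
  proof -
    have "\<zeta> [^] p = d [^] p \<otimes> inv d [^] p"
      unfolding \<zeta>_def d(2) using g id by (simp add: nat_pow_distrib)
    also have "\<dots> = (d \<otimes> inv d) [^] p"
      by (rule nat_pow_distrib[symmetric]) (use d id in auto)
    finally show ?thesis using id by simp
  qed
  let ?g = "\<lambda>i. \<zeta> [^] (i::nat)"
  have gc: "?g \<in> I \<rightarrow> carrier R" for I using zB by simp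
  \<comment> \<open>As \<zeta> \<noteq> 1 and B is a field, 1 + \<zeta> + ... + \<zeta>^(p-1) = 0 is
    a nontrivial relation. It makes the degree m smaller than p and hence coprime to p.\<close>
  have "\<not> lindep ?g {..<p}"
  proof
    assume l: "lindep ?g {..<p}"
    define s where "s = (\<Oplus>i\<in>{..<p}. ?g i)"
    have s: "s \<in> B" unfolding s_def using zB by (intro B.K_finsum) auto
    have "(\<zeta> \<ominus> \<one>) \<otimes> s = \<zero>"
      unfolding s_def geometric_sum[OF B_carrier[OF zB]] zp by (simp add: a_minus_def r_neg)
    moreover have "\<zeta> \<ominus> \<one> \<noteq> \<zero>" using zK zB by (auto simp: r_right_minus_eq)
    moreover have "\<zeta> \<ominus> \<one> \<in> B" using zB by simp
    ultimately have "s = \<zero>" using B.K_integral[of "\<zeta> \<ominus> \<one>" s] s by simp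
    moreover have "lcomb (\<lambda>_. \<one>) ?g {..<p} = s"
      unfolding lcomb_def s_def using zB by (intro finsum_cong') auto
    ultimately have "\<one> = \<zero>"
      using lindepD[OF l, of "\<lambda>_. \<one>" 0] p_gt_1 by simp
    then show False by simp
  qed
  then obtain m where m: "m < p" "lindep ?g {..<m}" "?g m \<in> lspan ?g {..<m}"
    using lindep_least[of ?g p] gc by blast
  have m0: "m > 0"
  proof (rule ccontr)
    assume "\<not> m > 0"
    then have "\<one> \<in> lspan ?g {}" using m(3) by simp
    then show False by (auto simp: lspan_def lcomb_def)
  qed
  define F where "F = lspan ?g {..<m}"
  have FB: "F \<subseteq> B"
    unfolding F_def lspan_def lcomb_def using zB by (auto intro!: B.K_finsum)
  have F: "subfield F R" "F \<subseteq> stab ?g m" "K \<subseteq> F" "\<zeta> \<in> F"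
  proof -
    have cancel: "x = \<zero>" if "b \<in> lspan ?g {..<m}" "b \<noteq> \<zero>" "x \<in> lspan ?g {..<m}" "b \<otimes> x = \<zero>" for b x
    proof -
      have "b \<in> B" "x \<in> B" using FB that unfolding F_def by auto
      then show ?thesis using B.K_integral[of b x] that by simp
    qed
    show "subfield F R" "F \<subseteq> stab ?g m" "K \<subseteq> F" "\<zeta> \<in> F"
      unfolding F_def
      by (rule simple_subfield[OF _ m0 m(2,3) cancel], use zB in simp, assumption+)+
  qed
  interpret F: cring_subfield R F
    by (intro cring_subfield.intro cring_subfield_axioms.intro is_cring F(1))
  have False
  proof (cases "\<exists>f\<in>F. f [^] p = a")
    case False
    \<comment> \<open>Over F the powers of \<alpha> stay independent. The expansion of \<zeta> over
      K and the trivial expansion \<zeta> \<alpha>^0 over F then agree, which puts \<zeta> into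
      K.\<close>
    then have "F.lindep (\<lambda>i. \<alpha> [^] i \<otimes> \<one>) {..<p}"
      using F(3) by (intro F.pow_lindep[where c = a] prime) (auto simp: alpha_pow)
    then have l: "F.lindep powers {..<p}" by simp
    obtain c where c: "\<And>i. c i \<in> K" "\<zeta> = lcomb c powers {..<p}"
      using zB unfolding B_def by (rule lspanE) blast
    have "F.lcomb (\<lambda>i. if i = 0 then \<zeta> else \<zero>) powers {..<p} = \<zeta> \<otimes> powers 0"
      by (rule F.lcomb_delta) (use F(4) p_gt_1 in auto)
    also have "\<dots> = \<zeta>" using zB by simp
    finally have delta: "F.lcomb (\<lambda>i. if i = 0 then \<zeta> else \<zero>) powers {..<p} = \<zeta>" .
    have eq: "lcomb c powers {..<p} = F.lcomb (\<lambda>i. if i = 0 then \<zeta> else \<zero>) powers {..<p}"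
      by (rule trans[OF c(2)[symmetric] delta[symmetric]])
    have cF: "c i \<in> F" for i using c(1) F(3) by blast
    have "c 0 = (if (0::nat) = 0 then \<zeta> else \<zero>)"
      by (rule F.lcomb_unique[OF l powers_carrier cF _ eq, of 0]) (use F(4) p_gt_1 in auto)
    then show False using zK c(1)[of 0] by simp
  next
    case True
    then obtain f where f: "f \<in> F" "f [^] p = a" by blast
    \<comment> \<open>The norm from F to K turns f^p = a into a p-th root of a^m in K, and m is
      coprime to p.\<close>
    have "fnorm ?g m f [^] p = fnorm ?g m (f [^] p)"
      by (rule fnorm_pow[OF gc m(2), symmetric]) (use F(2) f(1) in blast)
    also have "\<dots> = a [^] m" unfolding f(2) by (rule fnorm_scalar[OF gc m(2) a]) simp
    finally have "fnorm ?g m f [^] p = a [^] m" .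
    moreover have "fnorm ?g m f \<in> K" by (rule fnorm_closed) (use F(2) f(1) in blast)
    moreover have "coprime m p"
      by (rule coprime_less_prime[OF prime m0 m(1)])
    ultimately obtain e where "e \<in> K" "e [^] p = a"
      using root_of_coprime[OF a, of "fnorm ?g m f" p m] m0 p_gt_1 by auto
    then show False using no_root by blast
  qed
  then show ?thesis by (rule FalseE)
qed

section \<open>Coefficients with respect to the powers of the generator\<close>

lemma coords_K: "x \<in> B \<Longrightarrow> coords powers {..<p} x i \<in> K"
  unfolding B_def by (rule coords(1))

lemma coords_alpha_pow:
  assumes "i < p"
  shows "coords powers {..<p} (\<alpha> [^] n) i = (if i = n mod p then a [^] (n div p) else \<zero>)"
  using coords_lcomb[OF lindep_powers powers_carrier, of "\<lambda>i. if i = n mod p then a [^] (n div p) else \<zero>" i]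
    lcomb_delta[OF powers_carrier, of "{..<p}" "n mod p" "a [^] (n div p)"] assms p_gt_1
    alpha_pow_mod[of n] by auto

lemma coords_mult_alpha_pow:
  assumes "x \<in> B" "i < p"
  shows "coords powers {..<p} (x \<otimes> \<alpha> [^] (n::nat)) i =
    (\<Oplus>k\<in>{..<p}. coords powers {..<p} x k \<otimes> coords powers {..<p} (\<alpha> [^] (k + n)) i)"
proof -
  have x: "x \<in> lspan powers {..<p}" using assms B_def by simp
  have "x \<otimes> \<alpha> [^] n = \<alpha> [^] n \<otimes> lcomb (coords powers {..<p} x) powers {..<p}"
    using coords(2)[OF x] assms by (simp add: m_comm)
  also have "\<dots> = lcomb (coords powers {..<p} x) (\<lambda>k. \<alpha> [^] n \<otimes> \<alpha> [^] k) {..<p}"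
    using coords(1)[OF x] by (intro mult_lcomb) auto
  also have "\<dots> = lcomb (coords powers {..<p} x) (\<lambda>k. \<alpha> [^] (k + n)) {..<p}"
    by (simp add: nat_pow_mult add.commute)
  finally show ?thesis
    using coords_linear[OF lindep_powers powers_carrier, of "\<lambda>k. \<alpha> [^] (k + n)" "{..<p}" "coords powers {..<p} x" i]
      coords(1)[OF x] assms(2) by (simp add: B_def[symmetric])
qed

lemma finsum_K_delta:
  "(\<And>k. k \<in> I \<Longrightarrow> f k \<in> K) \<Longrightarrow> finite I \<Longrightarrow> j \<in> I \<Longrightarrow> (\<And>k. k \<in> I \<Longrightarrow> k \<noteq> j \<Longrightarrow> f k = \<zero>) \<Longrightarrow>
    (\<Oplus>k\<in>I. f k) = f j"
  using finsum_singleton[of j I f] add.finprod_cong'[of I I "\<lambda>k. if j = k then f k else \<zero>" f]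
  by (auto simp: Pi_iff)

text \<open>Multiplication by a power of \<alpha> shifts coefficients cyclically, up to factors a.
  The first part says that all diagonal entries of the matrix of x equal its constant coefficient;
  the second moves the j-th coefficient to position 0.\<close>

lemma coords_mult_alpha_pow_zero:
  assumes x: "x \<in> B" and j: "j < p"
  shows "coords powers {..<p} (x \<otimes> \<alpha> [^] j) j = coords powers {..<p} x 0"
    "coords powers {..<p} (x \<otimes> \<alpha> [^] (p - j)) 0 = coords powers {..<p} x j \<otimes> a"
proof -
  have xK: "coords powers {..<p} x k \<in> K" for k by (rule coords_K[OF x])
  have *: "j = (k + j) mod p \<longleftrightarrow> k = 0" if "k < p" for k
    using that j by (auto simp: mod_if)
  show "coords powers {..<p} (x \<otimes> \<alpha> [^] j) j = coords powers {..<p} x 0"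
    unfolding coords_mult_alpha_pow[OF x j]
    using xK j * by (subst finsum_K_delta[of _ _ 0]) (auto simp: coords_alpha_pow)
  have *: "(k + (p - j)) mod p = 0 \<longleftrightarrow> k = j" if "k < p" for k
    using that j by (auto simp: mod_if)
  show "coords powers {..<p} (x \<otimes> \<alpha> [^] (p - j)) 0 = coords powers {..<p} x j \<otimes> a"
    unfolding coords_mult_alpha_pow[OF x p_gt_1(2)]
    using xK j * p_gt_1 by (subst finsum_K_delta[of _ _ j]) (auto simp: coords_alpha_pow)
qed

text \<open>In the basis of powers of \<gamma> the matrix of \<gamma> has zero diagonal, so its
  trace is 0. In the basis of powers of \<alpha> the trace is p times the constant coefficient, and
  p is nonzero in K.\<close>

lemma coords_root_zero:
  assumes g: "\<gamma> \<in> B" "\<gamma> \<notin> K" "\<gamma> [^] p \<in> K" and char: "add_pow R p \<one> \<noteq> \<zero>"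
  shows "coords powers {..<p} \<gamma> 0 = \<zero>"
proof -
  let ?g = "\<lambda>i. \<gamma> [^] (i::nat)"
  have l: "lindep ?g {..<p}" by (rule lindep_powers_of_root[OF g])
  have gc: "?g \<in> I \<rightarrow> carrier R" for I using g by simp
  have b0: "coords powers {..<p} \<gamma> 0 \<in> K" by (rule coords_K[OF g(1)])
  have "lspan ?g {..<p} = lspan powers {..<p}"
    using l powers_carrier g by (intro lspan_eq_if_card) (auto simp: B_def[symmetric])
  then have "ftrace powers p \<gamma> = ftrace ?g p \<gamma>"
    by (rule ftrace_basis_change[OF lindep_powers powers_carrier l gc _ B_stab[OF g(1)]])
  also have "\<dots> = \<zero>"
    unfolding ftrace_def
  proof (rule add.finprod_one_eqI)
    fix j assume j: "j \<in> {..<p}"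
    show "coords ?g {..<p} (\<gamma> \<otimes> ?g j) j = \<zero>"
    proof (cases "Suc j = p")
      case False
      then show ?thesis
        using coords_lcomb[OF l gc, of "\<lambda>i. if i = Suc j then \<one> else \<zero>" j]
          lcomb_delta[OF gc, of "{..<p}" "Suc j" \<one>] j g by (simp add: m_comm)
    next
      case True
      \<comment> \<open>The last basis vector returns to index 0, which is off the diagonal because
        p > 1.\<close>
      have "\<gamma> \<otimes> ?g j = \<gamma> [^] p \<otimes> ?g 0"
        using nat_pow_Suc[of \<gamma> j] m_comm[of \<gamma> "?g j"] g unfolding True by simp
      then show ?thesis
        using coords_lcomb[OF l gc, of "\<lambda>i. if i = 0 then \<gamma> [^] p else \<zero>" j]
          lcomb_delta[OF gc, of "{..<p}" 0 "\<gamma> [^] p"] j g True p_gt_1 by auto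
    qed
  qed
  finally have "ftrace powers p \<gamma> = \<zero>" .
  moreover have "ftrace powers p \<gamma> = (\<Oplus>i\<in>{..<p}. coords powers {..<p} \<gamma> 0)"
    unfolding ftrace_def using coords_mult_alpha_pow_zero(1)[OF g(1)] b0
    by (intro finsum_cong') auto
  ultimately have "\<zero> = (\<Oplus>i\<in>{..<p}. coords powers {..<p} \<gamma> 0)" by simp
  also have "\<dots> = add_pow R p (coords powers {..<p} \<gamma> 0)"
    using add.finprod_const[of "coords powers {..<p} \<gamma> 0" "{..<p}"] b0 by simp
  also have "\<dots> = add_pow R p \<one> \<otimes> coords powers {..<p} \<gamma> 0"
    using add_pow_ldistr[of \<one> "coords powers {..<p} \<gamma> 0" p] b0 by simp
  finally have eq: "add_pow R p \<one> \<otimes> coords powers {..<p} \<gamma> 0 = \<zero>" by simp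
  have "add_pow R n \<one> \<in> K" for n :: nat by (induction n) auto
  then show ?thesis by (rule K_integral[OF _ _ eq char]) (use b0 in simp)
qed

text \<open>The group generated by the nonzero elements of \<open>K\<close> and \<alpha>; since
  \<alpha>^p lies in \<open>K\<close>, natural exponents already give all inverses.\<close>

definition mon :: "'a set" where "mon = {k \<otimes> \<alpha> [^] (j::nat) |k j. k \<in> K \<and> k \<noteq> \<zero>}"

lemma monI: "k \<in> K \<Longrightarrow> k \<noteq> \<zero> \<Longrightarrow> k \<otimes> \<alpha> [^] (j::nat) \<in> mon"
  unfolding mon_def by blast

text \<open>Each \<beta> \<alpha>^(p-j) again has its p-th power in K. If none of them lies in K,
  all their constant coefficients vanish, and these are a times the coefficients of \<beta>.\<close>

lemma kummer:
  assumes b: "\<beta> \<in> B" "\<beta> \<noteq> \<zero>" "\<beta> [^] p \<in> K" and char: "add_pow R p \<one> \<noteq> \<zero>"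
  shows "\<exists>j<p. \<beta> \<otimes> \<alpha> [^] (p - j) \<in> K"
proof (rule ccontr)
  assume no: "\<not> (\<exists>j<p. \<beta> \<otimes> \<alpha> [^] (p - j) \<in> K)"
  have bc: "coords powers {..<p} \<beta> j \<in> K" for j by (rule coords_K[OF b(1)])
  have "coords powers {..<p} \<beta> j = \<zero>" if j: "j < p" for j
  proof -
    have "(\<beta> \<otimes> \<alpha> [^] (p - j)) [^] p = \<beta> [^] p \<otimes> a [^] (p - j)"
      using b alpha_pow by (simp add: nat_pow_distrib nat_pow_pow mult.commute[of _ p] flip: alpha_pow)
    then have "coords powers {..<p} (\<beta> \<otimes> \<alpha> [^] (p - j)) 0 = \<zero>"
      using no j b char by (intro coords_root_zero) auto
    then have "a \<otimes> coords powers {..<p} \<beta> j = \<zero>"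
      using coords_mult_alpha_pow_zero(2)[OF b(1) j] bc by (simp add: m_comm)
    then show ?thesis by (rule K_integral[OF a _ _ a_nonzero, rotated]) (use bc in simp)
  qed
  then have "lcomb (coords powers {..<p} \<beta>) powers {..<p} = \<zero>"
    unfolding lcomb_def by (intro add.finprod_one_eqI) auto
  then show False using b coords(2)[of \<beta> powers "{..<p}"] by (simp add: B_def)
qed

end

lemma (in ring) neg_pow:
  "x \<in> carrier R \<Longrightarrow> (\<ominus> x) [^] (n::nat) = (if even n then x [^] n else \<ominus> (x [^] n))"
  by (induction n) (auto simp: l_minus r_minus)

section \<open>Monomials and their roots\<close>

context pure_extension
begin

lemma monE:
  assumes "x \<in> mon" obtains k j where "k \<in> K" "k \<noteq> \<zero>" "x = k \<otimes> \<alpha> [^] (j::nat)"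
  using assms unfolding mon_def by blast

lemma alpha_Units: "\<alpha> \<in> Units R"
proof -
  have "\<alpha> \<noteq> \<zero>" using alpha_pow a_nonzero p_gt_1 by (auto simp: nat_pow_zero)
  then show ?thesis by (intro B.K_Units) auto
qed

lemma mon_Units: "x \<in> mon \<Longrightarrow> x \<in> Units R"
  by (elim monE) (auto intro: K_Units alpha_Units Units_pow_closed)

lemma mon_B: "x \<in> mon \<Longrightarrow> x \<in> B"
  by (elim monE) auto

lemma mon_mult: assumes "x \<in> mon" "y \<in> mon" shows "x \<otimes> y \<in> mon"
proof -
  obtain k j l i where kj: "k \<in> K" "k \<noteq> \<zero>" "x = k \<otimes> \<alpha> [^] (j::nat)"
    "l \<in> K" "l \<noteq> \<zero>" "y = l \<otimes> \<alpha> [^] (i::nat)"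
    using assms by (elim monE)
  have "x \<otimes> y = (k \<otimes> l) \<otimes> \<alpha> [^] (j + i)" using kj by (simp add: m_ac flip: nat_pow_mult)
  moreover have "k \<otimes> l \<noteq> \<zero>" using K_integral[of k l] kj by auto
  ultimately show ?thesis using monI kj by simp
qed

lemma K_mon: "k \<in> K \<Longrightarrow> k \<noteq> \<zero> \<Longrightarrow> k \<in> mon"
  using monI[of k 0] by simp

lemma alpha_pow_mon: "\<alpha> [^] (n::nat) \<in> mon"
  using monI[of \<one> n] by simp

lemma mon_inv: assumes "x \<in> mon" shows "inv x \<in> mon"
proof -
  have "x \<in> B" "x \<noteq> \<zero>" "x \<in> Units R"
    using assms mon_B mon_Units Units_neq_zero by auto
  obtain k j where kj: "k \<in> K" "k \<noteq> \<zero>" "x = k \<otimes> \<alpha> [^] (j::nat)" using assms by (rule monE)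
  \<comment> \<open>The inverse of \<alpha>^j is \<alpha>^((p-1)j) / a^j.\<close>
  define y where "y = inv k \<otimes> (inv (a [^] j) \<otimes> \<alpha> [^] ((p - 1) * j))"
  have aj: "a [^] j \<in> K" "a [^] j \<noteq> \<zero>"
    using Units_neq_zero[OF Units_pow_closed[OF K_Units[OF a a_nonzero], of j]] by auto
  have "\<alpha> [^] j \<otimes> \<alpha> [^] ((p - 1) * j) = \<alpha> [^] (p * j)"
    using p_gt_1 by (cases p) (simp_all add: nat_pow_mult)
  also have "\<dots> = a [^] j" using alpha_pow nat_pow_pow[of \<alpha> p j] by simp
  finally have al: "\<alpha> [^] j \<otimes> \<alpha> [^] ((p - 1) * j) = a [^] j" .
  have c: "inv k \<in> carrier R" "inv (a [^] j) \<in> carrier R" using K_inv kj aj by auto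
  have "x \<otimes> y = (k \<otimes> inv k) \<otimes> (inv (a [^] j) \<otimes> (\<alpha> [^] j \<otimes> \<alpha> [^] ((p - 1) * j)))"
    unfolding kj(3) y_def using kj(1) c by (simp add: m_ac)
  also have "\<dots> = \<one>" unfolding al using K_inv kj aj by simp
  finally have "x \<otimes> y = \<one>" .
  moreover have "y \<in> mon" unfolding y_def
    using K_inv kj aj by (intro mon_mult alpha_pow_mon K_mon) (metis K_carrier one_neq_zero(1) r_null l_null)+
  ultimately show ?thesis using comm_inv_char[of x y] mon_B B_carrier \<open>x \<in> B\<close> by simp
qed

lemma mon_of_mult: "x \<in> B \<Longrightarrow> y \<in> mon \<Longrightarrow> x \<otimes> y \<in> mon \<Longrightarrow> x \<in> mon"
  using mon_mult[OF _ mon_inv, of "x \<otimes> y" y] mon_Units[of y] mon_B[of y]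
  by (simp add: m_assoc)

lemma kummer_mon:
  assumes b: "\<beta> \<in> B" "\<beta> \<noteq> \<zero>" "\<beta> [^] p \<in> K" and char: "add_pow R p \<one> \<noteq> \<zero>"
  shows "\<beta> \<in> mon"
proof -
  obtain j where j: "\<beta> \<otimes> \<alpha> [^] (p - j) \<in> K" using kummer[OF assms] by blast
  have "\<beta> \<otimes> \<alpha> [^] (p - j) \<noteq> \<zero>"
    using B.K_integral[of \<beta> "\<alpha> [^] (p - j)"] b Units_neq_zero[OF mon_Units[OF alpha_pow_mon]] by auto
  then have "\<beta> \<otimes> \<alpha> [^] (p - j) \<in> mon" using j by (intro K_mon)
  then show ?thesis using mon_of_mult b alpha_pow_mon by blast
qed

lemma mon_K:
  assumes "k \<in> K" "p dvd j" shows "k \<otimes> \<alpha> [^] (j::nat) \<in> K"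
  using alpha_pow_mod[of j] assms by (simp add: dvd_eq_mod_eq_0)

text \<open>If \<beta>^p = k \<alpha>^j with p not dividing j, taking norms makes N(\<alpha>)^j, and
  by coprimality N(\<alpha>) itself, a p-th power in K. This contradicts \<open>no_root\<close>, so
  \<beta>^p lies in K and \<open>kummer_mon\<close> applies.\<close>

lemma mon_closed_odd:
  assumes b: "\<beta> \<in> B" "\<beta> \<noteq> \<zero>" "\<beta> [^] p \<in> mon" and char: "add_pow R p \<one> \<noteq> \<zero>" and p: "odd p"
  shows "\<beta> \<in> mon"
proof -
  obtain k j where kj: "k \<in> K" "k \<noteq> \<zero>" "\<beta> [^] p = k \<otimes> \<alpha> [^] (j::nat)" using b(3) by (rule monE)
  show ?thesis
  proof (cases "p dvd j")
    case True
    then show ?thesis using kummer_mon[OF b(1,2) _ char] kj mon_K by simp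
  next
    case False
    then have j: "coprime j p" "j > 0"
      using prime_imp_coprime_nat[OF prime, of j] by (auto simp: coprime_commute intro: gr0I)
    have Nc: "N \<beta> \<in> K" "N \<alpha> \<in> K" using b by auto
    have "N \<beta> [^] p = N k \<otimes> N (\<alpha> [^] j)"
      using b kj by (simp add: N_mult flip: N_pow)
    also have "\<dots> = k [^] p \<otimes> N \<alpha> [^] j" using kj by (simp add: N_pow N_scalar)
    finally have eq: "N \<beta> [^] p = k [^] p \<otimes> N \<alpha> [^] j" .
    have ik: "inv k \<in> K" "inv k \<otimes> k = \<one>" using K_inv kj by auto
    have "(inv k \<otimes> N \<beta>) [^] p = inv k [^] p \<otimes> (k [^] p \<otimes> N \<alpha> [^] j)"
      unfolding eq[symmetric] using ik Nc by (simp add: nat_pow_distrib)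
    also have "\<dots> = (inv k \<otimes> k) [^] p \<otimes> N \<alpha> [^] j"
      using ik(1) Nc kj(1) by (simp add: nat_pow_distrib m_assoc)
    also have "\<dots> = N \<alpha> [^] j" using ik Nc by simp
    finally have eq': "(inv k \<otimes> N \<beta>) [^] p = N \<alpha> [^] j" .
    obtain d where d: "d \<in> K" "d [^] p = N \<alpha>"
      using root_of_coprime[OF Nc(2) _ eq' j] ik(1) Nc p_gt_1 by auto
    \<comment> \<open>For odd p the unknown sign of N(\<alpha>) is absorbed by replacing d with
      -d.\<close>
    have "d [^] p = a \<or> (\<ominus> d) [^] p = a"
      using N_alpha d p by (auto simp: neg_pow)
    then have False using no_root[of d] no_root[of "\<ominus> d"] d by auto
    then show ?thesis by (rule FalseE)
  qed
qed

lemma two_indep: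
  assumes "p = 2" "x \<in> K" "y \<in> K" "x \<oplus> y \<otimes> \<alpha> = \<zero>" shows "x = \<zero>"
proof -
  define c where "c i = (if i = 0 then x else if i = (1::nat) then y else \<zero>)" for i
  have cK: "c i \<in> K" for i using assms by (simp add: c_def)
  have I: "{..<p} = insert 0 {1}" using assms(1) by auto
  have "lcomb c powers {..<p} = c 0 \<otimes> powers 0 \<oplus> lcomb c powers (insert 1 {})"
    unfolding I using cK by (intro lcomb_insert) auto
  also have "lcomb c powers (insert 1 {}) = c 1 \<otimes> powers 1 \<oplus> lcomb c powers {}"
    using cK by (intro lcomb_insert) auto
  finally have "lcomb c powers {..<p} = \<zero>" using assms by (simp add: c_def lcomb_def)
  then show ?thesis using lindepD[OF lindep_powers, of c 0] cK p_gt_1 by (auto simp: c_def)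
qed

text \<open>Here N(\<alpha>) = -a may be a square, so norms do not decide. Writing \<beta> = x + y
  \<alpha> and comparing constant coefficients in \<beta>^2 = l \<alpha> gives x^2 + y^2 a = 0, and
  e = x/y is a square root of -a.\<close>

lemma mon_closed_two:
  assumes b: "\<beta> \<in> B" "\<beta> \<noteq> \<zero>" "\<beta> [^] p \<in> mon" and char: "add_pow R p \<one> \<noteq> \<zero>" and p: "p = 2"
  shows "\<beta> \<in> mon \<or> (\<exists>e\<in>K. \<exists>y\<in>K. y \<noteq> \<zero> \<and> e \<otimes> e = \<ominus> a \<and> \<beta> = y \<otimes> (e \<oplus> \<alpha>))"
proof -
  obtain k j where kj: "k \<in> K" "k \<noteq> \<zero>" "\<beta> [^] p = k \<otimes> \<alpha> [^] (j::nat)" using b(3) by (rule monE)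
  show ?thesis
  proof (cases "p dvd j")
    case True
    then show ?thesis using kummer_mon[OF b(1,2) _ char] kj mon_K by simp
  next
    case False
    then have j: "j mod p = 1" using p by (auto simp: odd_iff_mod_2_eq_one)
    obtain c where c: "\<And>i. c i \<in> K" "\<beta> = lcomb c powers {..<p}"
      using b(1) unfolding B_def by (rule lspanE) blast
    define x y where "x = c 0" and "y = c 1"
    have xy: "x \<in> K" "y \<in> K" using c by (auto simp: x_def y_def)
    have I: "{..<p} = insert 0 {1}" using p by auto
    have "\<beta> = c 0 \<otimes> powers 0 \<oplus> lcomb c powers (insert 1 {})"
      unfolding c(2) I using c(1) by (intro lcomb_insert) auto
    also have "lcomb c powers (insert 1 {}) = c 1 \<otimes> powers 1 \<oplus> lcomb c powers {}"
      using c(1) by (intro lcomb_insert) auto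
    finally have bxy: "\<beta> = x \<oplus> y \<otimes> \<alpha>"
      using c(1) by (simp add: lcomb_def x_def y_def)
    have aa: "\<alpha> \<otimes> \<alpha> = a" using alpha_pow p by (simp add: numeral_2_eq_2)
    define l where "l = k \<otimes> a [^] (j div p)"
    have l: "l \<in> K" using kj by (simp add: l_def)
    have "\<beta> \<otimes> \<beta> = \<beta> [^] p" using b p by (simp add: numeral_2_eq_2)
    also have "\<dots> = l \<otimes> \<alpha>" unfolding kj(3) using alpha_pow_mod[of j] j kj by (simp add: l_def m_assoc)
    finally have bb: "\<beta> \<otimes> \<beta> = l \<otimes> \<alpha>" .
    have "\<beta> \<otimes> \<beta> = (x \<otimes> x \<oplus> y \<otimes> y \<otimes> (\<alpha> \<otimes> \<alpha>)) \<oplus> (x \<otimes> y \<oplus> x \<otimes> y) \<otimes> \<alpha>"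
      unfolding bxy using xy by (simp add: l_distr r_distr m_ac a_ac)
    then have ST: "l \<otimes> \<alpha> = (x \<otimes> x \<oplus> y \<otimes> y \<otimes> a) \<oplus> (x \<otimes> y \<oplus> x \<otimes> y) \<otimes> \<alpha>"
      unfolding bb aa .
    have "(x \<otimes> x \<oplus> y \<otimes> y \<otimes> a) \<oplus> (x \<otimes> y \<oplus> x \<otimes> y \<oplus> \<ominus> l) \<otimes> \<alpha> = l \<otimes> \<alpha> \<oplus> \<ominus> l \<otimes> \<alpha>"
    proof -
      define S T where "S = x \<otimes> x \<oplus> y \<otimes> y \<otimes> a" and "T = x \<otimes> y \<oplus> x \<otimes> y"
      have "S \<in> carrier R" "T \<in> carrier R" using xy by (auto simp: S_def T_def)
      then have "S \<oplus> (T \<oplus> \<ominus> l) \<otimes> \<alpha> = (S \<oplus> T \<otimes> \<alpha>) \<oplus> \<ominus> l \<otimes> \<alpha>"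
        using l by (simp add: l_distr a_assoc)
      then show ?thesis unfolding ST S_def T_def .
    qed
    also have "\<dots> = \<zero>" using l by (simp add: l_minus r_neg)
    finally have z: "x \<otimes> x \<oplus> y \<otimes> y \<otimes> a = \<zero>" by (rule two_indep[OF p, rotated -1]) (use xy l in auto)
    have y0: "y \<noteq> \<zero>"
    proof
      assume "y = \<zero>"
      then have "x \<otimes> x = \<zero>" using z xy by simp
      then have "x = \<zero>" using K_integral[of x x] xy by auto
      then show False using bxy b(2) \<open>y = \<zero>\<close> by simp
    qed
    have iy: "inv y \<in> K" "inv y \<otimes> y = \<one>" "y \<otimes> inv y = \<one>" using K_inv xy y0 by auto
    define e where "e = inv y \<otimes> x"
    have e: "e \<in> K" using iy xy by (simp add: e_def)
    have xx: "x \<otimes> x = \<ominus> (y \<otimes> y \<otimes> a)" using z xy minus_equality[of "x \<otimes> x" "y \<otimes> y \<otimes> a"] by simp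
    have "e \<otimes> e = inv y \<otimes> inv y \<otimes> (x \<otimes> x)"
      unfolding e_def using iy(1) xy by (simp add: m_ac)
    also note xx
    also have "inv y \<otimes> inv y \<otimes> \<ominus> (y \<otimes> y \<otimes> a) = \<ominus> ((inv y \<otimes> y) \<otimes> (inv y \<otimes> y) \<otimes> a)"
      using iy(1) xy by (simp add: r_minus m_ac)
    finally have "e \<otimes> e = \<ominus> a" using iy by simp
    moreover have "y \<otimes> (e \<oplus> \<alpha>) = (y \<otimes> inv y) \<otimes> x \<oplus> y \<otimes> \<alpha>"
      unfolding e_def using iy(1) xy by (simp add: r_distr m_assoc)
    then have "\<beta> = y \<otimes> (e \<oplus> \<alpha>)" using bxy iy xy by simp
    ultimately show ?thesis using e xy y0 by blast
  qed
qed

text \<open>Dividing \<beta> by a suitable \<alpha>^n makes its q-th power an element c of K. The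
  norm then gives a q-th root of c^p in K, hence one of c, as p and q are coprime.\<close>

lemma mon_root_coprime:
  fixes q :: nat
  assumes b: "\<beta> \<in> B" "\<beta> \<noteq> \<zero>" "\<beta> [^] q \<in> mon" and q: "Factorial_Ring.prime q" "q \<noteq> p"
  shows "\<exists>w\<in>mon. w [^] q = \<beta> [^] q"
proof -
  obtain k j where kj: "k \<in> K" "k \<noteq> \<zero>" "\<beta> [^] q = k \<otimes> \<alpha> [^] (j::nat)" using b(3) by (rule monE)
  have cop: "coprime p q" using primes_coprime[OF prime q(1)] q(2) by auto
  have q0: "q > 0" using prime_gt_0_nat[OF q(1)] .
  obtain x y where xy: "p * x = q * y + 1" using bezout_nat[of p q] cop p_gt_1 by auto
  \<comment> \<open>These exponents are chosen so that j + p s = q n: multiplying \<alpha>^j by a^s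
    = \<alpha>^(ps) turns it into a q-th power.\<close>
  define s where "s = x * j * (q - 1)"
  define n where "n = j + y * j * (q - 1)"
  have "j + p * s = j + (p * x) * (j * (q - 1))" by (simp add: s_def)
  also have "\<dots> = q * n" unfolding xy n_def using q0 by (cases q) (simp_all add: algebra_simps)
  finally have js: "j + p * s = q * n" .
  have as: "a [^] s \<in> K" "a [^] s \<noteq> \<zero>"
    using Units_neq_zero[OF Units_pow_closed[OF K_Units[OF a a_nonzero], of s]] by auto
  define c where "c = k \<otimes> inv (a [^] s)"
  have ia: "inv (a [^] s) \<in> K" "a [^] s \<otimes> inv (a [^] s) = \<one>" using K_inv as by auto
  have c: "c \<in> K" using kj ia by (simp add: c_def)
  have iw: "inv (\<alpha> [^] n) \<in> mon" "inv (\<alpha> [^] n) \<otimes> \<alpha> [^] n = \<one>"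
    using mon_inv[OF alpha_pow_mon] Units_l_inv[OF mon_Units[OF alpha_pow_mon]] by auto
  define \<beta>' where "\<beta>' = \<beta> \<otimes> inv (\<alpha> [^] n)"
  have b': "\<beta>' \<in> B" using b mon_B iw by (simp add: \<beta>'_def)
  have bn: "\<beta> = \<beta>' \<otimes> \<alpha> [^] n" unfolding \<beta>'_def using b iw mon_B[OF iw(1)] by (simp add: m_assoc)
  have e1: "\<beta> [^] q = c \<otimes> \<alpha> [^] (q * n)"
  proof -
    have "c \<otimes> \<alpha> [^] (q * n) = c \<otimes> (\<alpha> [^] j \<otimes> (\<alpha> [^] p) [^] s)"
      unfolding js[symmetric] by (simp add: nat_pow_mult nat_pow_pow)
    also have "\<dots> = k \<otimes> \<alpha> [^] j \<otimes> (a [^] s \<otimes> inv (a [^] s))"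
      unfolding alpha_pow c_def using kj(1) ia(1) by (simp add: m_ac)
    finally show ?thesis using kj ia by simp
  qed
  have "\<beta> [^] q = \<beta>' [^] q \<otimes> \<alpha> [^] (q * n)"
    by (subst bn) (use b' in \<open>simp add: nat_pow_distrib nat_pow_pow mult.commute\<close>)
  then have "\<beta>' [^] q = c"
    using e1 Units_l_cancel[OF mon_Units[OF alpha_pow_mon[of "q * n"]], of "\<beta>' [^] q" c] b' c
    by (simp add: m_comm)
  then have "N \<beta>' [^] q = c [^] p" using N_pow[OF b', of q] c by (simp add: N_scalar)
  then obtain d where d: "d \<in> K" "d [^] q = c"
    using root_of_coprime[OF c N_closed[OF b'] _ cop] q0 p_gt_1 by auto
  have "d \<noteq> \<zero>"
  proof
    assume "d = \<zero>"
    then have "c = \<zero>" using d q0 by (simp add: nat_pow_zero)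
    then have "\<beta> [^] q = \<zero>" using e1 by simp
    then show False using Units_neq_zero[OF mon_Units[OF b(3)]] by simp
  qed
  moreover have "(d \<otimes> \<alpha> [^] n) [^] q = \<beta> [^] q"
    unfolding e1 using d by (simp add: nat_pow_distrib nat_pow_pow mult.commute)
  ultimately show ?thesis using d monI by blast
qed

end

section \<open>Towers of radical extensions\<close>

text \<open>
  \<open>P\<close> bounds the primes that divide orders of elements of \<open>U\<close> modulo \<open>K\<close>.
\<close>

locale kummer_group = cring_subfield R K for R (structure) and K +
  fixes U :: "'a set" and P :: "nat set"
  assumes U_Units: "u \<in> U \<Longrightarrow> u \<in> Units R"
    and U_mult: "u \<in> U \<Longrightarrow> v \<in> U \<Longrightarrow> u \<otimes> v \<in> U"
    and U_inv: "u \<in> U \<Longrightarrow> inv u \<in> U"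
    and K_U: "k \<in> K \<Longrightarrow> k \<noteq> \<zero> \<Longrightarrow> k \<in> U"
    and U_tor: "u \<in> U \<Longrightarrow> \<exists>n>0::nat. u [^] n \<in> K \<and> (\<forall>q. Factorial_Ring.prime q \<longrightarrow> q dvd n \<longrightarrow> q \<in> P)"
    and U_ess: "u \<in> U \<Longrightarrow> Factorial_Ring.prime (q::nat) \<Longrightarrow> u [^] q = \<one> \<Longrightarrow> u \<in> K"
    and P_char: "q \<in> P \<Longrightarrow> add_pow R q \<one> \<noteq> \<zero>"
begin

lemma U_carrier [simp]: "u \<in> U \<Longrightarrow> u \<in> carrier R"
  using U_Units by blast

lemma U_nonzero: "u \<in> U \<Longrightarrow> u \<noteq> \<zero>"
  using U_Units Units_neq_zero by blast

lemma U_pow: "u \<in> U \<Longrightarrow> u [^] (n::nat) \<in> U"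
  by (induction n) (auto intro: U_mult K_U)

lemma minus_one_U: "\<ominus> \<one> \<in> U"
proof (rule K_U)
  show "\<ominus> \<one> \<noteq> \<zero>"
  proof
    assume "\<ominus> \<one> = \<zero>"
    then have "\<ominus> (\<ominus> \<one>) = \<zero>" by simp
    then show False by simp
  qed
qed simp

lemma U_cancel: "u \<in> U \<Longrightarrow> v \<in> U \<Longrightarrow> u \<otimes> inv v \<otimes> v = u"
  using U_Units[of v] by (simp add: m_assoc)

lemma U_div_pow:
  assumes "u \<in> U" "v \<in> U" "u [^] (n::nat) = k \<otimes> v [^] n" "k \<in> carrier R"
  shows "(u \<otimes> inv v) [^] n = k"
proof -
  have v: "v \<in> Units R" "inv v \<in> carrier R" using U_Units assms(2) by auto
  have "(u \<otimes> inv v) [^] n = k \<otimes> (v [^] n \<otimes> inv v [^] n)"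
    using assms v by (simp add: nat_pow_distrib m_assoc)
  also have "v [^] n \<otimes> inv v [^] n = (v \<otimes> inv v) [^] n"
    by (rule nat_pow_distrib[symmetric]) (use assms v in auto)
  also have "v \<otimes> inv v = \<one>" using v by simp
  finally show ?thesis using assms by simp
qed

text \<open>The quotient of the two roots has q-th power 1, so \<open>U_ess\<close> puts it into
  \<open>K\<close>.\<close>

lemma U_root_eq:
  assumes "u \<in> U" "w \<in> U" "u [^] q = w [^] q" "Factorial_Ring.prime (q::nat)"
  shows "u \<otimes> inv w \<in> K" "u \<otimes> inv w \<noteq> \<zero>"
  using U_ess[OF U_mult[OF assms(1) U_inv[OF assms(2)]] assms(4)] U_div_pow[of u w q \<one>]
    U_nonzero[OF U_mult[OF assms(1) U_inv[OF assms(2)]]] assms by auto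

end

text \<open>The condition \<open>root\<close> concerns only those \<beta> whose q-th power is also
  attained in \<open>U\<close>. This restriction is what lets the step adjoining i use that -4 has
  no fourth root in \<open>U\<close>; in the other steps every \<beta> satisfies the
  conclusion.\<close>

locale kummer_step = kummer_group R K U P + pure_extension R K \<alpha> a p
  for R (structure) and K U P \<alpha> a p +
  assumes alpha_U: "\<alpha> \<in> U"
    and root: "\<beta> \<in> B \<Longrightarrow> \<beta> \<noteq> \<zero> \<Longrightarrow> Factorial_Ring.prime (q::nat) \<Longrightarrow> u \<in> U \<Longrightarrow> u [^] q = \<beta> [^] q \<Longrightarrow>
      \<beta> [^] q \<in> mon \<Longrightarrow> \<exists>w\<in>mon. w [^] q = \<beta> [^] q"
begin

lemma mon_U: "x \<in> mon \<Longrightarrow> x \<in> U"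
  by (elim monE) (auto intro: U_mult K_U U_pow alpha_U)

lemma U_root_mon:
  assumes "u \<in> U" "w \<in> mon" "w [^] q = u [^] q" "Factorial_Ring.prime (q::nat)"
  shows "u \<in> mon"
proof -
  have "u \<otimes> inv w \<in> mon"
    using U_root_eq[OF assms(1) mon_U[OF assms(2)] assms(3)[symmetric] assms(4)] by (intro K_mon)
  then show ?thesis using mon_mult[OF _ assms(2)] U_cancel[OF assms(1) mon_U[OF assms(2)]] by force
qed

text \<open>Induction on an exponent n with u^n in K: for a prime q dividing n, u^q is a monomial by
  induction, so \<open>root\<close> with \<beta> = u yields a monomial with the same q-th power, and
  essentiality makes u differ from it by a factor in K.\<close>

lemma U_B_mon:
  assumes "u \<in> U" "u \<in> B" shows "u \<in> mon"
proof -
  have "\<lbrakk>n > 0; u \<in> U; u \<in> B; u [^] n \<in> K\<rbrakk> \<Longrightarrow> u \<in> mon" for n :: nat and u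
  proof (induction n arbitrary: u rule: less_induct)
    case (less n)
    show ?case
    proof (cases "n = 1")
      case True
      then show ?thesis using less.prems U_nonzero by (intro K_mon) auto
    next
      case False
      then obtain q where q: "Factorial_Ring.prime q" "q dvd n" using prime_factor_nat by blast
      then obtain m where m: "n = q * m" by blast
      have "m > 0" "m < n" using less.prems(1) m prime_gt_1_nat[OF q(1)] by auto
      moreover have "(u [^] q) [^] m \<in> K" using less.prems m by (simp add: nat_pow_pow)
      moreover have "u [^] q \<in> B" using less.prems(3) by simp
      ultimately have "u [^] q \<in> mon" using less.IH[of m "u [^] q"] U_pow less.prems(2) by simp
      then obtain w where "w \<in> mon" "w [^] q = u [^] q"
        using root[OF less.prems(3) U_nonzero q(1) less.prems(2)] less.prems(2) by auto
      then show ?thesis using U_root_mon less.prems(2) q(1) by simp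
    qed
  qed
  then show ?thesis using U_tor[OF assms(1)] assms by blast
qed

text \<open>The group that takes over the role of \<open>U\<close> when the base field is enlarged
  to \<open>B\<close>.\<close>

definition U' :: "'a set" where "U' = {b \<otimes> u |b u. b \<in> B \<and> b \<noteq> \<zero> \<and> u \<in> U}"

lemma U'I: "b \<in> B \<Longrightarrow> b \<noteq> \<zero> \<Longrightarrow> u \<in> U \<Longrightarrow> b \<otimes> u \<in> U'"
  unfolding U'_def by blast

lemma U'E:
  assumes "z \<in> U'" obtains b u where "b \<in> B" "b \<noteq> \<zero>" "u \<in> U" "z = b \<otimes> u"
  using assms unfolding U'_def by blast

lemma U_U': "u \<in> U \<Longrightarrow> u \<in> U'"
  using U'I[of \<one> u] by simp

lemma inv_B: "b \<in> B \<Longrightarrow> b \<noteq> \<zero> \<Longrightarrow> inv b \<in> B \<and> inv b \<noteq> \<zero>"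
  using B.K_inv[of b] by (auto simp: )

lemma pow_eq_of_mult:
  assumes "b \<in> B" "b \<noteq> \<zero>" "u \<in> U" "(b \<otimes> u) [^] (q::nat) = k" "k \<in> carrier R"
  shows "u [^] q = k \<otimes> (inv b) [^] q"
proof -
  have b: "inv b \<in> B" "inv b \<otimes> b = \<one>" using B.K_inv assms by auto
  have "(inv b) [^] q \<otimes> (b \<otimes> u) [^] q = (inv b \<otimes> b \<otimes> u) [^] q"
    using b(1) assms by (simp add: nat_pow_distrib m_assoc)
  then show ?thesis using b assms by (simp add: m_comm)
qed

text \<open>Only essentiality over B is at stake; group laws, torsion and the allowed primes carry
  over from the factors.\<close>

lemma kummer_group_step: "kummer_group R B U' P"
proof (intro kummer_group.intro kummer_group_axioms.intro B.cring_subfield_axioms)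
  show "\<And>u. u \<in> U' \<Longrightarrow> u \<in> Units R"
    by (elim U'E) (auto intro: B.K_Units U_Units)
  show "\<And>k. k \<in> B \<Longrightarrow> k \<noteq> \<zero> \<Longrightarrow> k \<in> U'"
    using U'I[OF _ _ K_U[of \<one>]] by simp
  show "\<And>q. q \<in> P \<Longrightarrow> add_pow R q \<one> \<noteq> \<zero>" by (rule P_char)
next
  fix z y assume "z \<in> U'" "y \<in> U'"
  then obtain b u c v where *: "b \<in> B" "b \<noteq> \<zero>" "u \<in> U" "z = b \<otimes> u" "c \<in> B" "c \<noteq> \<zero>" "v \<in> U" "y = c \<otimes> v"
    by (elim U'E)
  then have "z \<otimes> y = (b \<otimes> c) \<otimes> (u \<otimes> v)" by (simp add: m_ac)
  moreover have "b \<otimes> c \<noteq> \<zero>" using B.K_integral[of b c] * by auto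
  ultimately show "z \<otimes> y \<in> U'" using U'I * U_mult by simp
next
  fix z assume "z \<in> U'"
  then obtain b u where *: "b \<in> B" "b \<noteq> \<zero>" "u \<in> U" "z = b \<otimes> u" by (elim U'E)
  have "inv z = inv b \<otimes> inv u"
    unfolding *(4)
  proof (rule comm_inv_char)
    have c: "inv b \<in> carrier R" "inv u \<in> carrier R" using inv_B U_inv * by auto
    have "b \<otimes> u \<otimes> (inv b \<otimes> inv u) = (b \<otimes> inv b) \<otimes> (u \<otimes> inv u)"
      using * c by (simp add: m_ac)
    then show "b \<otimes> u \<otimes> (inv b \<otimes> inv u) = \<one>" using B.K_inv U_Units * by simp
  qed (use * inv_B U_inv in auto)
  then show "inv z \<in> U'" using U'I inv_B U_inv * by simp
next
  fix z assume "z \<in> U'"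
  then obtain b u where *: "b \<in> B" "b \<noteq> \<zero>" "u \<in> U" "z = b \<otimes> u" by (elim U'E)
  obtain n :: nat where n: "n > 0" "u [^] n \<in> K" "\<forall>q. Factorial_Ring.prime q \<longrightarrow> q dvd n \<longrightarrow> q \<in> P"
    using U_tor[OF *(3)] by blast
  moreover have "z [^] n \<in> B" using * n by (simp add: nat_pow_distrib)
  ultimately show "\<exists>n>0. z [^] n \<in> B \<and> (\<forall>q. Factorial_Ring.prime q \<longrightarrow> q dvd n \<longrightarrow> q \<in> P)" by blast
next
  fix z and q :: nat assume z: "z \<in> U'" and q: "Factorial_Ring.prime q" "z [^] q = \<one>"
  obtain b u where *: "b \<in> B" "b \<noteq> \<zero>" "u \<in> U" "z = b \<otimes> u" using z by (elim U'E)
  have ib: "inv b \<in> B" "inv b \<noteq> \<zero>" using inv_B * by auto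
  have eq: "u [^] q = inv b [^] q" using pow_eq_of_mult[OF *(1,2,3), of q \<one>] q * ib by simp
  \<comment> \<open>From (b u)^q = 1 the element u^q = b^(-q) lies in both U and B and is therefore
    a monomial. \<open>root\<close> for b^(-1) then makes u itself a monomial, so z = b u lies in
    B.\<close>
  have "u [^] q \<in> B" unfolding eq using ib by simp
  then have "u [^] q \<in> mon" by (rule U_B_mon[OF U_pow[OF *(3)]])
  then have "inv b [^] q \<in> mon" unfolding eq .
  then obtain w where "w \<in> mon" "w [^] q = u [^] q"
    using root[OF ib q(1) *(3) eq] eq by auto
  then have "u \<in> mon" using U_root_mon * q by simp
  then show "z \<in> B" using * mon_B by simp
qed

end

section \<open>Invariants of towers and the two kinds of steps\<close>

context cring
begin

text \<open>The second condition excludes the exceptional case of \<open>mon_closed_two\<close>: a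
  square root e of -a would make \<alpha>/e a square root of -1 in \<open>U\<close>.\<close>

definition tower_base :: "nat set \<Rightarrow> 'a set \<Rightarrow> 'a set \<Rightarrow> bool" where
  "tower_base P K U \<longleftrightarrow> kummer_group R K U P \<and> (\<forall>u\<in>U. u \<otimes> u = \<ominus> \<one> \<longrightarrow> u \<in> K)"

text \<open>The last clause serves the primary parts: when \<open>p\<close> is the only prime
  involved, taking p-th roots within \<open>U'\<close> does not lead out of
  \<open>U\<close>.\<close>

definition tower_ext :: "nat set \<Rightarrow> 'a set \<Rightarrow> 'a set \<Rightarrow> 'a set \<Rightarrow> 'a set \<Rightarrow> bool" where
  "tower_ext P K U K' U' \<longleftrightarrow> tower_base P K' U' \<and> K \<subseteq> K' \<and> U \<subseteq> U' \<and>
     (\<forall>p. P = {p} \<longrightarrow> (\<forall>f\<in>U'. f [^] p \<in> U \<longrightarrow> f \<in> U))"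

end

lemma (in kummer_group) no_root_of_pow:
  assumes "\<alpha> \<in> U" "\<alpha> \<notin> K" "Factorial_Ring.prime (p::nat)" "d \<in> K"
  shows "d [^] p \<noteq> \<alpha> [^] p"
proof
  assume eq: "d [^] p = \<alpha> [^] p"
  have "d \<noteq> \<zero>"
    using eq U_nonzero[OF U_pow[OF assms(1), of p]] prime_gt_0_nat[OF assms(3)] by (auto simp: nat_pow_zero)
  then have d: "d \<in> U" using K_U assms by simp
  have "\<alpha> \<otimes> inv d \<in> K" using U_root_eq[OF assms(1) d eq[symmetric] assms(3)] by simp
  then have "\<alpha> \<otimes> inv d \<otimes> d \<in> K" using assms(4) by simp
  then show False using U_cancel[OF assms(1) d] assms(2) by simp
qed

lemma (in kummer_group) tower_step:
  assumes i: "\<And>u. u \<in> U \<Longrightarrow> u \<otimes> u = \<ominus> \<one> \<Longrightarrow> u \<in> K"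
    and al: "\<alpha> \<in> U" "\<alpha> \<notin> K" and p: "Factorial_Ring.prime p" "p \<in> P" "\<alpha> [^] p \<in> K"
  shows "\<exists>K' U'. tower_ext P K U K' U' \<and> \<alpha> \<in> K'"
proof -
  interpret pure_extension R K \<alpha> "\<alpha> [^] p" p
    using no_root_of_pow[OF al p(1)] al p by unfold_locales auto
  have closed: "\<beta> \<in> mon" if b: "\<beta> \<in> B" "\<beta> \<noteq> \<zero>" "\<beta> [^] p \<in> mon" for \<beta>
  proof (cases "p = 2")
    case False
    then have "odd p" using p(1) prime_odd_nat[of p] prime_ge_2_nat[OF p(1)] by simp
    then show ?thesis using mon_closed_odd b P_char p(2) by simp
  next
    case True
    \<comment> \<open>Such an e gives (\<alpha>/e)^2 = -1, whence \<alpha>/e lies in K and so does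
      \<alpha>.\<close>
    have False if e: "e \<in> K" "e \<otimes> e = \<ominus> (\<alpha> [^] p)" for e
    proof -
      have "e \<noteq> \<zero>"
      proof
        assume "e = \<zero>"
        then have "\<ominus> (\<alpha> [^] p) = \<zero>" using e by simp
        then have "\<alpha> [^] p = \<zero>" using al(1) by simp
        then show False using a_nonzero by simp
      qed
      then have eU: "e \<in> U" using e K_U by simp
      have "\<alpha> [^] (2::nat) = \<ominus> \<one> \<otimes> e [^] (2::nat)"
        using e(1) al(1) minus_minus[of "\<alpha> [^] p"] unfolding True
        by (simp add: numeral_2_eq_2 l_minus e(2)[unfolded True numeral_2_eq_2])
      then have "(\<alpha> \<otimes> inv e) [^] (2::nat) = \<ominus> \<one>" by (intro U_div_pow al eU) auto
      then have "(\<alpha> \<otimes> inv e) \<otimes> (\<alpha> \<otimes> inv e) = \<ominus> \<one>"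
        using U_mult[OF al(1) U_inv[OF eU]] by (simp add: numeral_2_eq_2)
      then have "\<alpha> \<otimes> inv e \<in> K" using i U_mult[OF al(1) U_inv[OF eU]] by simp
      then have "\<alpha> \<otimes> inv e \<otimes> e \<in> K" using e by simp
      then show False using U_cancel[OF al(1) eU] al(2) by simp
    qed
    then show ?thesis using mon_closed_two[OF b P_char[OF p(2)] True] by blast
  qed
  have mroot: "\<exists>w\<in>mon. w [^] q = \<beta> [^] q"
    if "\<beta> \<in> B" "\<beta> \<noteq> \<zero>" "Factorial_Ring.prime q" "\<beta> [^] q \<in> mon" for \<beta> and q :: nat
    using closed[of \<beta>] mon_root_coprime[of \<beta> q] that by (cases "q = p") auto
  interpret kummer_step R K U P \<alpha> "\<alpha> [^] p" p
    using al mroot by unfold_locales auto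
  \<comment> \<open>For u = b v with u^2 = -1 the element -v^2 = b^(-2) lies in U and B, so it has a
    monomial square root w. Then (v/w)^2 = -1 forces v/w into K and v into B.\<close>
  have "u \<in> B" if u: "u \<in> U'" "u \<otimes> u = \<ominus> \<one>" for u
  proof -
    obtain b v where *: "b \<in> B" "b \<noteq> \<zero>" "v \<in> U" "u = b \<otimes> v" using u(1) by (elim U'E)
    have ib: "inv b \<in> B" "inv b \<noteq> \<zero>" using inv_B * by auto
    have "(b \<otimes> v) [^] (2::nat) = \<ominus> \<one>" using u(2) * by (simp add: numeral_2_eq_2)
    from pow_eq_of_mult[OF *(1,2,3) this]
    have eq: "v [^] (2::nat) = \<ominus> \<one> \<otimes> inv b [^] (2::nat)" by simp
    then have "\<ominus> \<one> \<otimes> v [^] (2::nat) = inv b [^] (2::nat)"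
      using ib by (simp add: l_minus)
    moreover have "\<ominus> \<one> \<otimes> v [^] (2::nat) \<in> U"
      by (rule U_mult[OF minus_one_U U_pow[OF *(3)]])
    moreover have "inv b [^] (2::nat) \<in> B" using ib by simp
    ultimately have "inv b [^] (2::nat) \<in> mon" using U_B_mon by simp
    then obtain w where w: "w \<in> mon" "w [^] (2::nat) = inv b [^] (2::nat)"
      using mroot[OF ib two_is_prime_nat] by blast
    have wU: "w \<in> U" by (rule mon_U[OF w(1)])
    have "(v \<otimes> inv w) [^] (2::nat) = \<ominus> \<one>" using eq w by (intro U_div_pow * wU) auto
    then have "v \<otimes> inv w \<otimes> (v \<otimes> inv w) = \<ominus> \<one>"
      using U_mult[OF *(3) U_inv[OF wU]] by (simp add: numeral_2_eq_2)
    then have "v \<otimes> inv w \<in> K" using i U_mult[OF *(3) U_inv[OF wU]] by simp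
    then have "v \<otimes> inv w \<otimes> w \<in> B" using mon_B[OF w(1)] by simp
    then have "v \<in> B" using U_cancel[OF *(3) wU] by simp
    then show ?thesis using * by simp
  qed
  \<comment> \<open>For f = b v the power b^p lies in U and B, so it is a monomial; closure of
    monomials under p-th roots makes b a monomial, hence an element of U.\<close>
  moreover have "f \<in> U" if P: "P = {p'}" and f: "f \<in> U'" "f [^] p' \<in> U" for f p'
  proof -
    have pp: "p' = p" using P p(2) by simp
    obtain b v where *: "b \<in> B" "b \<noteq> \<zero>" "v \<in> U" "f = b \<otimes> v" using f(1) by (elim U'E)
    have vp: "v [^] p \<in> U" using * U_pow by simp
    have "f [^] p = b [^] p \<otimes> v [^] p" using * by (simp add: nat_pow_distrib)
    then have "f [^] p \<otimes> inv (v [^] p) = b [^] p"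
      using U_Units[OF vp] * by (simp add: m_assoc)
    then have "b [^] p \<in> U" using U_mult[OF f(2)[unfolded pp] U_inv[OF vp]] by simp
    then have "b [^] p \<in> mon" using * by (intro U_B_mon) auto
    then have "b \<in> mon" using closed * by simp
    then show "f \<in> U" using mon_U U_mult * by simp
  qed
  moreover have "K \<subseteq> B" "U \<subseteq> U'" using U_U' by auto
  ultimately have "tower_ext P K U B U'"
    using kummer_group_step unfolding tower_ext_def tower_base_def by blast
  then show ?thesis using alpha_B by blast
qed

text \<open>No \<open>tower_ext\<close> is claimed, since its radical clause fails for P = {2}: 1 +
  i lies in the new group and has its square 2 i in \<open>U\<close>, but as a fourth root of -4 it
  is not in \<open>U\<close>.\<close>

lemma (in kummer_group) adjoin_imaginary_unit:
  assumes i: "i \<in> U" "i \<notin> K" "i \<otimes> i = \<ominus> \<one>"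
    and four: "\<And>u. u \<in> U \<Longrightarrow> u [^] (4::nat) \<noteq> \<ominus> (add_pow R (4::nat) \<one>)"
  shows "\<exists>K' U'. tower_base P K' U' \<and> K \<subseteq> K' \<and> U \<subseteq> U'"
proof -
  have i2: "i [^] (2::nat) = \<ominus> \<one>" using i by (simp add: numeral_2_eq_2)
  \<comment> \<open>No odd power of i lies in K, so 2 divides the exponent supplied by
    \<open>U_tor\<close>. In particular the characteristic is not 2.\<close>
  have p2: "2 \<in> P"
  proof -
    obtain n :: nat where n: "n > 0" "i [^] n \<in> K" "\<forall>q. Factorial_Ring.prime q \<longrightarrow> q dvd n \<longrightarrow> q \<in> P"
      using U_tor[OF i(1)] by blast
    have "even n"
    proof (rule ccontr)
      assume "odd n"
      then obtain m where m: "n = 2 * m + 1" by (auto elim: oddE)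
      define s where "s = i [^] (2 * m)"
      have "s = (i [^] (2::nat)) [^] m" using i by (simp add: s_def nat_pow_pow)
      then have s: "s \<in> K" unfolding i2 by simp
      have su: "s \<noteq> \<zero>" unfolding s_def using U_nonzero U_pow i by blast
      have "i [^] n = s \<otimes> i" using i by (simp add: m s_def)
      then have "inv s \<otimes> (s \<otimes> i) \<in> K" using n(2) K_inv(1)[OF s su] by simp
      moreover have "inv s \<otimes> (s \<otimes> i) = i"
        using K_inv[OF s su] s i by (simp add: m_assoc[symmetric])
      ultimately show False using i by simp
    qed
    then show ?thesis using n(3) two_is_prime_nat by blast
  qed
  interpret pure_extension R K i "\<ominus> \<one>" 2
    using no_root_of_pow[OF i(1,2) two_is_prime_nat] i i2 two_is_prime_nat by unfold_locales auto
  \<comment> \<open>The product s = e i satisfies s^2 = -1 and (e + i)^2 = 2 s. Squaring again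
    produces -4, and u/y becomes the forbidden fourth root.\<close>
  have exc: False
    if u: "u \<in> U" "u [^] (2::nat) = \<beta> [^] (2::nat)"
      and b: "e \<in> K" "y \<in> K" "y \<noteq> \<zero>" "e \<otimes> e = \<ominus> (\<ominus> \<one>)" "\<beta> = y \<otimes> (e \<oplus> i)" for u \<beta> e y
  proof -
    have yU: "y \<in> U" using K_U b by simp
    have e1: "e \<otimes> e = \<one>" using b(4) by simp
    define s where "s = e \<otimes> i"
    have s: "s \<in> carrier R" using b i by (simp add: s_def)
    have ss: "s \<otimes> s = \<ominus> \<one>"
    proof -
      have "s \<otimes> s = (e \<otimes> e) \<otimes> (i \<otimes> i)" unfolding s_def using b(1) i(1) by (simp add: m_ac)
      then show ?thesis unfolding e1 i(3) by simp
    qed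
    have "(e \<oplus> i) \<otimes> (e \<oplus> i) = (e \<otimes> e \<oplus> i \<otimes> i) \<oplus> (s \<oplus> s)"
      unfolding s_def using b(1) i(1) by (simp add: l_distr r_distr m_ac a_ac)
    also have "\<dots> = s \<oplus> s" unfolding e1 i(3) using s by (simp add: r_neg)
    finally have sq: "(e \<oplus> i) [^] (2::nat) = s \<oplus> s"
      using b(1) i(1) by (simp add: numeral_2_eq_2)
    have "(e \<oplus> i) [^] (4::nat) = ((e \<oplus> i) [^] (2::nat)) [^] (2::nat)"
      using nat_pow_pow[of "e \<oplus> i" 2 2] b(1) i(1) by simp
    also have "\<dots> = (s \<oplus> s) \<otimes> (s \<oplus> s)" unfolding sq using s by (simp add: numeral_2_eq_2)
    also have "\<dots> = s \<otimes> s \<oplus> s \<otimes> s \<oplus> s \<otimes> s \<oplus> s \<otimes> s"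
      using s by (simp add: l_distr r_distr a_assoc)
    also have "\<dots> = \<ominus> (add_pow R (4::nat) \<one>)"
      unfolding ss by (simp add: numeral_eq_Suc minus_add a_ac)
    finally have q: "(e \<oplus> i) [^] (4::nat) = \<ominus> (add_pow R (4::nat) \<one>)" .
    have "u [^] (4::nat) = (u [^] (2::nat)) [^] (2::nat)" using u(1) by (simp add: nat_pow_pow)
    also have "\<dots> = \<beta> [^] (4::nat)" unfolding u(2) using b i by (simp add: nat_pow_pow)
    also have "\<dots> = \<ominus> (add_pow R (4::nat) \<one>) \<otimes> y [^] (4::nat)"
      unfolding b(5) q[symmetric] using b(1,2) i(1) by (simp add: nat_pow_distrib m_comm)
    finally have "(u \<otimes> inv y) [^] (4::nat) = \<ominus> (add_pow R (4::nat) \<one>)"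
      by (intro U_div_pow u yU) simp_all
    then show False using four U_mult[OF u(1) U_inv[OF yU]] by blast
  qed
  interpret kummer_step R K U P i "\<ominus> \<one>" 2
  proof (unfold_locales)
    fix \<beta> u and q :: nat
    assume *: "\<beta> \<in> B" "\<beta> \<noteq> \<zero>" "Factorial_Ring.prime q" "u \<in> U" "u [^] q = \<beta> [^] q" "\<beta> [^] q \<in> mon"
    show "\<exists>w\<in>mon. w [^] q = \<beta> [^] q"
    proof (cases "q = 2")
      case True
      have "\<beta> \<in> mon"
        using mon_closed_two[OF *(1,2) *(6)[unfolded True] P_char[OF p2] refl] exc *(4,5) True by blast
      then show ?thesis by blast
    next
      case False
      then show ?thesis using mon_root_coprime * by simp
    qed
  qed (rule i(1))
  interpret U': kummer_group R B U' P by (rule kummer_group_step)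
  \<comment> \<open>Both u and i square to -1, so essentiality over B, already established, puts u/i
    into B.\<close>
  have "u \<in> B" if u: "u \<in> U'" "u \<otimes> u = \<ominus> \<one>" for u
  proof -
    have iU: "i \<in> U'" using U_U' i by simp
    have "u \<otimes> inv i \<in> B"
      using U'.U_root_eq(1)[OF u(1) iU _ two_is_prime_nat] u i2 i(1) by (simp add: numeral_2_eq_2)
    then have "u \<otimes> inv i \<otimes> i \<in> B" by simp
    then show ?thesis using U'.U_cancel[OF u(1) iU] by simp
  qed
  then have "tower_base P B U'" unfolding tower_base_def using kummer_group_step by blast
  moreover have "K \<subseteq> B" "U \<subseteq> U'" using U_U' by auto
  ultimately show ?thesis by blast
qed

section \<open>Adjoining finitely many elements\<close>

context cring
begin

lemma tower_ext_refl: "tower_base P K U \<Longrightarrow> tower_ext P K U K U"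
  by (simp add: tower_ext_def)

lemma tower_ext_trans:
  assumes "tower_ext P K U K' U'" "tower_ext P K' U' K'' U''"
  shows "tower_ext P K U K'' U''"
proof -
  have "f \<in> U" if P: "P = {p}" and f: "f \<in> U''" "f [^] p \<in> U" for p f
  proof -
    have "f [^] p \<in> U'" using assms(1) f(2) unfolding tower_ext_def by auto
    then have "f \<in> U'" using assms(2) P f(1) unfolding tower_ext_def by simp
    then show ?thesis using assms(1) P f(2) unfolding tower_ext_def by simp
  qed
  then show ?thesis using assms unfolding tower_ext_def by auto
qed

text \<open>For n = q m the element u^m has its q-th power in K, so one step adjoins it if
  necessary. Over the new field the exponent m suffices for u, and its prime divisors still belong
  to \<open>P\<close>.\<close>

lemma tower_adjoin_aux:
  fixes n :: nat
  assumes "tower_base P K U" "u \<in> U" "n > 0" "u [^] n \<in> K"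
    "\<And>q. Factorial_Ring.prime q \<Longrightarrow> q dvd n \<Longrightarrow> q \<in> P"
  shows "\<exists>K' U'. tower_ext P K U K' U' \<and> u \<in> K'"
  using assms
proof (induction n arbitrary: K U rule: less_induct)
  case (less n)
  note base = less.prems(1) and uU = less.prems(2) and n = less.prems(3,4) and nP = less.prems(5)
  have kg: "kummer_group R K U P" using base unfolding tower_base_def by (rule conjunct1)
  have im: "v \<in> K" if "v \<in> U" "v \<otimes> v = \<ominus> \<one>" for v
    using base that unfolding tower_base_def by simp
  show ?case
  proof (cases "n = 1")
    case True
    then have "u [^] (1::nat) \<in> K" using n by simp
    then have "u \<in> K" using kummer_group.U_carrier[OF kg uU] by simp
    then show ?thesis using tower_ext_refl[OF base] by (intro exI conjI)
  next
    case False
    then obtain q where q: "Factorial_Ring.prime q" "q dvd n" using prime_factor_nat by auto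
    then obtain m where m: "n = q * m" by (elim dvdE)
    have m': "m > 0" "m < n" using n(1) m prime_gt_1_nat[OF q(1)] by auto
    have mP: "r \<in> P" if "Factorial_Ring.prime r" "r dvd m" for r
      using nP[OF that(1)] that(2) m by simp
    show ?thesis
    proof (cases "u [^] m \<in> K")
      case True
      show ?thesis by (rule less.IH[OF m'(2) base uU m'(1) True mP])
    next
      case F: False
      have "(u [^] m) [^] q = u [^] n"
        unfolding m by (subst nat_pow_pow[OF kummer_group.U_carrier[OF kg uU]]) (simp only: mult.commute)
      then have pw: "(u [^] m) [^] q \<in> K" using n(2) by (simp only:)
      have "\<exists>K1 U1. tower_ext P K U K1 U1 \<and> u [^] m \<in> K1"
        by (rule kummer_group.tower_step[OF kg im kummer_group.U_pow[OF kg uU] F q(1) nP[OF q] pw])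
      then obtain K1 U1 where 1: "tower_ext P K U K1 U1" "u [^] m \<in> K1" by (elim exE conjE)
      then have "tower_base P K1 U1" "u \<in> U1" using uU unfolding tower_ext_def by auto
      then have "\<exists>K2 U2. tower_ext P K1 U1 K2 U2 \<and> u \<in> K2"
        by (rule less.IH[OF m'(2) _ _ m'(1) 1(2) mP])
      then obtain K2 U2 where "tower_ext P K1 U1 K2 U2" "u \<in> K2" by (elim exE conjE)
      then show ?thesis using tower_ext_trans[OF 1(1), of K2 U2] by (intro exI conjI)
    qed
  qed
qed

lemma tower_adjoin:
  assumes "tower_base P K U" "u \<in> U"
  shows "\<exists>K' U'. tower_ext P K U K' U' \<and> u \<in> K'"
proof -
  have kg: "kummer_group R K U P" using assms(1) unfolding tower_base_def by (rule conjunct1)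
  obtain n :: nat where "n > 0" "u [^] n \<in> K" "\<forall>q. Factorial_Ring.prime q \<longrightarrow> q dvd n \<longrightarrow> q \<in> P"
    using kummer_group.U_tor[OF kg assms(2)] by (elim exE conjE)
  then show ?thesis by (intro tower_adjoin_aux[OF assms]) auto
qed

lemma tower_adjoin_finite:
  assumes "finite T" "tower_base P K U" "T \<subseteq> U"
  shows "\<exists>K' U'. tower_ext P K U K' U' \<and> T \<subseteq> K'"
  using assms
proof (induction T rule: finite_induct)
  case empty
  then show ?case using tower_ext_refl by blast
next
  case (insert t T)
  then obtain K1 U1 where 1: "tower_ext P K U K1 U1" "T \<subseteq> K1" by auto
  then have "tower_base P K1 U1" "t \<in> U1" using insert.prems unfolding tower_ext_def by auto
  then obtain K2 U2 where 2: "tower_ext P K1 U1 K2 U2" "t \<in> K2" using tower_adjoin by blast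
  then have "insert t T \<subseteq> K2" using 1 unfolding tower_ext_def by auto
  then show ?case using tower_ext_trans[OF 1(1) 2(1)] by blast
qed

end

section \<open>The universal algebra as a ring\<close>

locale graded_extension = K: field K + U: comm_group U
  for K :: "('k, 'm) ring_scheme" (structure) and U :: "('u, 'n) monoid_scheme" +
  fixes \<iota> :: "'k \<Rightarrow> 'u" and x :: "'u set \<Rightarrow> 'u"
  assumes iota: "\<iota> \<in> mon (units_of K) U" and rep: "is_rep_system K U \<iota> x"
begin

abbreviation "H \<equiv> base_units K \<iota>"
abbreviation "D \<equiv> grading_group K U \<iota>"
abbreviation "cls u \<equiv> H #>\<^bsub>U\<^esub> u"
abbreviation "ucoeff \<equiv> unit_coeff K U \<iota> x"
abbreviation "hom_unit \<equiv> homog_unit K U \<iota> x"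
abbreviation "A \<equiv> universal_algebra K U \<iota> x"

lemma iota_group_hom: "group_hom (units_of K) U \<iota>"
  using iota by (intro group_hom.intro group_hom_axioms.intro K.units_group U.is_group) (simp add: mon_def)

lemma iota_closed [simp]: "a \<in> Units K \<Longrightarrow> \<iota> a \<in> carrier U"
  using group_hom.hom_closed[OF iota_group_hom] by (simp add: units_of_carrier)

lemma iota_mult: "a \<in> Units K \<Longrightarrow> b \<in> Units K \<Longrightarrow> \<iota> (a \<otimes> b) = \<iota> a \<otimes>\<^bsub>U\<^esub> \<iota> b"
  using group_hom.hom_mult[OF iota_group_hom] by (simp add: units_of_carrier units_of_mult)

lemma iota_one: "\<iota> \<one> = \<one>\<^bsub>U\<^esub>"
  using group_hom.hom_one[OF iota_group_hom] by (simp add: units_of_one)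

lemma iota_inj: "a \<in> Units K \<Longrightarrow> b \<in> Units K \<Longrightarrow> \<iota> a = \<iota> b \<Longrightarrow> a = b"
  using iota by (auto simp: mon_def units_of_carrier inj_on_def)

lemma H_subgroup: "subgroup H U"
  using group_hom.img_is_subgroup[OF iota_group_hom] by (simp add: base_units_def units_of_carrier)

lemma H_normal: "normal H U"
  by (simp add: H_subgroup U.normal_iff_subgroup)

lemma D_comm_group: "comm_group D"
  unfolding grading_group_def by (rule U.abelian_FactGroup[OF H_subgroup])

sublocale D: comm_group D by (rule D_comm_group)

lemma cls_closed [simp]: "u \<in> carrier U \<Longrightarrow> cls u \<in> carrier D"
  by (simp add: grading_group_def carrier_FactGroup)

lemma D_one: "\<one>\<^bsub>D\<^esub> = H"
  by (simp add: grading_group_def)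

lemma cls_mult: "u \<in> carrier U \<Longrightarrow> v \<in> carrier U \<Longrightarrow> cls (u \<otimes>\<^bsub>U\<^esub> v) = cls u \<otimes>\<^bsub>D\<^esub> cls v"
  by (simp add: grading_group_def normal.rcos_sum[OF H_normal])

lemma cls_iota: assumes "a \<in> Units K" shows "cls (\<iota> a) = \<one>\<^bsub>D\<^esub>"
  unfolding D_one using assms by (intro U.coset_join2 H_subgroup) (auto simp: base_units_def)

lemma cls_one: "cls \<one>\<^bsub>U\<^esub> = \<one>\<^bsub>D\<^esub>"
  using cls_iota[of \<one>] by (simp add: iota_one)

lemma cls_iota_mult: "a \<in> Units K \<Longrightarrow> u \<in> carrier U \<Longrightarrow> cls (\<iota> a \<otimes>\<^bsub>U\<^esub> u) = cls u"
  by (simp add: cls_mult cls_iota)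

lemma
  assumes "d \<in> carrier D"
  shows x_closed [simp]: "x d \<in> carrier U"
  and cls_x [simp]: "cls (x d) = d"
proof -
  obtain u where u: "u \<in> carrier U" "d = cls u"
    using assms by (auto simp: grading_group_def carrier_FactGroup)
  have "x d \<in> d" using rep assms unfolding is_rep_system_def by blast
  then have xd: "x d \<in> cls u" unfolding u(2) .
  show "cls (x d) = d"
    by (rule trans[OF U.repr_independence[OF xd u(1) H_subgroup, symmetric] u(2)[symmetric]])
  show "x d \<in> carrier U"
    by (rule subsetD[OF U.r_coset_subset_G[OF subgroup.subset[OF H_subgroup] u(1)] xd])
qed

lemma coset_eqE:
  assumes "u \<in> carrier U" "v \<in> carrier U" "cls u = cls v"
  obtains a where "a \<in> Units K" "u = \<iota> a \<otimes>\<^bsub>U\<^esub> v"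
proof -
  have "u \<in> cls v" using U.rcos_self[OF assms(1) H_subgroup] assms(3) by simp
  then show ?thesis using that by (auto simp: r_coset_def base_units_def)
qed

lemma ucoeff_eqI:
  assumes "a \<in> Units K" "u \<in> carrier U" "u = \<iota> a \<otimes>\<^bsub>U\<^esub> x (cls u)"
  shows "ucoeff u = a"
  unfolding unit_coeff_def
proof (rule the_equality)
  fix b assume b: "b \<in> Units K \<and> u = \<iota> b \<otimes>\<^bsub>U\<^esub> x (cls u)"
  have "\<iota> b \<otimes>\<^bsub>U\<^esub> x (cls u) = \<iota> a \<otimes>\<^bsub>U\<^esub> x (cls u)" by (rule trans[OF conjunct2[OF b, symmetric] assms(3)])
  moreover have bU: "b \<in> Units K" using b by (rule conjunct1)
  ultimately have "\<iota> b = \<iota> a"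
    using U.right_cancel[of "x (cls u)" "\<iota> b" "\<iota> a"] assms(1,2) by simp
  then show "b = a" using iota_inj assms(1) bU by blast
qed (rule conjI[OF assms(1,3)])

lemma
  assumes "u \<in> carrier U"
  shows ucoeff_Units [simp]: "ucoeff u \<in> Units K" and ucoeff_eq: "\<iota> (ucoeff u) \<otimes>\<^bsub>U\<^esub> x (cls u) = u"
proof -
  obtain a where a: "a \<in> Units K" "u = \<iota> a \<otimes>\<^bsub>U\<^esub> x (cls u)"
    by (rule coset_eqE[OF assms x_closed[OF cls_closed[OF assms]]
          cls_x[OF cls_closed[OF assms], symmetric]])
  have eq: "ucoeff u = a" by (rule ucoeff_eqI[OF a(1) assms a(2)])
  show "ucoeff u \<in> Units K" unfolding eq by (rule a(1))
  show "\<iota> (ucoeff u) \<otimes>\<^bsub>U\<^esub> x (cls u) = u" unfolding eq by (rule a(2)[symmetric])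
qed

lemma ucoeff_carrier [simp]: "u \<in> carrier U \<Longrightarrow> ucoeff u \<in> carrier K"
  by (rule K.Units_closed[OF ucoeff_Units])

lemma ucoeff_iota_mult:
  assumes "a \<in> Units K" "u \<in> carrier U" shows "ucoeff (\<iota> a \<otimes>\<^bsub>U\<^esub> u) = a \<otimes> ucoeff u"
proof (rule ucoeff_eqI)
  have "\<iota> a \<otimes>\<^bsub>U\<^esub> u = \<iota> a \<otimes>\<^bsub>U\<^esub> (\<iota> (ucoeff u) \<otimes>\<^bsub>U\<^esub> x (cls u))" using ucoeff_eq[OF assms(2)] by simp
  also have "\<dots> = \<iota> (a \<otimes> ucoeff u) \<otimes>\<^bsub>U\<^esub> x (cls u)"
    using assms by (simp add: iota_mult U.m_assoc)
  finally show "\<iota> a \<otimes>\<^bsub>U\<^esub> u = \<iota> (a \<otimes> ucoeff u) \<otimes>\<^bsub>U\<^esub> x (cls (\<iota> a \<otimes>\<^bsub>U\<^esub> u))"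
    using assms by (simp add: cls_iota_mult)
qed (use assms in auto)

lemma ucoeff_x: "d \<in> carrier D \<Longrightarrow> ucoeff (x d) = \<one>"
  by (rule ucoeff_eqI) (auto simp: cls_x iota_one)

text \<open>The symmetric 2-cocycle of the extension with respect to the chosen
  representatives.\<close>

definition s :: "'u set \<Rightarrow> 'u set \<Rightarrow> 'k" where
  "s d e = ucoeff (x d \<otimes>\<^bsub>U\<^esub> x e)"

lemma s_carrier [simp]: "d \<in> carrier D \<Longrightarrow> e \<in> carrier D \<Longrightarrow> s d e \<in> carrier K"
  by (simp add: s_def)

lemma s_comm: "d \<in> carrier D \<Longrightarrow> e \<in> carrier D \<Longrightarrow> s d e = s e d"
  by (simp add: s_def U.m_comm)

lemma ucoeff_mult_x:
  assumes "u \<in> carrier U" "e \<in> carrier D"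
  shows "ucoeff (u \<otimes>\<^bsub>U\<^esub> x e) = ucoeff u \<otimes> s (cls u) e"
proof -
  have "u \<otimes>\<^bsub>U\<^esub> x e = \<iota> (ucoeff u) \<otimes>\<^bsub>U\<^esub> (x (cls u) \<otimes>\<^bsub>U\<^esub> x e)"
    using ucoeff_eq[OF assms(1)] assms by (simp add: U.m_assoc[symmetric])
  then show ?thesis using ucoeff_iota_mult[of "ucoeff u" "x (cls u) \<otimes>\<^bsub>U\<^esub> x e"] assms
    by (simp add: s_def)
qed

text \<open>Both sides are the coefficient of one product of three representatives, read in two
  orders. The identity has this shape because associativity is derived from left
  commutativity.\<close>

lemma s_cocycle:
  assumes "d \<in> carrier D" "e \<in> carrier D" "z \<in> carrier D"
  shows "s d e \<otimes> s z (d \<otimes>\<^bsub>D\<^esub> e) = s z e \<otimes> s d (z \<otimes>\<^bsub>D\<^esub> e)"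
proof -
  have *: "s d e \<otimes> s z (d \<otimes>\<^bsub>D\<^esub> e) = ucoeff (x d \<otimes>\<^bsub>U\<^esub> x e \<otimes>\<^bsub>U\<^esub> x z)"
    if "d \<in> carrier D" "e \<in> carrier D" "z \<in> carrier D" for d e z
    using ucoeff_mult_x[of "x d \<otimes>\<^bsub>U\<^esub> x e" z] that
    by (simp add: cls_mult cls_x s_comm[of z] flip: s_def)
  have "x d \<otimes>\<^bsub>U\<^esub> x e \<otimes>\<^bsub>U\<^esub> x z = x z \<otimes>\<^bsub>U\<^esub> x e \<otimes>\<^bsub>U\<^esub> x d"
    using assms by (simp add: U.m_ac)
  then show ?thesis using *[of d e z] *[of z e d] assms by simp
qed

section \<open>Multiplication as a twisted convolution over the grading group\<close>

lemma A_carrier_iff: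
  "f \<in> carrier A \<longleftrightarrow> (\<forall>d. f d \<in> carrier K) \<and> (\<forall>d. d \<notin> carrier D \<longrightarrow> f d = \<zero>) \<and> finite {d. f d \<noteq> \<zero>}"
  by (simp add: universal_algebra_def)

lemma A_carrierD:
  assumes "f \<in> carrier A"
  shows "f d \<in> carrier K" "f d \<noteq> \<zero> \<Longrightarrow> d \<in> carrier D" "finite {d. f d \<noteq> \<zero>}" "d \<notin> carrier D \<Longrightarrow> f d = \<zero>"
  using assms unfolding A_carrier_iff by auto

lemma A_add: "(f \<oplus>\<^bsub>A\<^esub> g) d = f d \<oplus> g d" and A_zero: "\<zero>\<^bsub>A\<^esub> d = \<zero>" and A_one: "\<one>\<^bsub>A\<^esub> = hom_unit \<one>\<^bsub>U\<^esub>"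
  by (simp_all add: universal_algebra_def)

lemma A_mult_pairs: "(f \<otimes>\<^bsub>A\<^esub> g) h = finsum K (\<lambda>(d, e). f d \<otimes> g e \<otimes> s d e)
    {(d, e). f d \<noteq> \<zero> \<and> g e \<noteq> \<zero> \<and> d \<otimes>\<^bsub>D\<^esub> e = h}"
  by (simp add: universal_algebra_def s_def)

lemma A_mult_outside:
  assumes "f \<in> carrier A" "g \<in> carrier A" "h \<notin> carrier D" shows "(f \<otimes>\<^bsub>A\<^esub> g) h = \<zero>"
proof -
  have E: "{(d, e). f d \<noteq> \<zero> \<and> g e \<noteq> \<zero> \<and> d \<otimes>\<^bsub>D\<^esub> e = h} = {}"
    using A_carrierD(2)[OF assms(1)] A_carrierD(2)[OF assms(2)] assms(3) by auto
  show ?thesis unfolding A_mult_pairs E by simp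
qed

text \<open>The second index is determined by the first and by h. Any finite set containing the
  support of f may serve as the range, so that sums for different factors can share it.\<close>

lemma A_mult:
  assumes f: "f \<in> carrier A" and g: "g \<in> carrier A" and h: "h \<in> carrier D"
    and S: "finite S" "S \<subseteq> carrier D" "\<And>d. f d \<noteq> \<zero> \<Longrightarrow> d \<in> S"
  shows "(f \<otimes>\<^bsub>A\<^esub> g) h = (\<Oplus>d\<in>S. f d \<otimes> g (inv\<^bsub>D\<^esub> d \<otimes>\<^bsub>D\<^esub> h) \<otimes> s d (inv\<^bsub>D\<^esub> d \<otimes>\<^bsub>D\<^esub> h))"
proof -
  let ?e = "\<lambda>d. inv\<^bsub>D\<^esub> d \<otimes>\<^bsub>D\<^esub> h"
  let ?F = "\<lambda>d e. f d \<otimes> g e \<otimes> s d e"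
  let ?T = "{d \<in> S. f d \<noteq> \<zero> \<and> g (?e d) \<noteq> \<zero>}"
  have SD: "d \<in> carrier D" if "d \<in> S" for d using S(2) that by blast
  have F: "?F d (?e d) \<in> carrier K" if "d \<in> S" for d
    using SD[OF that] h A_carrierD(1)[OF f] A_carrierD(1)[OF g] by simp
  have pairs: "{(d, e). f d \<noteq> \<zero> \<and> g e \<noteq> \<zero> \<and> d \<otimes>\<^bsub>D\<^esub> e = h} = (\<lambda>d. (d, ?e d)) ` ?T"
  proof (intro equalityI subsetI)
    fix z assume "z \<in> {(d, e). f d \<noteq> \<zero> \<and> g e \<noteq> \<zero> \<and> d \<otimes>\<^bsub>D\<^esub> e = h}"
    then obtain d e where z: "z = (d, e)" "f d \<noteq> \<zero>" "g e \<noteq> \<zero>" "d \<otimes>\<^bsub>D\<^esub> e = h" by auto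
    have "d \<in> carrier D" "e \<in> carrier D" using A_carrierD(2) f g z by auto
    then have "e = ?e d" using z(4) by (simp add: D.m_assoc[symmetric] flip: z(4))
    then show "z \<in> (\<lambda>d. (d, ?e d)) ` ?T" using z S(3) by auto
  next
    fix z assume "z \<in> (\<lambda>d. (d, ?e d)) ` ?T"
    then show "z \<in> {(d, e). f d \<noteq> \<zero> \<and> g e \<noteq> \<zero> \<and> d \<otimes>\<^bsub>D\<^esub> e = h}"
      using SD h by (auto simp: D.m_assoc[symmetric])
  qed
  have "(f \<otimes>\<^bsub>A\<^esub> g) h = finsum K (\<lambda>(d, e). ?F d e) {(d, e). f d \<noteq> \<zero> \<and> g e \<noteq> \<zero> \<and> d \<otimes>\<^bsub>D\<^esub> e = h}"
    by (simp add: universal_algebra_def s_def)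
  also have "\<dots> = (\<Oplus>d\<in>?T. ?F d (?e d))"
    unfolding pairs using F by (subst K.add.finprod_reindex) (auto simp: inj_on_def)
  also have "\<dots> = (\<Oplus>d\<in>S. ?F d (?e d))"
    using F S A_carrierD(1)[OF f] A_carrierD(1)[OF g] SD h
    by (intro K.add.finprod_mono_neutral_cong_left) auto
  finally show ?thesis .
qed

lemma A_mult_closed:
  assumes f: "f \<in> carrier A" and g: "g \<in> carrier A" shows "f \<otimes>\<^bsub>A\<^esub> g \<in> carrier A"
proof -
  let ?S = "{d. f d \<noteq> \<zero>}" and ?T = "{d. g d \<noteq> \<zero>}"
  have S: "finite ?S" "?S \<subseteq> carrier D" and T: "finite ?T" "?T \<subseteq> carrier D"
    using A_carrierD(2,3) f g by auto
  have zero: "(f \<otimes>\<^bsub>A\<^esub> g) h = \<zero>" if h: "h \<notin> (\<lambda>(d, e). d \<otimes>\<^bsub>D\<^esub> e) ` (?S \<times> ?T)" for h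
  proof -
    have E: "{(d, e). f d \<noteq> \<zero> \<and> g e \<noteq> \<zero> \<and> d \<otimes>\<^bsub>D\<^esub> e = h} = {}" using h by auto
    show ?thesis unfolding A_mult_pairs E by simp
  qed
  have "finite {h. (f \<otimes>\<^bsub>A\<^esub> g) h \<noteq> \<zero>}"
    by (rule finite_subset[of _ "(\<lambda>(d, e). d \<otimes>\<^bsub>D\<^esub> e) ` (?S \<times> ?T)"]) (use zero S T in auto)
  moreover have "(f \<otimes>\<^bsub>A\<^esub> g) h \<in> carrier K" for h
  proof (cases "h \<in> carrier D")
    case True
    show ?thesis unfolding A_mult[OF f g True S(1,2), simplified]
      using S True A_carrierD(1)[OF f] A_carrierD(1)[OF g] by (intro K.finsum_closed) auto
  qed (simp add: A_mult_outside[OF f g])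
  ultimately show ?thesis unfolding A_carrier_iff using A_mult_outside[OF f g] by blast
qed

lemma A_mult_comm:
  assumes f: "f \<in> carrier A" and g: "g \<in> carrier A" shows "f \<otimes>\<^bsub>A\<^esub> g = g \<otimes>\<^bsub>A\<^esub> f"
proof
  fix h
  let ?F = "\<lambda>f g. \<lambda>(d, e). f d \<otimes> g e \<otimes> s d e"
  let ?P = "\<lambda>f g. {(d, e). f d \<noteq> \<zero> \<and> g e \<noteq> \<zero> \<and> d \<otimes>\<^bsub>D\<^esub> e = h}"
  have P: "?P g f = prod.swap ` ?P f g"
    using A_carrierD(2)[OF f] A_carrierD(2)[OF g] by (auto simp: image_iff D.m_comm)
  have c: "?F g f z \<in> carrier K" if "z \<in> ?P g f" for z
    using that A_carrierD(1,2)[OF f] A_carrierD(1,2)[OF g] by auto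
  have "(g \<otimes>\<^bsub>A\<^esub> f) h = finsum K (?F g f) (prod.swap ` ?P f g)"
    unfolding P[symmetric] by (simp add: universal_algebra_def s_def)
  also have "\<dots> = finsum K (\<lambda>z. ?F g f (prod.swap z)) (?P f g)"
    using c unfolding P by (intro K.add.finprod_reindex) auto
  also have "\<dots> = finsum K (?F f g) (?P f g)"
    using A_carrierD(1,2)[OF f] A_carrierD(1,2)[OF g]
    by (intro K.finsum_cong') (auto simp: K.m_comm s_comm)
  finally show "(f \<otimes>\<^bsub>A\<^esub> g) h = (g \<otimes>\<^bsub>A\<^esub> f) h"
    by (simp add: universal_algebra_def s_def)
qed

text \<open>Both sides expand by the same formula with the roles of f and k exchanged, so a single
  expansion, an interchange of sums and \<open>s_cocycle\<close> suffice. With commutativity this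
  gives associativity.\<close>

lemma A_mult_left_comm:
  assumes f: "f \<in> carrier A" and g: "g \<in> carrier A" and k: "k \<in> carrier A"
  shows "k \<otimes>\<^bsub>A\<^esub> (f \<otimes>\<^bsub>A\<^esub> g) = f \<otimes>\<^bsub>A\<^esub> (k \<otimes>\<^bsub>A\<^esub> g)"
proof
  fix h
  show "(k \<otimes>\<^bsub>A\<^esub> (f \<otimes>\<^bsub>A\<^esub> g)) h = (f \<otimes>\<^bsub>A\<^esub> (k \<otimes>\<^bsub>A\<^esub> g)) h"
  proof (cases "h \<in> carrier D")
    case False
    then show ?thesis using A_mult_outside A_mult_closed f g k by simp
  next
    case h: True
    let ?M = "\<lambda>k f z d. k z \<otimes> (f d \<otimes> g (inv\<^bsub>D\<^esub> d \<otimes>\<^bsub>D\<^esub> (inv\<^bsub>D\<^esub> z \<otimes>\<^bsub>D\<^esub> h)) \<otimes> s d (inv\<^bsub>D\<^esub> d \<otimes>\<^bsub>D\<^esub> (inv\<^bsub>D\<^esub> z \<otimes>\<^bsub>D\<^esub> h)))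
          \<otimes> s z (inv\<^bsub>D\<^esub> z \<otimes>\<^bsub>D\<^esub> h)"
    have gen: "(k \<otimes>\<^bsub>A\<^esub> (f \<otimes>\<^bsub>A\<^esub> g)) h = (\<Oplus>z\<in>{d. k d \<noteq> \<zero>}. \<Oplus>d\<in>{d. f d \<noteq> \<zero>}.
        ?M k f z d)"
      if f: "f \<in> carrier A" and k: "k \<in> carrier A" for f k
    proof -
      let ?S = "{d. f d \<noteq> \<zero>}" and ?T = "{d. k d \<noteq> \<zero>}"
      have S: "finite ?S" "?S \<subseteq> carrier D" and T: "finite ?T" "?T \<subseteq> carrier D"
        using A_carrierD(2,3) f k by auto
      note cl = A_carrierD(1)[OF f] A_carrierD(1)[OF g] A_carrierD(1)[OF k]
      have "(k \<otimes>\<^bsub>A\<^esub> (f \<otimes>\<^bsub>A\<^esub> g)) h =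
          (\<Oplus>z\<in>?T. k z \<otimes> (f \<otimes>\<^bsub>A\<^esub> g) (inv\<^bsub>D\<^esub> z \<otimes>\<^bsub>D\<^esub> h) \<otimes> s z (inv\<^bsub>D\<^esub> z \<otimes>\<^bsub>D\<^esub> h))"
        using T by (intro A_mult k A_mult_closed f g h) auto
      also have "\<dots> = (\<Oplus>z\<in>?T. \<Oplus>d\<in>?S.
        ?M k f z d)"
      proof (intro K.finsum_cong' refl)
        fix z assume z: "z \<in> ?T"
        then have zh: "z \<in> carrier D" "inv\<^bsub>D\<^esub> z \<otimes>\<^bsub>D\<^esub> h \<in> carrier D" using T h by auto
        let ?f = "\<lambda>d. f d \<otimes> g (inv\<^bsub>D\<^esub> d \<otimes>\<^bsub>D\<^esub> (inv\<^bsub>D\<^esub> z \<otimes>\<^bsub>D\<^esub> h)) \<otimes> s d (inv\<^bsub>D\<^esub> d \<otimes>\<^bsub>D\<^esub> (inv\<^bsub>D\<^esub> z \<otimes>\<^bsub>D\<^esub> h))"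
        have fc: "?f d \<in> carrier K" if "d \<in> ?S" for d
        proof -
          have "d \<in> carrier D" using S that by blast
          then show ?thesis using zh cl by simp
        qed
        have "(f \<otimes>\<^bsub>A\<^esub> g) (inv\<^bsub>D\<^esub> z \<otimes>\<^bsub>D\<^esub> h) = (\<Oplus>d\<in>?S. ?f d)"
          using S by (intro A_mult f g zh) auto
        then show "k z \<otimes> (f \<otimes>\<^bsub>A\<^esub> g) (inv\<^bsub>D\<^esub> z \<otimes>\<^bsub>D\<^esub> h) \<otimes> s z (inv\<^bsub>D\<^esub> z \<otimes>\<^bsub>D\<^esub> h) =
            (\<Oplus>d\<in>?S. k z \<otimes> ?f d \<otimes> s z (inv\<^bsub>D\<^esub> z \<otimes>\<^bsub>D\<^esub> h))"
          using fc cl zh S(1) by (simp add: K.finsum_rdistr K.finsum_ldistr Pi_iff)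
      next
        show "(\<lambda>z. \<Oplus>d\<in>?S. ?M k f z d) \<in> ?T \<rightarrow> carrier K"
        proof (intro Pi_I K.finsum_closed)
          fix z d assume "z \<in> ?T" "d \<in> ?S"
          then have "z \<in> carrier D" "d \<in> carrier D" using S T by auto
          then show "?M k f z d \<in> carrier K" using cl h by simp
        qed
      qed
      finally show ?thesis .
    qed
    let ?S = "{d. f d \<noteq> \<zero>}" and ?T = "{d. k d \<noteq> \<zero>}"
    have S: "finite ?S" "?S \<subseteq> carrier D" and T: "finite ?T" "?T \<subseteq> carrier D"
      using A_carrierD(2,3) f k by auto
    note cl = A_carrierD(1)[OF f] A_carrierD(1)[OF g] A_carrierD(1)[OF k]
    have Mc: "?M k f z d \<in> carrier K" if "z \<in> ?T" "d \<in> ?S" for z d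
    proof -
      have "z \<in> carrier D" "d \<in> carrier D" using S T that by auto
      then show ?thesis using cl h by simp
    qed
    have sym: "?M k f z d = ?M f k d z" if "z \<in> ?T" "d \<in> ?S" for z d
    proof -
      have zd: "z \<in> carrier D" "d \<in> carrier D" using S T that by auto
      define e where "e = inv\<^bsub>D\<^esub> d \<otimes>\<^bsub>D\<^esub> (inv\<^bsub>D\<^esub> z \<otimes>\<^bsub>D\<^esub> h)"
      have e: "e \<in> carrier D" using zd h by (simp add: e_def)
      have e': "inv\<^bsub>D\<^esub> z \<otimes>\<^bsub>D\<^esub> (inv\<^bsub>D\<^esub> d \<otimes>\<^bsub>D\<^esub> h) = e" unfolding e_def using zd h by (simp add: D.m_lcomm)
      have zh: "inv\<^bsub>D\<^esub> z \<otimes>\<^bsub>D\<^esub> h = d \<otimes>\<^bsub>D\<^esub> e" unfolding e_def using zd h by (simp add: D.m_assoc[symmetric])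
      have dh: "inv\<^bsub>D\<^esub> d \<otimes>\<^bsub>D\<^esub> h = z \<otimes>\<^bsub>D\<^esub> e" unfolding e'[symmetric] using zd h by (simp add: D.m_assoc[symmetric])
      have 1: "?M k f z d = k z \<otimes> (f d \<otimes> g e \<otimes> s d e) \<otimes> s z (d \<otimes>\<^bsub>D\<^esub> e)"
        unfolding e_def[symmetric] unfolding zh ..
      have 2: "?M f k d z = f d \<otimes> (k z \<otimes> g e \<otimes> s z e) \<otimes> s d (z \<otimes>\<^bsub>D\<^esub> e)"
        unfolding e' unfolding dh ..
      have "k z \<otimes> (f d \<otimes> g e \<otimes> s d e) \<otimes> s z (d \<otimes>\<^bsub>D\<^esub> e) = f d \<otimes> k z \<otimes> g e \<otimes> (s d e \<otimes> s z (d \<otimes>\<^bsub>D\<^esub> e))"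
        using cl zd e by (simp add: K.m_ac)
      also have "\<dots> = f d \<otimes> (k z \<otimes> g e \<otimes> s z e) \<otimes> s d (z \<otimes>\<^bsub>D\<^esub> e)"
        unfolding s_cocycle[OF zd(2) e zd(1)] using cl zd e by (simp add: K.m_assoc)
      finally show ?thesis unfolding 1 2 .
    qed
    have "(k \<otimes>\<^bsub>A\<^esub> (f \<otimes>\<^bsub>A\<^esub> g)) h = (\<Oplus>z\<in>?T. \<Oplus>d\<in>?S. ?M k f z d)" by (rule gen[OF f k])
    also have "\<dots> = (\<Oplus>d\<in>?S. \<Oplus>z\<in>?T. ?M k f z d)"
      by (rule K.finsum_swap[OF T(1) S(1) Mc])
    also have "\<dots> = (\<Oplus>d\<in>?S. \<Oplus>z\<in>?T. ?M f k d z)"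
    proof (intro K.finsum_cong' refl)
      show "(\<lambda>d. \<Oplus>z\<in>?T. ?M f k d z) \<in> ?S \<rightarrow> carrier K"
      proof (intro Pi_I K.finsum_closed)
        fix d z assume "d \<in> ?S" "z \<in> ?T"
        then show "?M f k d z \<in> carrier K" using Mc[of z d] sym[of z d] by simp
      qed
      fix d assume d: "d \<in> ?S"
      show "(\<lambda>z. ?M f k d z) \<in> ?T \<rightarrow> carrier K"
      proof
        fix z assume "z \<in> ?T"
        then show "?M f k d z \<in> carrier K" using Mc[of z d] sym[of z d] d by simp
      qed
      fix z assume "z \<in> ?T"
      then show "?M k f z d = ?M f k d z" using sym d by blast
    qed
    also have "\<dots> = (f \<otimes>\<^bsub>A\<^esub> (k \<otimes>\<^bsub>A\<^esub> g)) h" by (rule gen[OF k f, symmetric])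
    finally show ?thesis .
  qed
qed

lemma A_mult_assoc:
  assumes "f \<in> carrier A" "g \<in> carrier A" "k \<in> carrier A"
  shows "(f \<otimes>\<^bsub>A\<^esub> g) \<otimes>\<^bsub>A\<^esub> k = f \<otimes>\<^bsub>A\<^esub> (g \<otimes>\<^bsub>A\<^esub> k)"
  using A_mult_left_comm[OF assms(1,2,3)] A_mult_comm[OF A_mult_closed[OF assms(1,2)] assms(3)]
    A_mult_comm[OF assms(3,2)] by simp


section \<open>Homogeneous units and scalars\<close>

lemma hom_unit_apply: "hom_unit u d = (if d = cls u then ucoeff u else \<zero>)"
  by (simp add: homog_unit_def)

lemma ucoeff_nonzero: "u \<in> carrier U \<Longrightarrow> ucoeff u \<noteq> \<zero>"
  using ucoeff_Units[of u] by (auto simp: K.field_Units)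

lemma hom_unit_carrier [simp]: "u \<in> carrier U \<Longrightarrow> hom_unit u \<in> carrier A"
  unfolding A_carrier_iff hom_unit_apply by (auto simp: ucoeff_nonzero cong: conj_cong)

lemma hom_unit_mult_apply:
  assumes "u \<in> carrier U" "f \<in> carrier A" "h \<in> carrier D"
  shows "(hom_unit u \<otimes>\<^bsub>A\<^esub> f) h =
    f (inv\<^bsub>D\<^esub> (cls u) \<otimes>\<^bsub>D\<^esub> h) \<otimes> ucoeff (u \<otimes>\<^bsub>U\<^esub> x (inv\<^bsub>D\<^esub> (cls u) \<otimes>\<^bsub>D\<^esub> h))"
proof -
  let ?e = "inv\<^bsub>D\<^esub> (cls u) \<otimes>\<^bsub>D\<^esub> h"
  have e: "?e \<in> carrier D" using assms by simp
  have fe: "f ?e \<in> carrier K" by (rule A_carrierD(1)[OF assms(2)])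
  have "(hom_unit u \<otimes>\<^bsub>A\<^esub> f) h = (\<Oplus>d\<in>{cls u}. hom_unit u d \<otimes> f (inv\<^bsub>D\<^esub> d \<otimes>\<^bsub>D\<^esub> h) \<otimes> s d (inv\<^bsub>D\<^esub> d \<otimes>\<^bsub>D\<^esub> h))"
    using assms by (intro A_mult) (auto simp: hom_unit_apply split: if_splits)
  also have "\<dots> = hom_unit u (cls u) \<otimes> f ?e \<otimes> s (cls u) ?e"
    using assms e fe by (subst K.finsum_insert) (auto simp: hom_unit_apply)
  also have "\<dots> = f ?e \<otimes> (ucoeff u \<otimes> s (cls u) ?e)"
    using assms e fe by (simp add: hom_unit_apply K.m_ac)
  also have "ucoeff u \<otimes> s (cls u) ?e = ucoeff (u \<otimes>\<^bsub>U\<^esub> x ?e)"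
    by (rule ucoeff_mult_x[OF assms(1) e, symmetric])
  finally show ?thesis .
qed

lemma A_add_closed:
  assumes "f \<in> carrier A" "g \<in> carrier A" shows "f \<oplus>\<^bsub>A\<^esub> g \<in> carrier A"
proof -
  have "{d. (f \<oplus>\<^bsub>A\<^esub> g) d \<noteq> \<zero>} \<subseteq> {d. f d \<noteq> \<zero>} \<union> {d. g d \<noteq> \<zero>}"
    by (auto simp: A_add)
  then have fin: "finite {d. (f \<oplus>\<^bsub>A\<^esub> g) d \<noteq> \<zero>}"
    by (rule finite_subset) (use A_carrierD(3)[OF assms(1)] A_carrierD(3)[OF assms(2)] in simp)
  show ?thesis
    unfolding A_carrier_iff
  proof (intro conjI allI impI fin)
    fix d
    show "(f \<oplus>\<^bsub>A\<^esub> g) d \<in> carrier K"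
      unfolding A_add by (rule K.a_closed[OF A_carrierD(1)[OF assms(1)] A_carrierD(1)[OF assms(2)]])
    assume "d \<notin> carrier D"
    then show "(f \<oplus>\<^bsub>A\<^esub> g) d = \<zero>"
      unfolding A_add using A_carrierD(4)[OF assms(1)] A_carrierD(4)[OF assms(2)] by simp
  qed
qed

lemma A_cring: "cring A"
proof (rule cringI)
  show "abelian_group A"
  proof (rule abelian_groupI)
    show "\<zero>\<^bsub>A\<^esub> \<in> carrier A" by (simp add: A_carrier_iff A_zero)
  next
    fix f g k assume "f \<in> carrier A" "g \<in> carrier A" "k \<in> carrier A"
    then show "f \<oplus>\<^bsub>A\<^esub> g \<oplus>\<^bsub>A\<^esub> k = f \<oplus>\<^bsub>A\<^esub> (g \<oplus>\<^bsub>A\<^esub> k)"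
      by (intro ext) (simp add: A_add A_carrierD(1) K.a_assoc)
  next
    fix f g assume "f \<in> carrier A" "g \<in> carrier A"
    then show "f \<oplus>\<^bsub>A\<^esub> g = g \<oplus>\<^bsub>A\<^esub> f"
      by (intro ext) (simp add: A_add A_carrierD(1) K.a_comm)
  next
    fix f assume f: "f \<in> carrier A"
    then show "\<zero>\<^bsub>A\<^esub> \<oplus>\<^bsub>A\<^esub> f = f" by (intro ext) (simp add: A_add A_zero A_carrierD(1))
    have nz: "\<ominus> f d \<noteq> \<zero> \<longleftrightarrow> f d \<noteq> \<zero>" for d
      using A_carrierD(1)[OF f, of d] K.minus_minus[of "f d"] by (metis K.minus_zero)
    have "(\<lambda>d. \<ominus> f d) \<in> carrier A"
      unfolding A_carrier_iff nz using A_carrierD[OF f] by auto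
    moreover have "(\<lambda>d. \<ominus> f d) \<oplus>\<^bsub>A\<^esub> f = \<zero>\<^bsub>A\<^esub>"
      by (intro ext) (simp add: A_add A_zero A_carrierD(1)[OF f] K.l_neg)
    ultimately show "\<exists>g\<in>carrier A. g \<oplus>\<^bsub>A\<^esub> f = \<zero>\<^bsub>A\<^esub>" by blast
  qed (rule A_add_closed)
  show "comm_monoid A"
  proof (rule comm_monoidI)
    show "\<one>\<^bsub>A\<^esub> \<in> carrier A" by (simp add: A_one)
    fix f assume f: "f \<in> carrier A"
    show "\<one>\<^bsub>A\<^esub> \<otimes>\<^bsub>A\<^esub> f = f"
    proof
      fix h
      show "(\<one>\<^bsub>A\<^esub> \<otimes>\<^bsub>A\<^esub> f) h = f h"
      proof (cases "h \<in> carrier D")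
        case True
        then show ?thesis
          using hom_unit_mult_apply[OF _ f True, of "\<one>\<^bsub>U\<^esub>"] A_carrierD(1)[OF f]
          by (simp add: A_one cls_one ucoeff_x)
      qed (use A_mult_outside[OF hom_unit_carrier[OF U.one_closed] f] A_carrierD(4)[OF f] in \<open>simp add: A_one\<close>)
    qed
  qed (auto simp: A_mult_closed A_mult_assoc intro: A_mult_comm)
next
  fix f g k assume f: "f \<in> carrier A" and g: "g \<in> carrier A" and k: "k \<in> carrier A"
  note cl = A_carrierD(1)[OF f] A_carrierD(1)[OF g] A_carrierD(1)[OF k]
  show "(f \<oplus>\<^bsub>A\<^esub> g) \<otimes>\<^bsub>A\<^esub> k = f \<otimes>\<^bsub>A\<^esub> k \<oplus>\<^bsub>A\<^esub> g \<otimes>\<^bsub>A\<^esub> k"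
  proof
    fix h
    show "((f \<oplus>\<^bsub>A\<^esub> g) \<otimes>\<^bsub>A\<^esub> k) h = (f \<otimes>\<^bsub>A\<^esub> k \<oplus>\<^bsub>A\<^esub> g \<otimes>\<^bsub>A\<^esub> k) h"
    proof (cases "h \<in> carrier D")
      case h: True
      \<comment> \<open>Cancellation can shrink the support of the sum, so the union of the two
        supports is the common range.\<close>
      define S where "S = {d. f d \<noteq> \<zero>} \<union> {d. g d \<noteq> \<zero>}"
      have S: "finite S" "S \<subseteq> carrier D"
        using A_carrierD(2,3)[OF f] A_carrierD(2,3)[OF g] by (auto simp: S_def)
      let ?t = "\<lambda>f d. f d \<otimes> k (inv\<^bsub>D\<^esub> d \<otimes>\<^bsub>D\<^esub> h) \<otimes> s d (inv\<^bsub>D\<^esub> d \<otimes>\<^bsub>D\<^esub> h)"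
      have sc: "s d (inv\<^bsub>D\<^esub> d \<otimes>\<^bsub>D\<^esub> h) \<in> carrier K" if "d \<in> S" for d
        using S(2) that h by (intro s_carrier) auto
      have "((f \<oplus>\<^bsub>A\<^esub> g) \<otimes>\<^bsub>A\<^esub> k) h = (\<Oplus>d\<in>S. ?t (f \<oplus>\<^bsub>A\<^esub> g) d)"
        by (rule A_mult[OF A_add_closed[OF f g] k h S]) (use cl in \<open>auto simp: A_add S_def\<close>)
      also have "\<dots> = (\<Oplus>d\<in>S. ?t f d \<oplus> ?t g d)"
        using cl sc by (intro K.finsum_cong') (auto simp: A_add K.l_distr)
      also have "\<dots> = (\<Oplus>d\<in>S. ?t f d) \<oplus> (\<Oplus>d\<in>S. ?t g d)"
        using cl sc by (intro K.finsum_addf) auto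
      also have "(\<Oplus>d\<in>S. ?t f d) = (f \<otimes>\<^bsub>A\<^esub> k) h"
        by (rule A_mult[OF f k h S, symmetric]) (auto simp: S_def)
      also have "(\<Oplus>d\<in>S. ?t g d) = (g \<otimes>\<^bsub>A\<^esub> k) h"
        by (rule A_mult[OF g k h S, symmetric]) (auto simp: S_def)
      finally have "((f \<oplus>\<^bsub>A\<^esub> g) \<otimes>\<^bsub>A\<^esub> k) h = (f \<otimes>\<^bsub>A\<^esub> k) h \<oplus> (g \<otimes>\<^bsub>A\<^esub> k) h" .
      then show ?thesis unfolding A_add[of "f \<otimes>\<^bsub>A\<^esub> k" "g \<otimes>\<^bsub>A\<^esub> k" h] .
    next
      case False
      show ?thesis
        unfolding A_add[of "f \<otimes>\<^bsub>A\<^esub> k" "g \<otimes>\<^bsub>A\<^esub> k" h]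
          A_mult_outside[OF A_add_closed[OF f g] k False] A_mult_outside[OF f k False]
          A_mult_outside[OF g k False] by simp
    qed
  qed
qed

sublocale A: cring A by (rule A_cring)

lemma A_ext: "f \<in> carrier A \<Longrightarrow> g \<in> carrier A \<Longrightarrow> (\<And>d. d \<in> carrier D \<Longrightarrow> f d = g d) \<Longrightarrow> f = g"
  using A_carrierD(4) by (intro ext) metis

lemma hom_unit_mult:
  assumes "u \<in> carrier U" "v \<in> carrier U"
  shows "hom_unit (u \<otimes>\<^bsub>U\<^esub> v) = hom_unit u \<otimes>\<^bsub>A\<^esub> hom_unit v"
proof (rule A_ext)
  fix h assume h: "h \<in> carrier D"
  have eq: "inv\<^bsub>D\<^esub> (cls u) \<otimes>\<^bsub>D\<^esub> h = cls v \<longleftrightarrow> h = cls u \<otimes>\<^bsub>D\<^esub> cls v"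
    using assms h D.inv_solve_left[of "cls v" "cls u" h] by (auto simp: eq_commute)
  have "u \<otimes>\<^bsub>U\<^esub> v = \<iota> (ucoeff v) \<otimes>\<^bsub>U\<^esub> (u \<otimes>\<^bsub>U\<^esub> x (cls v))"
    using arg_cong[OF ucoeff_eq[OF assms(2)], of "\<lambda>w. u \<otimes>\<^bsub>U\<^esub> w"] assms by (simp add: U.m_lcomm)
  then have c: "ucoeff (u \<otimes>\<^bsub>U\<^esub> v) = ucoeff v \<otimes> ucoeff (u \<otimes>\<^bsub>U\<^esub> x (cls v))"
    using ucoeff_iota_mult[of "ucoeff v" "u \<otimes>\<^bsub>U\<^esub> x (cls v)"] assms by simp
  show "hom_unit (u \<otimes>\<^bsub>U\<^esub> v) h = (hom_unit u \<otimes>\<^bsub>A\<^esub> hom_unit v) h"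
  proof (cases "h = cls u \<otimes>\<^bsub>D\<^esub> cls v")
    case True
    then have e: "inv\<^bsub>D\<^esub> (cls u) \<otimes>\<^bsub>D\<^esub> h = cls v" using eq by simp
    have "(hom_unit u \<otimes>\<^bsub>A\<^esub> hom_unit v) h = ucoeff v \<otimes> ucoeff (u \<otimes>\<^bsub>U\<^esub> x (cls v))"
      using hom_unit_mult_apply[OF assms(1) hom_unit_carrier[OF assms(2)] h] by (simp add: e hom_unit_apply)
    then show ?thesis using True assms by (simp add: hom_unit_apply[of "u \<otimes>\<^bsub>U\<^esub> v"] cls_mult c)
  next
    case False
    then have e: "inv\<^bsub>D\<^esub> (cls u) \<otimes>\<^bsub>D\<^esub> h \<noteq> cls v" using eq by simp
    have "(hom_unit u \<otimes>\<^bsub>A\<^esub> hom_unit v) h = \<zero>"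
      using hom_unit_mult_apply[OF assms(1) hom_unit_carrier[OF assms(2)] h] e assms h
      by (simp add: hom_unit_apply)
    then show ?thesis using False assms by (simp add: hom_unit_apply[of "u \<otimes>\<^bsub>U\<^esub> v"] cls_mult)
  qed
qed (use assms in auto)

lemma hom_unit_one: "hom_unit \<one>\<^bsub>U\<^esub> = \<one>\<^bsub>A\<^esub>"
  by (simp add: A_one)

lemma hom_unit_pow: "u \<in> carrier U \<Longrightarrow> hom_unit (u [^]\<^bsub>U\<^esub> (n::nat)) = hom_unit u [^]\<^bsub>A\<^esub> n"
  by (induction n) (auto simp: hom_unit_one hom_unit_mult)

lemma hom_unit_inv_mult: "u \<in> carrier U \<Longrightarrow> hom_unit u \<otimes>\<^bsub>A\<^esub> hom_unit (inv\<^bsub>U\<^esub> u) = \<one>\<^bsub>A\<^esub>"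
  by (simp add: hom_unit_mult[symmetric] hom_unit_one)

lemma hom_unit_inv: "u \<in> carrier U \<Longrightarrow> inv\<^bsub>A\<^esub> (hom_unit u) = hom_unit (inv\<^bsub>U\<^esub> u)"
  by (rule A.comm_inv_char) (simp_all add: hom_unit_inv_mult)

lemma hom_unit_Units: "u \<in> carrier U \<Longrightarrow> hom_unit u \<in> Units A"
  unfolding Units_def using hom_unit_inv_mult[of u] A.m_comm[of "hom_unit u" "hom_unit (inv\<^bsub>U\<^esub> u)"]
  by (auto intro!: bexI[of _ "hom_unit (inv\<^bsub>U\<^esub> u)"])

lemma hom_unit_inj:
  assumes "u \<in> carrier U" "v \<in> carrier U" "hom_unit u = hom_unit v" shows "u = v"
proof -
  have e: "hom_unit v (cls u) = ucoeff u"
    unfolding assms(3)[symmetric] by (simp add: hom_unit_apply)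
  have c: "cls u = cls v"
  proof (rule ccontr)
    assume "cls u \<noteq> cls v"
    then have "hom_unit v (cls u) = \<zero>" by (simp add: hom_unit_apply)
    then show False using e ucoeff_nonzero[OF assms(1)] by simp
  qed
  have uc: "ucoeff u = ucoeff v" using e unfolding hom_unit_apply c by simp
  have "\<iota> (ucoeff u) \<otimes>\<^bsub>U\<^esub> x (cls u) = \<iota> (ucoeff v) \<otimes>\<^bsub>U\<^esub> x (cls v)" by (simp only: c uc)
  then show ?thesis unfolding ucoeff_eq[OF assms(1)] ucoeff_eq[OF assms(2)] .
qed

definition scalar :: "'k \<Rightarrow> 'u set \<Rightarrow> 'k" where
  "scalar a = (\<lambda>d. if d = \<one>\<^bsub>D\<^esub> then a \<otimes> ucoeff \<one>\<^bsub>U\<^esub> else \<zero>)"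

lemma scalar_unit: "a \<in> Units K \<Longrightarrow> scalar a = hom_unit (\<iota> a)"
  using ucoeff_iota_mult[of a "\<one>\<^bsub>U\<^esub>"] by (intro ext) (simp add: scalar_def hom_unit_apply cls_iota)

lemma scalar_zero: "scalar \<zero> = \<zero>\<^bsub>A\<^esub>"
  by (intro ext) (simp add: scalar_def A_zero)

lemma scalar_closed [simp]: "a \<in> carrier K \<Longrightarrow> scalar a \<in> carrier A"
  using scalar_zero scalar_unit[of a] by (cases "a = \<zero>") (auto simp: K.field_Units)

lemma scalar_mult_apply:
  assumes "a \<in> carrier K" "f \<in> carrier A" shows "(scalar a \<otimes>\<^bsub>A\<^esub> f) d = a \<otimes> f d"
proof (cases "d \<in> carrier D")
  case True
  show ?thesis
  proof (cases "a = \<zero>")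
    case True
    then show ?thesis using assms A_carrierD(1)[OF assms(2)] by (simp add: scalar_zero A_zero)
  next
    case False
    then have a: "a \<in> Units K" using assms by (simp add: K.field_Units)
    then show ?thesis
      using hom_unit_mult_apply[OF iota_closed[OF a] assms(2) True] True
        ucoeff_iota_mult[OF a, of "x d"] A_carrierD(1)[OF assms(2), of d] assms(1)
      by (simp add: scalar_unit cls_iota ucoeff_x K.m_comm)
  qed
next
  case False
  then show ?thesis
    using A_mult_outside[OF scalar_closed[OF assms(1)] assms(2) False] A_carrierD(4)[OF assms(2) False] assms(1)
    by simp
qed

lemma scalar_hom: "ring_hom_ring K A scalar"
proof (rule ring_hom_ringI2)
  show "scalar \<in> Ring.ring_hom K A"
  proof (rule ring_hom_memI)
    fix a b assume ab: "a \<in> carrier K" "b \<in> carrier K"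
    show "scalar (a \<otimes> b) = scalar a \<otimes>\<^bsub>A\<^esub> scalar b"
      using ab by (intro ext) (simp add: scalar_mult_apply, simp add: scalar_def K.m_assoc)
    show "scalar (a \<oplus> b) = scalar a \<oplus>\<^bsub>A\<^esub> scalar b"
      using ab by (intro ext) (simp add: A_add scalar_def K.l_distr)
  qed (auto simp: scalar_unit iota_one hom_unit_one)
qed (rule K.ring_axioms A.ring_axioms)+

lemma A_one_neq_zero: "\<one>\<^bsub>A\<^esub> \<noteq> \<zero>\<^bsub>A\<^esub>"
proof
  assume eq: "\<one>\<^bsub>A\<^esub> = \<zero>\<^bsub>A\<^esub>"
  have "hom_unit \<one>\<^bsub>U\<^esub> (cls \<one>\<^bsub>U\<^esub>) = \<zero>" unfolding A_one[symmetric] eq by (rule A_zero)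
  then show False using ucoeff_nonzero[of "\<one>\<^bsub>U\<^esub>"] by (simp add: hom_unit_apply)
qed

definition KA :: "('u set \<Rightarrow> 'k) set" where "KA = scalar ` carrier K"

definition UA :: "('u set \<Rightarrow> 'k) set" where "UA = hom_unit ` carrier U"

lemma KA_subfield: "subfield KA A"
  unfolding KA_def
  by (rule ring_hom_ring.img_is_subfield(2)[OF scalar_hom K.carrier_is_subfield A_one_neq_zero])

lemma hom_unit_KA_iff:
  assumes "u \<in> carrier U" shows "hom_unit u \<in> KA \<longleftrightarrow> u \<in> H"
proof
  assume "hom_unit u \<in> KA"
  then obtain a where a: "a \<in> carrier K" "hom_unit u = scalar a" by (auto simp: KA_def)
  have "scalar a (cls u) \<noteq> \<zero>" using ucoeff_nonzero[OF assms] by (simp add: hom_unit_apply flip: a(2))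
  then have "cls u = H" by (auto simp: scalar_def D_one split: if_splits)
  then show "u \<in> H" using U.coset_join1[OF _ assms H_subgroup] by simp
next
  assume "u \<in> H"
  then obtain a where "a \<in> Units K" "u = \<iota> a" by (auto simp: base_units_def)
  then show "hom_unit u \<in> KA" using scalar_unit[of a] by (auto simp: KA_def intro!: image_eqI[of _ _ a])
qed

lemma KA_UA: "f \<in> KA \<Longrightarrow> f \<noteq> \<zero>\<^bsub>A\<^esub> \<Longrightarrow> f \<in> UA"
proof -
  assume f: "f \<in> KA" "f \<noteq> \<zero>\<^bsub>A\<^esub>"
  then obtain a where a: "a \<in> carrier K" "f = scalar a" by (auto simp: KA_def)
  then have "a \<in> Units K" using f(2) scalar_zero by (auto simp: K.field_Units)
  then show "f \<in> UA" unfolding UA_def a(2) by (simp add: scalar_unit)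
qed

lemma scalar_units_eq: "scalar_units K U \<iota> x = hom_unit ` H"
  by (simp add: scalar_units_def)

lemma finsum_apply:
  assumes "finite S" "F \<in> S \<rightarrow> carrier A"
  shows "(\<Oplus>\<^bsub>A\<^esub>i\<in>S. F i) d = (\<Oplus>i\<in>S. F i d)"
  using assms
proof (induction S rule: finite_induct)
  case (insert i S)
  have "F j d \<in> carrier K" if "j \<in> insert i S" for j
    using A_carrierD(1)[of "F j" d] insert.prems that by blast
  then show ?case using insert by (simp add: A_add Pi_iff)
qed (simp add: A_zero)

lemma A_decompose:
  assumes f: "f \<in> carrier A"
  shows "f = (\<Oplus>\<^bsub>A\<^esub>d\<in>{d. f d \<noteq> \<zero>}. scalar (f d) \<otimes>\<^bsub>A\<^esub> hom_unit (x d))"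
proof (rule A_ext[OF f])
  let ?S = "{d. f d \<noteq> \<zero>}"
  have S: "finite ?S" "?S \<subseteq> carrier D" using A_carrierD(2,3)[OF f] by auto
  have F: "(\<lambda>d. scalar (f d) \<otimes>\<^bsub>A\<^esub> hom_unit (x d)) \<in> ?S \<rightarrow> carrier A"
    using S A_carrierD(1)[OF f] by auto
  then show "(\<Oplus>\<^bsub>A\<^esub>d\<in>?S. scalar (f d) \<otimes>\<^bsub>A\<^esub> hom_unit (x d)) \<in> carrier A"
    by (rule A.finsum_closed)
  fix e assume e: "e \<in> carrier D"
  have "(\<Oplus>\<^bsub>A\<^esub>d\<in>?S. scalar (f d) \<otimes>\<^bsub>A\<^esub> hom_unit (x d)) e = (\<Oplus>d\<in>?S. f d \<otimes> hom_unit (x d) e)"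
    unfolding finsum_apply[OF S(1) F]
    using S A_carrierD(1)[OF f] A_carrierD(1)[OF hom_unit_carrier]
    by (intro K.finsum_cong') (auto simp: scalar_mult_apply subset_eq)
  also have "\<dots> = (\<Oplus>d\<in>?S. if e = d then f d else \<zero>)"
  proof (intro K.finsum_cong' refl)
    fix d assume "d \<in> ?S"
    then have "d \<in> carrier D" using S by blast
    then show "f d \<otimes> hom_unit (x d) e = (if e = d then f d else \<zero>)"
      using A_carrierD(1)[OF f] by (simp add: hom_unit_apply ucoeff_x)
  qed (use A_carrierD(1)[OF f] in auto)
  also have "\<dots> = f e"
  proof (cases "e \<in> ?S")
    case True
    then show ?thesis using K.finsum_singleton[OF True S(1), of f] A_carrierD(1)[OF f] by auto
  next
    case False
    then have "(\<Oplus>d\<in>?S. if e = d then f d else \<zero>) = \<zero>"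
      by (intro K.add.finprod_one_eqI) auto
    then show ?thesis using False by simp
  qed
  finally show "f e = (\<Oplus>\<^bsub>A\<^esub>d\<in>?S. scalar (f d) \<otimes>\<^bsub>A\<^esub> hom_unit (x d)) e" by simp
qed

lemma scalar_eq_zero: assumes "a \<in> carrier K" "scalar a = \<zero>\<^bsub>A\<^esub>" shows "a = \<zero>"
proof (rule ccontr)
  assume "a \<noteq> \<zero>"
  then have a: "a \<in> Units K" using assms(1) by (simp add: K.field_Units)
  have "hom_unit (\<iota> a) (cls (\<iota> a)) = \<zero>" using assms(2) scalar_unit[OF a] by (simp add: A_zero)
  then show False using ucoeff_nonzero[OF iota_closed[OF a]] by (simp add: hom_unit_apply)
qed

lemma add_pow_A_one: "add_pow A (n::nat) \<one>\<^bsub>A\<^esub> = scalar (add_pow K n \<one>)"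
proof (induction n)
  case (Suc n)
  have "add_pow K n \<one> \<in> carrier K" by simp
  then have "scalar (add_pow K n \<one> \<oplus> \<one>) = scalar (add_pow K n \<one>) \<oplus>\<^bsub>A\<^esub> scalar \<one>"
    by (intro ext) (simp add: A_add scalar_def K.l_distr)
  then show ?case using Suc by (simp add: scalar_unit iota_one hom_unit_one)
qed (simp add: scalar_zero)

lemma scalar_minus: assumes "a \<in> carrier K" shows "scalar (\<ominus> a) = \<ominus>\<^bsub>A\<^esub> scalar a"
proof -
  have "scalar (\<ominus> a) \<oplus>\<^bsub>A\<^esub> scalar a = \<zero>\<^bsub>A\<^esub>"
    using assms by (intro ext) (simp add: A_add A_zero scalar_def K.l_distr[symmetric] K.l_neg)
  from A.minus_equality[OF this] show ?thesis using assms by simp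
qed

text \<open>The set \<open>P\<close> stays open because there are two uses: all primes that are
  nonzero in \<open>K\<close> for the field criterion, and a single prime for the primary
  parts.\<close>

lemma kummer_group_A:
  assumes tor: "\<And>u. u \<in> carrier U \<Longrightarrow> \<exists>n>0::nat. u [^]\<^bsub>U\<^esub> n \<in> H \<and> (\<forall>q. Factorial_Ring.prime q \<longrightarrow> q dvd n \<longrightarrow> q \<in> P)"
    and ess: "\<And>u q. u \<in> carrier U \<Longrightarrow> Factorial_Ring.prime (q::nat) \<Longrightarrow> u [^]\<^bsub>U\<^esub> q = \<one>\<^bsub>U\<^esub> \<Longrightarrow> u \<in> H"
    and char: "\<And>q. q \<in> P \<Longrightarrow> add_pow K q \<one> \<noteq> \<zero>"
  shows "kummer_group A KA UA P"
proof (intro kummer_group.intro cring_subfield.intro cring_subfield_axioms.intro kummer_group_axioms.intro)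
  show "cring A" by (rule A_cring)
  show "subfield KA A" by (rule KA_subfield)
  show "\<And>k. k \<in> KA \<Longrightarrow> k \<noteq> \<zero>\<^bsub>A\<^esub> \<Longrightarrow> k \<in> UA" by (rule KA_UA)
next
  fix f assume "f \<in> UA"
  then obtain u where u: "u \<in> carrier U" "f = hom_unit u" by (auto simp: UA_def)
  show "f \<in> Units A" using u hom_unit_Units by simp
  show "inv\<^bsub>A\<^esub> f \<in> UA" using u by (simp add: hom_unit_inv UA_def)
  obtain n :: nat where n: "n > 0" "u [^]\<^bsub>U\<^esub> n \<in> H" "\<forall>q. Factorial_Ring.prime q \<longrightarrow> q dvd n \<longrightarrow> q \<in> P"
    using tor[OF u(1)] by (elim exE conjE)
  have "f [^]\<^bsub>A\<^esub> n \<in> KA" using u n by (simp add: hom_unit_pow[symmetric] hom_unit_KA_iff)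
  then show "\<exists>n>0. f [^]\<^bsub>A\<^esub> n \<in> KA \<and> (\<forall>q. Factorial_Ring.prime q \<longrightarrow> q dvd n \<longrightarrow> q \<in> P)"
    using n by blast
  fix q :: nat assume q: "Factorial_Ring.prime q" "f [^]\<^bsub>A\<^esub> q = \<one>\<^bsub>A\<^esub>"
  have "hom_unit (u [^]\<^bsub>U\<^esub> q) = hom_unit \<one>\<^bsub>U\<^esub>" using q u by (simp add: hom_unit_pow hom_unit_one)
  then have "u [^]\<^bsub>U\<^esub> q = \<one>\<^bsub>U\<^esub>" using u by (intro hom_unit_inj) auto
  then show "f \<in> KA" using ess[OF u(1) q(1)] u by (simp add: hom_unit_KA_iff)
next
  fix f g assume "f \<in> UA" "g \<in> UA"
  then show "f \<otimes>\<^bsub>A\<^esub> g \<in> UA" by (auto simp: UA_def hom_unit_mult[symmetric])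
next
  fix q assume "q \<in> P"
  then show "add_pow A q \<one>\<^bsub>A\<^esub> \<noteq> \<zero>\<^bsub>A\<^esub>"
    using char scalar_eq_zero[of "add_pow K q \<one>"] by (auto simp: add_pow_A_one)
qed

end

section \<open>When the universal algebra is a field\<close>

lemma (in domain) square_eq:
  assumes "a \<in> carrier R" "b \<in> carrier R" "a \<otimes> a = b \<otimes> b" shows "a = b \<or> a = \<ominus> b"
proof -
  have "(a \<ominus> b) \<otimes> (a \<oplus> b) = (a \<otimes> a \<oplus> \<ominus> (b \<otimes> b)) \<oplus> (a \<otimes> b \<oplus> \<ominus> (a \<otimes> b))"
    using assms(1,2) by (simp add: a_minus_def l_distr r_distr l_minus r_minus m_ac a_ac)
  also have "\<dots> = \<zero>" unfolding assms(3) using assms(1,2) by (simp add: r_neg)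
  finally have "a \<ominus> b = \<zero> \<or> a \<oplus> b = \<zero>"
    by (rule integral) (use assms(1,2) in auto)
  then show ?thesis
    using assms(1,2) minus_equality[of a b] r_right_minus_eq[of a b] by auto
qed

lemma (in comm_group) coset_pow:
  assumes "subgroup S G" "y \<in> carrier G"
  shows "(S #> y) [^]\<^bsub>G Mod S\<^esub> (n::nat) = S #> (y [^] n)"
proof -
  have nm: "normal S G" by (simp add: assms(1) normal_iff_subgroup)
  show ?thesis
  proof (induction n)
    case 0
    show ?case using coset_join2[OF one_closed assms(1)] subgroup.one_closed[OF assms(1)] by simp
  next
    case (Suc n)
    then show ?case using normal.rcos_sum[OF nm, of "y [^] n" y] assms(2) by simp
  qed
qed

section \<open>Necessity of the conditions\<close>

context graded_extension
begin

lemma cls_pow: "u \<in> carrier U \<Longrightarrow> cls (u [^]\<^bsub>U\<^esub> (n::nat)) = cls u [^]\<^bsub>D\<^esub> n"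
  unfolding grading_group_def by (rule U.coset_pow[OF H_subgroup, symmetric])

lemma H_iff: assumes "u \<in> carrier U" shows "u \<in> H \<longleftrightarrow> cls u = \<one>\<^bsub>D\<^esub>"
  unfolding D_one using U.coset_join1[OF _ assms H_subgroup] U.coset_join2[OF assms H_subgroup] by auto

lemma A_uminus: assumes "f \<in> carrier A" shows "(\<ominus>\<^bsub>A\<^esub> f) d = \<ominus> f d"
proof -
  have c: "(\<ominus>\<^bsub>A\<^esub> f) d \<in> carrier K" "f d \<in> carrier K"
    using A_carrierD(1)[OF assms] A_carrierD(1)[OF A.a_inv_closed[OF assms]] by auto
  have "(\<ominus>\<^bsub>A\<^esub> f \<oplus>\<^bsub>A\<^esub> f) d = \<zero>" unfolding A.l_neg[OF assms] by (rule A_zero)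
  then have "(\<ominus>\<^bsub>A\<^esub> f) d \<oplus> f d = \<zero>" unfolding A_add .
  from K.minus_equality[OF this c(2,1)] show ?thesis by simp
qed

lemma cls_pow_neq:
  assumes u: "u \<in> carrier U" and n: "\<And>k. 0 < k \<Longrightarrow> k < n \<Longrightarrow> u [^]\<^bsub>U\<^esub> k \<notin> H"
    and ij: "i < j" "j < (n::nat)"
  shows "cls (u [^]\<^bsub>U\<^esub> i) \<noteq> cls (u [^]\<^bsub>U\<^esub> j)"
proof
  assume eq: "cls (u [^]\<^bsub>U\<^esub> i) = cls (u [^]\<^bsub>U\<^esub> j)"
  have "u [^]\<^bsub>U\<^esub> j = u [^]\<^bsub>U\<^esub> i \<otimes>\<^bsub>U\<^esub> u [^]\<^bsub>U\<^esub> (j - i)" using u ij by (simp add: U.nat_pow_mult)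
  then have "cls (u [^]\<^bsub>U\<^esub> i) \<otimes>\<^bsub>D\<^esub> cls (u [^]\<^bsub>U\<^esub> (j - i)) = cls (u [^]\<^bsub>U\<^esub> i)"
    using u eq by (simp add: cls_mult)
  then have "cls (u [^]\<^bsub>U\<^esub> (j - i)) = \<one>\<^bsub>D\<^esub>"
    using u D.l_cancel_one[of "cls (u [^]\<^bsub>U\<^esub> i)" "cls (u [^]\<^bsub>U\<^esub> (j - i))"] by simp
  then have "u [^]\<^bsub>U\<^esub> (j - i) \<in> H" using u H_iff[of "u [^]\<^bsub>U\<^esub> (j - i)"] by simp
  then show False using n[of "j - i"] ij by simp
qed

text \<open>The summands lie in pairwise distinct classes, so nothing cancels and each coefficient
  of the sum comes from one power.\<close>

lemma power_sum_apply:
  assumes u: "u \<in> carrier U" and n: "\<And>k. 0 < k \<Longrightarrow> k < n \<Longrightarrow> u [^]\<^bsub>U\<^esub> k \<notin> H" and k: "k < (n::nat)"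
  shows "(\<Oplus>\<^bsub>A\<^esub>j\<in>{..<n}. hom_unit u [^]\<^bsub>A\<^esub> j) (cls (u [^]\<^bsub>U\<^esub> k)) = ucoeff (u [^]\<^bsub>U\<^esub> k)"
proof -
  have ne: "cls (u [^]\<^bsub>U\<^esub> i) \<noteq> cls (u [^]\<^bsub>U\<^esub> j)" if "i < j" "j < n" for i j :: nat
    using u n that by (rule cls_pow_neq)
  have "(\<Oplus>\<^bsub>A\<^esub>j\<in>{..<n}. hom_unit u [^]\<^bsub>A\<^esub> j) (cls (u [^]\<^bsub>U\<^esub> k)) =
      (\<Oplus>j\<in>{..<n}. (hom_unit u [^]\<^bsub>A\<^esub> j) (cls (u [^]\<^bsub>U\<^esub> k)))"
    using u by (intro finsum_apply) auto
  also have "\<dots> = (\<Oplus>j\<in>{..<n}. if k = j then ucoeff (u [^]\<^bsub>U\<^esub> j) else \<zero>)"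
  proof (intro K.finsum_cong' refl)
    fix j assume "j \<in> {..<n}"
    then have "cls (u [^]\<^bsub>U\<^esub> k) = cls (u [^]\<^bsub>U\<^esub> j) \<longleftrightarrow> k = j"
      using ne[of k j] ne[of j k] k by (cases k j rule: linorder_cases) auto
    then show "(hom_unit u [^]\<^bsub>A\<^esub> j) (cls (u [^]\<^bsub>U\<^esub> k)) = (if k = j then ucoeff (u [^]\<^bsub>U\<^esub> j) else \<zero>)"
      unfolding hom_unit_pow[OF u, symmetric] hom_unit_apply by simp
  qed (use u in auto)
  also have "\<dots> = ucoeff (u [^]\<^bsub>U\<^esub> k)"
    using u k by (intro K.finsum_singleton) auto
  finally show ?thesis .
qed

text \<open>If f inverts u - 1, then 1 + u + ... + u^(n-1) = (u^n - 1) f. The right side is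
  supported on at most twice as many classes as f, the left side on exactly n.\<close>

lemma not_unit_of_infinite_order:
  assumes u: "u \<in> carrier U" and n: "\<And>k::nat. 0 < k \<Longrightarrow> u [^]\<^bsub>U\<^esub> k \<notin> H"
    and f: "f \<in> carrier A" "(hom_unit u \<ominus>\<^bsub>A\<^esub> \<one>\<^bsub>A\<^esub>) \<otimes>\<^bsub>A\<^esub> f = \<one>\<^bsub>A\<^esub>"
  shows False
proof -
  let ?y = "hom_unit u" and ?S = "{d. f d \<noteq> \<zero>}"
  \<comment> \<open>One more than the support of (u^n - 1) f can have.\<close>
  define n where "n = 2 * card ?S + 1"
  define s where "s = (\<Oplus>\<^bsub>A\<^esub>j\<in>{..<n}. ?y [^]\<^bsub>A\<^esub> j)"
  have y: "?y \<in> carrier A" using u by simp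
  have s: "s \<in> carrier A" unfolding s_def using y by simp
  have fS: "finite ?S" by (rule A_carrierD(3)[OF f(1)])
  have "s = s \<otimes>\<^bsub>A\<^esub> ((?y \<ominus>\<^bsub>A\<^esub> \<one>\<^bsub>A\<^esub>) \<otimes>\<^bsub>A\<^esub> f)" unfolding f(2) using s by simp
  also have "\<dots> = ((?y \<ominus>\<^bsub>A\<^esub> \<one>\<^bsub>A\<^esub>) \<otimes>\<^bsub>A\<^esub> s) \<otimes>\<^bsub>A\<^esub> f" using s y f(1) by (simp add: A.m_ac)
  also have "(?y \<ominus>\<^bsub>A\<^esub> \<one>\<^bsub>A\<^esub>) \<otimes>\<^bsub>A\<^esub> s = ?y [^]\<^bsub>A\<^esub> n \<ominus>\<^bsub>A\<^esub> \<one>\<^bsub>A\<^esub>"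
    unfolding s_def by (rule A.geometric_sum[OF y])
  also have "(?y [^]\<^bsub>A\<^esub> n \<ominus>\<^bsub>A\<^esub> \<one>\<^bsub>A\<^esub>) \<otimes>\<^bsub>A\<^esub> f = ?y [^]\<^bsub>A\<^esub> n \<otimes>\<^bsub>A\<^esub> f \<oplus>\<^bsub>A\<^esub> \<ominus>\<^bsub>A\<^esub> f"
    using y f(1) by (simp add: a_minus_def A.l_distr A.l_minus)
  finally have seq: "s = ?y [^]\<^bsub>A\<^esub> n \<otimes>\<^bsub>A\<^esub> f \<oplus>\<^bsub>A\<^esub> \<ominus>\<^bsub>A\<^esub> f" .
  let ?v = "cls (u [^]\<^bsub>U\<^esub> n)"
  let ?T = "?S \<union> (\<lambda>d. ?v \<otimes>\<^bsub>D\<^esub> d) ` ?S"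
  have v: "?v \<in> carrier D" using u by simp
  have "cls (u [^]\<^bsub>U\<^esub> k) \<in> ?T" if k: "k < n" for k
  proof (rule ccontr)
    assume nT: "cls (u [^]\<^bsub>U\<^esub> k) \<notin> ?T"
    let ?h = "cls (u [^]\<^bsub>U\<^esub> k)"
    have h: "?h \<in> carrier D" using u by simp
    have f0: "f ?h = \<zero>" using nT by simp
    have g0: "f (inv\<^bsub>D\<^esub> ?v \<otimes>\<^bsub>D\<^esub> ?h) = \<zero>"
    proof (rule ccontr)
      assume nz: "f (inv\<^bsub>D\<^esub> ?v \<otimes>\<^bsub>D\<^esub> ?h) \<noteq> \<zero>"
      have "?h = ?v \<otimes>\<^bsub>D\<^esub> (inv\<^bsub>D\<^esub> ?v \<otimes>\<^bsub>D\<^esub> ?h)"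
        using v h by (subst D.m_assoc[symmetric]) auto
      then have "?h \<in> (\<lambda>d. ?v \<otimes>\<^bsub>D\<^esub> d) ` ?S" using nz by (intro image_eqI) auto
      then show False using nT by blast
    qed
    have "(?y [^]\<^bsub>A\<^esub> n \<otimes>\<^bsub>A\<^esub> f) ?h = f (inv\<^bsub>D\<^esub> ?v \<otimes>\<^bsub>D\<^esub> ?h) \<otimes> ucoeff (u [^]\<^bsub>U\<^esub> n \<otimes>\<^bsub>U\<^esub> x (inv\<^bsub>D\<^esub> ?v \<otimes>\<^bsub>D\<^esub> ?h))"
      unfolding hom_unit_pow[OF u, symmetric] using u by (intro hom_unit_mult_apply f h) auto
    also have "\<dots> = \<zero>" unfolding g0 using u v h by (intro K.l_null ucoeff_carrier) simp
    finally have "s ?h = \<zero>" unfolding seq A_add A_uminus[OF f(1)] f0 by simp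
    moreover have "s ?h = ucoeff (u [^]\<^bsub>U\<^esub> k)"
      unfolding s_def by (rule power_sum_apply[OF u _ k]) (rule n)
    ultimately show False using ucoeff_nonzero[of "u [^]\<^bsub>U\<^esub> k"] u by simp
  qed
  then have "(\<lambda>k. cls (u [^]\<^bsub>U\<^esub> k)) ` {..<n} \<subseteq> ?T" by auto
  moreover have "inj_on (\<lambda>k. cls (u [^]\<^bsub>U\<^esub> k)) {..<n}"
  proof (rule linorder_inj_onI)
    fix i j assume ij: "i < j" "i \<in> {..<n}" "j \<in> {..<n}"
    show "cls (u [^]\<^bsub>U\<^esub> i) \<noteq> cls (u [^]\<^bsub>U\<^esub> j)"
      by (rule cls_pow_neq[OF u, where n = n]) (use n ij in auto)
  qed auto
  ultimately have "n \<le> card ?T"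
    using card_inj_on_le[of "\<lambda>k. cls (u [^]\<^bsub>U\<^esub> k)" "{..<n}" ?T] fS by simp
  also have "\<dots> \<le> card ?S + card ((\<lambda>d. ?v \<otimes>\<^bsub>D\<^esub> d) ` ?S)" by (rule card_Un_le)
  also have "\<dots> \<le> card ?S + card ?S" using card_image_le[OF fS] by (intro add_left_mono)
  finally show False by (simp add: n_def)
qed

lemma field_imp_essential:
  assumes "field A" shows "essential_extension H U"
  unfolding essential_extension_def
proof (intro conjI allI impI H_subgroup)
  interpret F: field A by fact
  fix F assume F: "subgroup F U \<and> F \<inter> H = {\<one>\<^bsub>U\<^esub>}"
  have "u = \<one>\<^bsub>U\<^esub>" if uF: "u \<in> F" for u
  proof (rule ccontr)
    assume u1: "u \<noteq> \<one>\<^bsub>U\<^esub>"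
    have u: "u \<in> carrier U" using F uF subgroup.subset by blast
    have powF: "u [^]\<^bsub>U\<^esub> k \<in> F" for k :: nat
    proof (induction k)
      case 0 show ?case using F subgroup.one_closed by auto
    next
      case (Suc k) then show ?case using F uF subgroup.m_closed by auto
    qed
    have pow1: "u [^]\<^bsub>U\<^esub> k = \<one>\<^bsub>U\<^esub>" if "u [^]\<^bsub>U\<^esub> k \<in> H" for k :: nat
      using F powF[of k] that by blast
    let ?y = "hom_unit u"
    have y: "?y \<in> carrier A" using u by simp
    have "?y \<noteq> \<one>\<^bsub>A\<^esub>" using hom_unit_inj[OF u U.one_closed] u1 by (auto simp: hom_unit_one)
    then have yz: "?y \<ominus>\<^bsub>A\<^esub> \<one>\<^bsub>A\<^esub> \<noteq> \<zero>\<^bsub>A\<^esub>" using A.r_right_minus_eq[OF y A.one_closed] by simp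
    have yc: "?y \<ominus>\<^bsub>A\<^esub> \<one>\<^bsub>A\<^esub> \<in> carrier A" using y by simp
    show False
    proof (cases "\<exists>k>0. u [^]\<^bsub>U\<^esub> (k::nat) = \<one>\<^bsub>U\<^esub>")
      case True
      \<comment> \<open>All powers of u lie in F, so a power in H is trivial. Hence the order n of u
        is also the least positive exponent with power in H, and the n powers below it have distinct
        classes.\<close>
      define n where "n = (LEAST k::nat. k > 0 \<and> u [^]\<^bsub>U\<^esub> k = \<one>\<^bsub>U\<^esub>)"
      have n: "n > 0" "u [^]\<^bsub>U\<^esub> n = \<one>\<^bsub>U\<^esub>" using LeastI_ex[OF True] unfolding n_def by auto
      have nH: "u [^]\<^bsub>U\<^esub> k \<notin> H" if "0 < k" "k < n" for k
        using not_less_Least[of k "\<lambda>k. k > 0 \<and> u [^]\<^bsub>U\<^esub> k = \<one>\<^bsub>U\<^esub>"] pow1[of k] that unfolding n_def by auto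
      let ?s = "\<Oplus>\<^bsub>A\<^esub>j\<in>{..<n}. ?y [^]\<^bsub>A\<^esub> j"
      have s: "?s \<in> carrier A" using y by simp
      have "?y [^]\<^bsub>A\<^esub> n = \<one>\<^bsub>A\<^esub>" using hom_unit_pow[OF u, of n] n(2) by (simp add: hom_unit_one)
      then have "(?y \<ominus>\<^bsub>A\<^esub> \<one>\<^bsub>A\<^esub>) \<otimes>\<^bsub>A\<^esub> ?s = \<zero>\<^bsub>A\<^esub>"
        unfolding A.geometric_sum[OF y] by (simp add: a_minus_def A.r_neg)
      then have "?s = \<zero>\<^bsub>A\<^esub>" using F.integral[OF _ yc s] yz by blast
      moreover have "?s (cls (u [^]\<^bsub>U\<^esub> (0::nat))) = ucoeff (u [^]\<^bsub>U\<^esub> (0::nat))"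
        by (rule power_sum_apply[OF u nH n(1)])
      ultimately show False using ucoeff_nonzero[of "\<one>\<^bsub>U\<^esub>"] by (simp add: A_zero)
    next
      case False
      then have nH: "u [^]\<^bsub>U\<^esub> k \<notin> H" if "0 < k" for k :: nat using pow1[of k] that by blast
      have "?y \<ominus>\<^bsub>A\<^esub> \<one>\<^bsub>A\<^esub> \<in> Units A" using yz yc by (simp add: F.field_Units)
      then show False
        by (intro not_unit_of_infinite_order[OF u nH, of "inv\<^bsub>A\<^esub> (?y \<ominus>\<^bsub>A\<^esub> \<one>\<^bsub>A\<^esub>)"]) auto
    qed
  qed
  then show "F = {\<one>\<^bsub>U\<^esub>}" using F by blast
qed

text \<open>Evaluating inside the algebra removes the explicit unit condition: a fourth power of a
  homogeneous unit is never zero, so in characteristic 2 both sides are false.\<close>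

lemma fourth_power_iff:
  "minus_4_is_fourth_power K U \<iota> \<longleftrightarrow> (\<exists>f\<in>UA. f [^]\<^bsub>A\<^esub> (4::nat) = \<ominus>\<^bsub>A\<^esub> (add_pow A (4::nat) \<one>\<^bsub>A\<^esub>))"
proof -
  let ?a = "\<ominus> (add_pow K (4::nat) \<one>)"
  have ac: "?a \<in> carrier K" by simp
  have a: "\<ominus>\<^bsub>A\<^esub> (add_pow A (4::nat) \<one>\<^bsub>A\<^esub>) = scalar ?a"
    unfolding add_pow_A_one by (rule scalar_minus[symmetric]) simp
  show ?thesis
  proof
    assume "minus_4_is_fourth_power K U \<iota>"
    then obtain u where u: "?a \<in> Units K" "u \<in> carrier U" "u [^]\<^bsub>U\<^esub> (4::nat) = \<iota> ?a"
      unfolding minus_4_is_fourth_power_def by blast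
    have "hom_unit u [^]\<^bsub>A\<^esub> (4::nat) = scalar ?a"
      unfolding hom_unit_pow[OF u(2), symmetric] u(3) scalar_unit[OF u(1)] ..
    then show "\<exists>f\<in>UA. f [^]\<^bsub>A\<^esub> (4::nat) = \<ominus>\<^bsub>A\<^esub> (add_pow A (4::nat) \<one>\<^bsub>A\<^esub>)"
      unfolding a UA_def using u(2) by blast
  next
    assume "\<exists>f\<in>UA. f [^]\<^bsub>A\<^esub> (4::nat) = \<ominus>\<^bsub>A\<^esub> (add_pow A (4::nat) \<one>\<^bsub>A\<^esub>)"
    then obtain u where u: "u \<in> carrier U" "hom_unit u [^]\<^bsub>A\<^esub> (4::nat) = scalar ?a"
      unfolding a UA_def by blast
    have eq: "hom_unit (u [^]\<^bsub>U\<^esub> (4::nat)) = scalar ?a" unfolding hom_unit_pow[OF u(1)] by (rule u(2))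
    have "?a \<noteq> \<zero>"
    proof
      assume z: "?a = \<zero>"
      have "hom_unit (u [^]\<^bsub>U\<^esub> (4::nat)) (cls (u [^]\<^bsub>U\<^esub> (4::nat))) = \<zero>"
        unfolding eq z scalar_zero by (rule A_zero)
      then show False using ucoeff_nonzero[of "u [^]\<^bsub>U\<^esub> (4::nat)"] u(1) by (simp add: hom_unit_apply)
    qed
    then have aU: "?a \<in> Units K" using ac by (simp add: K.field_Units)
    have "u [^]\<^bsub>U\<^esub> (4::nat) = \<iota> ?a"
      using eq scalar_unit[OF aU] u(1) iota_closed[OF aU] by (intro hom_unit_inj) auto
    then show "minus_4_is_fourth_power K U \<iota>" unfolding minus_4_is_fourth_power_def using aU u(1) by blast
  qed
qed

text \<open>Otherwise the cyclic group generated by u meets H trivially, so it is trivial by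
  essentiality, and then u = 1 lies in H after all.\<close>

lemma essential_imp_torsion:
  assumes "essential_extension H U" "u \<in> carrier U"
  shows "\<exists>n>0. u [^]\<^bsub>U\<^esub> (n::nat) \<in> H"
proof (rule ccontr)
  assume no: "\<not> ?thesis"
  have sub: "subgroup (generate U {u}) U" using assms(2) by (intro U.generate_is_subgroup) auto
  have "generate U {u} \<inter> H = {\<one>\<^bsub>U\<^esub>}"
  proof (intro equalityI subsetI)
    fix w assume w: "w \<in> generate U {u} \<inter> H"
    then obtain k :: int where k: "w = u [^]\<^bsub>U\<^esub> k" using U.generate_pow[OF assms(2)] by auto
    have "k = 0"
    proof (rule ccontr)
      assume "k \<noteq> 0"
      then consider "k > 0" | "k < 0" by linarith
      then show False
      proof cases
        case 1
        then have wk: "w = u [^]\<^bsub>U\<^esub> nat k" unfolding k using int_pow_int[of U u "nat k"] by simp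
        have "w \<in> H" using w by blast
        then have "u [^]\<^bsub>U\<^esub> nat k \<in> H" unfolding wk .
        moreover have "nat k > 0" using 1 by simp
        ultimately show False using no by blast
      next
        case 2
        then have wk: "inv\<^bsub>U\<^esub> w = u [^]\<^bsub>U\<^esub> nat (- k)"
          unfolding k using int_pow_int[of U u "nat (- k)"] U.int_pow_neg[OF assms(2), of k] by simp
        have "inv\<^bsub>U\<^esub> w \<in> H" using w subgroup.m_inv_closed[OF H_subgroup] by blast
        then have "u [^]\<^bsub>U\<^esub> nat (- k) \<in> H" unfolding wk .
        moreover have "nat (- k) > 0" using 2 by simp
        ultimately show False using no by blast
      qed
    qed
    then show "w \<in> {\<one>\<^bsub>U\<^esub>}" using k by simp
  qed (use subgroup.one_closed[OF sub] subgroup.one_closed[OF H_subgroup] in auto)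
  then have "generate U {u} = {\<one>\<^bsub>U\<^esub>}" using assms(1) sub unfolding essential_extension_def by blast
  moreover have "u \<in> generate U {u}" by (rule generate.incl) simp
  ultimately have "u [^]\<^bsub>U\<^esub> (1::nat) \<in> H" using subgroup.one_closed[OF H_subgroup] by simp
  then show False using no by blast
qed

text \<open>A group of prime order either lies in H or meets it trivially; essentiality excludes the
  second for a nontrivial group.\<close>

lemma essential_imp_prime_order:
  assumes "essential_extension H U" "u \<in> carrier U" "Factorial_Ring.prime (q::nat)" "u [^]\<^bsub>U\<^esub> q = \<one>\<^bsub>U\<^esub>"
  shows "u \<in> H"
proof (rule ccontr)
  assume uH: "u \<notin> H"
  have sub: "subgroup (generate U {u}) U" using assms(2) by (intro U.generate_is_subgroup) auto
  have "generate U {u} \<inter> H = {\<one>\<^bsub>U\<^esub>}"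
  proof (intro equalityI subsetI)
    fix w assume w: "w \<in> generate U {u} \<inter> H"
    then obtain k :: int where k: "w = u [^]\<^bsub>U\<^esub> k" using U.generate_pow[OF assms(2)] by auto
    have uq: "u [^]\<^bsub>U\<^esub> int q = \<one>\<^bsub>U\<^esub>" using assms(4) by (simp add: int_pow_int)
    have "int q dvd k"
    proof (rule ccontr)
      assume "\<not> int q dvd k"
      \<comment> \<open>If q does not divide k, Bezout recovers u as a power of w, so u would lie in
        H.\<close>
      then have "coprime (int q) k" using assms(3) by (intro prime_imp_coprime) simp_all
      then obtain a b where ab: "a * int q + b * k = 1" using bezout_int[of "int q" k] by auto
      have "u = u [^]\<^bsub>U\<^esub> (int q * a + k * b)" using ab assms(2) by (simp add: mult.commute)
      also have "\<dots> = (u [^]\<^bsub>U\<^esub> int q) [^]\<^bsub>U\<^esub> a \<otimes>\<^bsub>U\<^esub> w [^]\<^bsub>U\<^esub> b"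
        unfolding k using assms(2) by (simp only: U.int_pow_mult U.int_pow_pow)
      also have "\<dots> = w [^]\<^bsub>U\<^esub> b" unfolding uq k using assms(2) by simp
      finally have "u = w [^]\<^bsub>U\<^esub> b" .
      moreover have "w [^]\<^bsub>U\<^esub> b \<in> H" using U.subgroup_int_pow_closed[OF H_subgroup, of w b] w by blast
      ultimately show False using uH by simp
    qed
    then obtain m where "k = int q * m" by blast
    then have "w = (u [^]\<^bsub>U\<^esub> int q) [^]\<^bsub>U\<^esub> m" unfolding k using assms(2) by (simp add: U.int_pow_pow)
    then show "w \<in> {\<one>\<^bsub>U\<^esub>}" unfolding uq by simp
  qed (use subgroup.one_closed[OF sub] subgroup.one_closed[OF H_subgroup] in auto)
  then have "generate U {u} = {\<one>\<^bsub>U\<^esub>}" using assms(1) sub unfolding essential_extension_def by blast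
  moreover have "u \<in> generate U {u}" by (rule generate.incl) simp
  ultimately show False using uH subgroup.one_closed[OF H_subgroup] by simp
qed

text \<open>For u of order 4, u^2 has order 2, so it lies in K by essentiality and can only be -1.
  Conversely i^4 = 1, and an order dividing 2 would put i into K, again by essentiality.\<close>

lemma new_order_4_iff:
  assumes "essential_extension H U"
  shows "has_new_order_4 K U \<iota> \<longleftrightarrow> (\<exists>i\<in>UA. i \<notin> KA \<and> i \<otimes>\<^bsub>A\<^esub> i = \<ominus>\<^bsub>A\<^esub> \<one>\<^bsub>A\<^esub>)"
proof -
  note ess = essential_imp_prime_order[OF assms]
  show ?thesis
  proof
  interpret S: cring_subfield A KA
    by (intro cring_subfield.intro cring_subfield_axioms.intro A_cring KA_subfield)
  assume "has_new_order_4 K U \<iota>"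
  then obtain u where u: "u \<in> carrier U" "group.ord U u = 4" "u \<notin> H"
    unfolding has_new_order_4_def by blast
  let ?z = "u \<otimes>\<^bsub>U\<^esub> u"
  have z2: "?z = u [^]\<^bsub>U\<^esub> (2::nat)" using u(1) by (simp add: numeral_2_eq_2)
  have "?z [^]\<^bsub>U\<^esub> (2::nat) = u [^]\<^bsub>U\<^esub> (4::nat)" unfolding z2 using u(1) by (simp add: U.nat_pow_pow)
  also have "\<dots> = \<one>\<^bsub>U\<^esub>" using U.pow_ord_eq_1[OF u(1)] u(2) by simp
  finally have z4: "?z [^]\<^bsub>U\<^esub> (2::nat) = \<one>\<^bsub>U\<^esub>" .
  have zH: "?z \<in> H" using ess[OF _ two_is_prime_nat z4] u(1) by simp
  have z1: "?z \<noteq> \<one>\<^bsub>U\<^esub>" unfolding z2 U.pow_eq_id[OF u(1)] u(2) by simp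
  let ?w = "hom_unit ?z"
  have w: "?w \<in> KA" using zH u(1) by (simp add: hom_unit_KA_iff)
  have w1: "?w \<noteq> \<one>\<^bsub>A\<^esub>" using hom_unit_inj[of ?z "\<one>\<^bsub>U\<^esub>"] z1 u(1) by (auto simp: hom_unit_one)
  have ww: "?w \<otimes>\<^bsub>A\<^esub> ?w = \<one>\<^bsub>A\<^esub>"
    using hom_unit_mult[of ?z ?z] z4 u(1) by (simp add: hom_unit_one numeral_2_eq_2)
  have wc: "?w \<in> carrier A" using w by (rule S.K_carrier)
  have "(?w \<ominus>\<^bsub>A\<^esub> \<one>\<^bsub>A\<^esub>) \<otimes>\<^bsub>A\<^esub> (?w \<oplus>\<^bsub>A\<^esub> \<one>\<^bsub>A\<^esub>) = ?w \<otimes>\<^bsub>A\<^esub> ?w \<ominus>\<^bsub>A\<^esub> \<one>\<^bsub>A\<^esub>"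
    using wc by (simp add: a_minus_def A.l_distr A.r_distr A.l_minus A.a_assoc A.r_neg1 A.r_neg2)
  also have "\<dots> = \<zero>\<^bsub>A\<^esub>" unfolding ww by (simp add: a_minus_def A.r_neg)
  finally have 0: "(?w \<ominus>\<^bsub>A\<^esub> \<one>\<^bsub>A\<^esub>) \<otimes>\<^bsub>A\<^esub> (?w \<oplus>\<^bsub>A\<^esub> \<one>\<^bsub>A\<^esub>) = \<zero>\<^bsub>A\<^esub>" .
  have "?w \<oplus>\<^bsub>A\<^esub> \<one>\<^bsub>A\<^esub> = \<zero>\<^bsub>A\<^esub>"
  proof (rule S.K_integral[OF _ _ 0])
    show "?w \<ominus>\<^bsub>A\<^esub> \<one>\<^bsub>A\<^esub> \<noteq> \<zero>\<^bsub>A\<^esub>" using A.r_right_minus_eq[OF wc A.one_closed] w1 by simp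
  qed (use w wc in auto)
  then have "?w = \<ominus>\<^bsub>A\<^esub> \<one>\<^bsub>A\<^esub>" using A.minus_equality[of ?w "\<one>\<^bsub>A\<^esub>"] wc by simp
  then have "hom_unit u \<otimes>\<^bsub>A\<^esub> hom_unit u = \<ominus>\<^bsub>A\<^esub> \<one>\<^bsub>A\<^esub>" using u(1) by (simp add: hom_unit_mult)
  moreover have "hom_unit u \<notin> KA" using u by (simp add: hom_unit_KA_iff)
  ultimately show "\<exists>i\<in>UA. i \<notin> KA \<and> i \<otimes>\<^bsub>A\<^esub> i = \<ominus>\<^bsub>A\<^esub> \<one>\<^bsub>A\<^esub>" unfolding UA_def using u(1) by blast
next
  assume "\<exists>i\<in>UA. i \<notin> KA \<and> i \<otimes>\<^bsub>A\<^esub> i = \<ominus>\<^bsub>A\<^esub> \<one>\<^bsub>A\<^esub>"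
  then obtain u where u: "u \<in> carrier U" "hom_unit u \<notin> KA" "hom_unit u \<otimes>\<^bsub>A\<^esub> hom_unit u = \<ominus>\<^bsub>A\<^esub> \<one>\<^bsub>A\<^esub>"
    unfolding UA_def by blast
  have uH: "u \<notin> H" using u by (simp add: hom_unit_KA_iff)
  have h2: "hom_unit u [^]\<^bsub>A\<^esub> (2::nat) = \<ominus>\<^bsub>A\<^esub> \<one>\<^bsub>A\<^esub>" using u(1,3) by (simp add: numeral_2_eq_2)
  have "hom_unit u [^]\<^bsub>A\<^esub> (4::nat) = (hom_unit u [^]\<^bsub>A\<^esub> (2::nat)) [^]\<^bsub>A\<^esub> (2::nat)"
    using A.nat_pow_pow[of "hom_unit u" 2 2] u(1) by simp
  also have "\<dots> = \<one>\<^bsub>A\<^esub>" unfolding h2 by (simp add: numeral_2_eq_2 A.l_minus)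
  finally have "hom_unit (u [^]\<^bsub>U\<^esub> (4::nat)) = hom_unit \<one>\<^bsub>U\<^esub>"
    using u(1) by (simp add: hom_unit_pow hom_unit_one)
  then have "u [^]\<^bsub>U\<^esub> (4::nat) = \<one>\<^bsub>U\<^esub>" using u(1) by (intro hom_unit_inj) auto
  then have "group.ord U u dvd 4" using U.pow_eq_id[OF u(1)] by simp
  moreover have "\<not> group.ord U u dvd 2"
    using U.pow_eq_id[OF u(1), of 2] ess[OF u(1) two_is_prime_nat] uH by blast
  moreover have "d = 4" if "d dvd 4" "\<not> d dvd 2" for d :: nat
  proof -
    have "d \<le> 4" using that(1) by (rule dvd_imp_le) simp
    then have "d = 0 \<or> d = 1 \<or> d = 2 \<or> d = 3 \<or> d = 4" by auto
    then show ?thesis using that by auto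
  qed
  ultimately have "group.ord U u = 4" by blast
  then show "has_new_order_4 K U \<iota>" unfolding has_new_order_4_def using u(1) uH by blast
qed
qed


lemma K_minus_nonzero: "a \<in> carrier K \<Longrightarrow> a \<noteq> \<zero> \<Longrightarrow> \<ominus> a \<noteq> \<zero>"
  using K.minus_minus[of a] by auto

lemma field_imp_no_fourth_root:
  assumes "field A" and i: "i \<in> UA" "i \<notin> KA" "i \<otimes>\<^bsub>A\<^esub> i = \<ominus>\<^bsub>A\<^esub> \<one>\<^bsub>A\<^esub>"
    and f: "f \<in> UA" "f [^]\<^bsub>A\<^esub> (4::nat) = \<ominus>\<^bsub>A\<^esub> (add_pow A (4::nat) \<one>\<^bsub>A\<^esub>)"
  shows False
proof -
  interpret F: field A by fact
  obtain v where v: "v \<in> carrier U" "f = hom_unit v" using f(1) by (auto simp: UA_def)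
  obtain w where w: "w \<in> carrier U" "i = hom_unit w" using i(1) by (auto simp: UA_def)
  have fc: "f \<in> carrier A" and ic: "i \<in> carrier A" using v w by auto
  have "w \<notin> H" using i(2) w by (simp add: hom_unit_KA_iff)
  then have cw: "cls w \<noteq> \<one>\<^bsub>D\<^esub>" using H_iff[OF w(1)] by simp
  \<comment> \<open>Here \<open>?t\<close> is 2 i, with square -4. Since the algebra is a field, f^2
    is 2 i or -2 i, that is (1 + i)^2 or (1 - i)^2.\<close>
  let ?t = "i \<oplus>\<^bsub>A\<^esub> i"
  have tc: "?t \<in> carrier A" using ic by simp
  have "?t \<otimes>\<^bsub>A\<^esub> ?t = i \<otimes>\<^bsub>A\<^esub> i \<oplus>\<^bsub>A\<^esub> i \<otimes>\<^bsub>A\<^esub> i \<oplus>\<^bsub>A\<^esub> i \<otimes>\<^bsub>A\<^esub> i \<oplus>\<^bsub>A\<^esub> i \<otimes>\<^bsub>A\<^esub> i"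
    using ic by (simp add: A.l_distr A.r_distr A.a_assoc)
  also have "\<dots> = \<ominus>\<^bsub>A\<^esub> (add_pow A (4::nat) \<one>\<^bsub>A\<^esub>)"
    unfolding i(3) by (simp add: numeral_eq_Suc A.minus_add A.a_ac)
  also have "\<dots> = (f \<otimes>\<^bsub>A\<^esub> f) \<otimes>\<^bsub>A\<^esub> (f \<otimes>\<^bsub>A\<^esub> f)"
    unfolding f(2)[symmetric] using fc by (simp add: numeral_eq_Suc A.m_assoc)
  finally have ff: "f \<otimes>\<^bsub>A\<^esub> f = ?t \<or> f \<otimes>\<^bsub>A\<^esub> f = \<ominus>\<^bsub>A\<^esub> ?t"
    using F.square_eq[of "f \<otimes>\<^bsub>A\<^esub> f" ?t] fc tc by simp
  let ?e = "\<one>\<^bsub>A\<^esub> \<oplus>\<^bsub>A\<^esub> i" and ?g = "\<one>\<^bsub>A\<^esub> \<oplus>\<^bsub>A\<^esub> \<ominus>\<^bsub>A\<^esub> i"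
  have ec: "?e \<in> carrier A" and gc: "?g \<in> carrier A" using ic by auto
  have "?e \<otimes>\<^bsub>A\<^esub> ?e = (\<one>\<^bsub>A\<^esub> \<oplus>\<^bsub>A\<^esub> i \<otimes>\<^bsub>A\<^esub> i) \<oplus>\<^bsub>A\<^esub> ?t"
    using ic by (simp add: A.l_distr A.r_distr A.a_ac)
  also have "\<dots> = ?t" unfolding i(3) using tc by (simp add: A.r_neg)
  finally have ee: "?e \<otimes>\<^bsub>A\<^esub> ?e = ?t" .
  have "?g \<otimes>\<^bsub>A\<^esub> ?g = (\<one>\<^bsub>A\<^esub> \<oplus>\<^bsub>A\<^esub> i \<otimes>\<^bsub>A\<^esub> i) \<oplus>\<^bsub>A\<^esub> \<ominus>\<^bsub>A\<^esub> ?t"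
    using ic by (simp add: A.l_distr A.r_distr A.l_minus A.r_minus A.minus_add A.a_ac)
  also have "\<dots> = \<ominus>\<^bsub>A\<^esub> ?t" unfolding i(3) using tc by (simp add: A.r_neg)
  finally have gg: "?g \<otimes>\<^bsub>A\<^esub> ?g = \<ominus>\<^bsub>A\<^esub> ?t" .
  have cases: "f = ?e \<or> f = \<ominus>\<^bsub>A\<^esub> ?e \<or> f = ?g \<or> f = \<ominus>\<^bsub>A\<^esub> ?g"
    using ff F.square_eq[OF fc ec] F.square_eq[OF fc gc] unfolding ee gg by blast
  have c1: "ucoeff \<one>\<^bsub>U\<^esub> \<in> carrier K" "ucoeff \<one>\<^bsub>U\<^esub> \<noteq> \<zero>" and c2: "ucoeff w \<in> carrier K" "ucoeff w \<noteq> \<zero>"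
    using ucoeff_nonzero w(1) by auto
  have val: "\<one>\<^bsub>A\<^esub> \<one>\<^bsub>D\<^esub> = ucoeff \<one>\<^bsub>U\<^esub>" "\<one>\<^bsub>A\<^esub> (cls w) = \<zero>" "i \<one>\<^bsub>D\<^esub> = \<zero>" "i (cls w) = ucoeff w"
    unfolding A_one w(2) hom_unit_apply cls_one using cw by auto
  \<comment> \<open>All four candidates have nonzero coefficients both at the trivial class and at
    that of i, whereas a homogeneous f has a single nonzero coefficient.\<close>
  have "f \<one>\<^bsub>D\<^esub> \<noteq> \<zero> \<and> f (cls w) \<noteq> \<zero>"
    using cases
  proof (elim disjE)
    assume e: "f = ?e"
    show ?thesis unfolding e A_add val using c1 c2 by simp
  next
    assume e: "f = \<ominus>\<^bsub>A\<^esub> ?e"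
    show ?thesis unfolding e A_uminus[OF ec] A_add val using c1 c2 K_minus_nonzero by simp
  next
    assume e: "f = ?g"
    show ?thesis unfolding e A_add A_uminus[OF ic] val using c1 c2 K_minus_nonzero by simp
  next
    assume e: "f = \<ominus>\<^bsub>A\<^esub> ?g"
    show ?thesis unfolding e A_uminus[OF gc] A_add A_uminus[OF ic] val using c1 c2 K_minus_nonzero by simp
  qed
  then have "\<one>\<^bsub>D\<^esub> = cls v" "cls w = cls v" unfolding v(2) hom_unit_apply by (auto split: if_splits)
  then show False using cw by simp
qed

section \<open>Sufficiency through towers\<close>

lemma mem_of_homogeneous:
  assumes "subfield K' A" "KA \<subseteq> K'" "f \<in> carrier A" "\<And>d. f d \<noteq> \<zero> \<Longrightarrow> hom_unit (x d) \<in> K'"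
  shows "f \<in> K'"
proof -
  have sr: "subring K' A" by (rule subfieldE(1)[OF assms(1)])
  have "(\<Oplus>\<^bsub>A\<^esub>d\<in>{d. f d \<noteq> \<zero>}. scalar (f d) \<otimes>\<^bsub>A\<^esub> hom_unit (x d)) \<in> K'"
  proof (rule A.finsum_in_subring[OF sr])
    fix d assume "d \<in> {d. f d \<noteq> \<zero>}"
    then have "hom_unit (x d) \<in> K'" using assms(4) by simp
    moreover have "scalar (f d) \<in> K'" using assms(2) A_carrierD(1)[OF assms(3)] by (auto simp: KA_def)
    ultimately show "scalar (f d) \<otimes>\<^bsub>A\<^esub> hom_unit (x d) \<in> K'" using subringE(6)[OF sr] by simp
  qed
  then show ?thesis using A_decompose[OF assms(3)] by simp
qed

text \<open>Only the finitely many homogeneous components of f have to be adjoined. The base may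
  exceed \<open>KA\<close>, as it does once an imaginary unit has been adjoined.\<close>

lemma tower_contains:
  assumes base: "A.tower_base P K' U'" "KA \<subseteq> K'" "UA \<subseteq> U'" and f: "f \<in> carrier A"
  shows "\<exists>K'' U''. A.tower_ext P K' U' K'' U'' \<and> f \<in> K''"
proof -
  let ?T = "(\<lambda>d. hom_unit (x d)) ` {d. f d \<noteq> \<zero>}"
  have "?T \<subseteq> U'"
  proof
    fix g assume "g \<in> ?T"
    then obtain d where "f d \<noteq> \<zero>" "g = hom_unit (x d)" by blast
    then have "g \<in> UA" unfolding UA_def using A_carrierD(2)[OF f] by simp
    then show "g \<in> U'" using base(3) by blast
  qed
  moreover have "finite ?T" using A_carrierD(3)[OF f] by simp
  ultimately obtain K'' U'' where K: "A.tower_ext P K' U' K'' U''" "?T \<subseteq> K''"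
    using A.tower_adjoin_finite[OF _ base(1)] by blast
  then have "kummer_group A K'' U'' P" "K' \<subseteq> K''" unfolding A.tower_ext_def A.tower_base_def by auto
  then have sf: "subfield K'' A" "KA \<subseteq> K''"
    using base(2) by (auto simp: kummer_group_def cring_subfield_def cring_subfield_axioms_def)
  have "f \<in> K''" by (rule mem_of_homogeneous[OF sf f]) (use K(2) in blast)
  then show ?thesis using K(1) by blast
qed

lemma field_of_tower:
  assumes "A.tower_base P K' U'" "KA \<subseteq> K'" "UA \<subseteq> U'" shows "field A"
proof (rule A.cring_fieldI)
  show "Units A = carrier A - {\<zero>\<^bsub>A\<^esub>}"
  proof (intro equalityI subsetI)
    fix f assume "f \<in> Units A"
    then have "f \<in> carrier A" "f \<noteq> \<zero>\<^bsub>A\<^esub>"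
      using A_one_neq_zero A.Units_l_inv[of "\<zero>\<^bsub>A\<^esub>"] A.Units_inv_closed[of "\<zero>\<^bsub>A\<^esub>"] by auto
    then show "f \<in> carrier A - {\<zero>\<^bsub>A\<^esub>}" by simp
  next
    fix f assume f: "f \<in> carrier A - {\<zero>\<^bsub>A\<^esub>}"
    then have "f \<in> carrier A" by simp
    from tower_contains[OF assms this]
    obtain K'' U'' where "A.tower_ext P K' U' K'' U''" and fK: "f \<in> K''" by (elim exE conjE)
    then have "kummer_group A K'' U'' P" unfolding A.tower_ext_def A.tower_base_def by auto
    then have "cring_subfield A K''" by (simp add: kummer_group_def)
    then show "f \<in> Units A" by (rule cring_subfield.K_Units[OF _ fK]) (use f in simp)
  qed
qed

text \<open>The least positive l with l 1 = 0 satisfies l \<le> q. If q did not divide l, the two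
  would be coprime and Bezout would give 1 = 0.\<close>

lemma ring_char_eq:
  assumes q: "Factorial_Ring.prime (q::nat)" "add_pow K q \<one> = \<zero>" shows "ring_char K = q"
proof -
  define l where "l = (LEAST n::nat. n > 0 \<and> add_pow K n \<one> = \<zero>)"
  have ex: "\<exists>n::nat. n > 0 \<and> add_pow K n \<one> = \<zero>" using q prime_gt_0_nat by blast
  have l: "l > 0" "add_pow K l \<one> = \<zero>" using LeastI_ex[OF ex] unfolding l_def by auto
  have lq: "l \<le> q" unfolding l_def using q prime_gt_0_nat by (intro Least_le) auto
  have z: "add_pow K (m * n) \<one> = \<zero>" if "add_pow K m \<one> = \<zero>" for m n :: nat
    using K.add.nat_pow_pow[of "\<one>" n m] that by simp
  have "q dvd l"
  proof (rule ccontr)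
    assume "\<not> q dvd l"
    then have "coprime l q" using prime_imp_coprime_nat[OF q(1), of l] by (simp add: coprime_commute)
    then obtain a b where ab: "l * a = q * b + 1" using bezout_nat[of l q] l(1) by auto
    have "\<zero> = add_pow K (q * b + 1) \<one>" using z[OF l(2), of a] unfolding ab by simp
    also have "\<dots> = add_pow K (q * b) \<one> \<oplus> \<one>" by simp
    also have "\<dots> = \<one>" unfolding z[OF q(2)] by simp
    finally show False by simp
  qed
  then have "l = q" using lq l(1) by (simp add: dvd_imp_le le_antisym)
  then show ?thesis using ex unfolding ring_char_def l_def by simp
qed

lemma primary_classes_trivial:
  assumes char: "ring_char K > 0 \<Longrightarrow> primary_part D (ring_char K) = {\<one>\<^bsub>D\<^esub>}"
    and q: "Factorial_Ring.prime (q::nat)" "add_pow K q \<one> = \<zero>"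
    and d: "d \<in> carrier D" "d [^]\<^bsub>D\<^esub> (q ^ k) = \<one>\<^bsub>D\<^esub>"
  shows "d = \<one>\<^bsub>D\<^esub>"
proof -
  have c: "ring_char K = q" by (rule ring_char_eq[OF q])
  \<comment> \<open>The exponent is raised by one because \<open>primary_part\<close> asks for k
    \<ge> 1.\<close>
  have "d [^]\<^bsub>D\<^esub> (q ^ Suc k) = (d [^]\<^bsub>D\<^esub> (q ^ k)) [^]\<^bsub>D\<^esub> q" using d(1) by (simp add: D.nat_pow_pow mult.commute)
  then have "d [^]\<^bsub>D\<^esub> (q ^ Suc k) = \<one>\<^bsub>D\<^esub>" unfolding d(2) by simp
  then have "d \<in> primary_part D q" unfolding primary_part_def using d(1) by (intro CollectI conjI exI[of _ "Suc k"]) auto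
  then show ?thesis using char prime_gt_0_nat[OF q(1)] unfolding c by blast
qed

text \<open>The least exponent n works: if the characteristic q divided n, the class of u^(n/q)
  would be killed by q, hence trivial by hypothesis, contradicting minimality.\<close>

lemma torsion_prime_to_char:
  assumes ess: "essential_extension H U"
    and char: "ring_char K > 0 \<Longrightarrow> primary_part D (ring_char K) = {\<one>\<^bsub>D\<^esub>}" and u: "u \<in> carrier U"
  shows "\<exists>n>0::nat. u [^]\<^bsub>U\<^esub> n \<in> H \<and> (\<forall>q. Factorial_Ring.prime q \<longrightarrow> q dvd n \<longrightarrow> q \<in> {q. add_pow K q \<one> \<noteq> \<zero>})"
proof -
  define n where "n = (LEAST n::nat. n > 0 \<and> u [^]\<^bsub>U\<^esub> n \<in> H)"
  have ex: "\<exists>n>0::nat. u [^]\<^bsub>U\<^esub> n \<in> H" by (rule essential_imp_torsion[OF ess u])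
  have n: "n > 0" "u [^]\<^bsub>U\<^esub> n \<in> H" using LeastI_ex[OF ex] unfolding n_def by auto
  have "add_pow K q \<one> \<noteq> \<zero>" if q: "Factorial_Ring.prime q" "q dvd n" for q :: nat
  proof
    assume z: "add_pow K q \<one> = \<zero>"
    obtain m where m: "n = q * m" using q(2) by (elim dvdE)
    have m': "m > 0" "m < n" using n(1) m prime_gt_1_nat[OF q(1)] by auto
    let ?v = "u [^]\<^bsub>U\<^esub> m"
    have v: "?v \<in> carrier U" using u by simp
    have "?v [^]\<^bsub>U\<^esub> q = u [^]\<^bsub>U\<^esub> n" unfolding m using u by (simp add: U.nat_pow_pow mult.commute)
    then have pw: "cls ?v [^]\<^bsub>D\<^esub> (q ^ 1) = \<one>\<^bsub>D\<^esub>"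
      using n(2) H_iff[of "u [^]\<^bsub>U\<^esub> n"] cls_pow[OF v, of q] u by simp
    have "cls ?v = \<one>\<^bsub>D\<^esub>" by (rule primary_classes_trivial[OF char q(1) z cls_closed[OF v] pw])
    then have "?v \<in> H" using H_iff[OF v] by simp
    then show False using not_less_Least[of m "\<lambda>n. n > 0 \<and> u [^]\<^bsub>U\<^esub> n \<in> H"] m' unfolding n_def by blast
  qed
  then show ?thesis using n by (intro exI[of _ n]) simp
qed

lemma field_iff:
  assumes char: "ring_char K > 0 \<Longrightarrow> primary_part D (ring_char K) = {\<one>\<^bsub>D\<^esub>}"
  shows "field A \<longleftrightarrow> essential_extension H U \<and> (has_new_order_4 K U \<iota> \<longrightarrow> \<not> minus_4_is_fourth_power K U \<iota>)"
proof
  assume A: "field A"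
  have ess: "essential_extension H U" by (rule field_imp_essential[OF A])
  have "\<not> minus_4_is_fourth_power K U \<iota>" if h4: "has_new_order_4 K U \<iota>"
  proof
    assume "minus_4_is_fourth_power K U \<iota>"
    then obtain f where f: "f \<in> UA" "f [^]\<^bsub>A\<^esub> (4::nat) = \<ominus>\<^bsub>A\<^esub> (add_pow A (4::nat) \<one>\<^bsub>A\<^esub>)"
      unfolding fourth_power_iff by blast
    obtain i where i: "i \<in> UA" "i \<notin> KA" "i \<otimes>\<^bsub>A\<^esub> i = \<ominus>\<^bsub>A\<^esub> \<one>\<^bsub>A\<^esub>"
      using h4 new_order_4_iff[OF ess] by blast
    show False by (rule field_imp_no_fourth_root[OF A i f])
  qed
  then show "essential_extension H U \<and> (has_new_order_4 K U \<iota> \<longrightarrow> \<not> minus_4_is_fourth_power K U \<iota>)"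
    using ess by blast
next
  assume R: "essential_extension H U \<and> (has_new_order_4 K U \<iota> \<longrightarrow> \<not> minus_4_is_fourth_power K U \<iota>)"
  then have ess: "essential_extension H U" by blast
  \<comment> \<open>The largest set of exponents that the nonvanishing condition in
    \<open>kummer_group\<close> allows.\<close>
  let ?P = "{q. add_pow K q \<one> \<noteq> \<zero>}"
  have kg: "kummer_group A KA UA ?P"
  proof (rule kummer_group_A)
    show "\<exists>n>0. u [^]\<^bsub>U\<^esub> (n::nat) \<in> H \<and> (\<forall>q. Factorial_Ring.prime q \<longrightarrow> q dvd n \<longrightarrow> q \<in> ?P)"
      if "u \<in> carrier U" for u
      by (rule torsion_prime_to_char[OF ess char that])
    show "u \<in> H" if "u \<in> carrier U" "Factorial_Ring.prime (q::nat)" "u [^]\<^bsub>U\<^esub> q = \<one>\<^bsub>U\<^esub>" for u q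
      by (rule essential_imp_prime_order[OF ess that])
  qed simp
  note new = new_order_4_iff[OF ess]
  show "field A"
  proof (cases "has_new_order_4 K U \<iota>")
    case False
    then have "\<forall>u\<in>UA. u \<otimes>\<^bsub>A\<^esub> u = \<ominus>\<^bsub>A\<^esub> \<one>\<^bsub>A\<^esub> \<longrightarrow> u \<in> KA" using new by blast
    then have "A.tower_base ?P KA UA" unfolding A.tower_base_def using kg by blast
    then show ?thesis by (rule field_of_tower) auto
  next
    case True
    then obtain i where i: "i \<in> UA" "i \<notin> KA" "i \<otimes>\<^bsub>A\<^esub> i = \<ominus>\<^bsub>A\<^esub> \<one>\<^bsub>A\<^esub>" using new by blast
    have no4: "f [^]\<^bsub>A\<^esub> (4::nat) \<noteq> \<ominus>\<^bsub>A\<^esub> (add_pow A (4::nat) \<one>\<^bsub>A\<^esub>)" if "f \<in> UA" for f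
      using R True that unfolding fourth_power_iff by blast
    have "\<exists>K' U'. A.tower_base ?P K' U' \<and> KA \<subseteq> K' \<and> UA \<subseteq> U'"
      by (rule kummer_group.adjoin_imaginary_unit[OF kg i no4])
    then obtain K' U' where "A.tower_base ?P K' U'" "KA \<subseteq> K'" "UA \<subseteq> U'" by (elim exE conjE)
    then show ?thesis by (rule field_of_tower)
  qed
qed

section \<open>Primary parts of the unit quotient\<close>

lemma p_group_pow:
  assumes "p_group p D" "u \<in> carrier U" obtains k where "u [^]\<^bsub>U\<^esub> (p ^ k) \<in> H"
proof -
  have c: "cls u \<in> carrier D" using assms(2) by simp
  obtain k where "group.ord D (cls u) = p ^ k" using assms(1) c unfolding p_group_def by blast
  then have "cls u [^]\<^bsub>D\<^esub> (p ^ k) = \<one>\<^bsub>D\<^esub>" using D.pow_ord_eq_1[OF c] by simp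
  then have "u [^]\<^bsub>U\<^esub> (p ^ k) \<in> H"
    using H_iff[of "u [^]\<^bsub>U\<^esub> (p ^ k)"] cls_pow[OF assms(2)] assms(2) by simp
  then show ?thesis by (rule that)
qed

text \<open>If p is the characteristic, the grading group is trivial and f is a scalar. Otherwise a
  tower with P = {p} reaches a field containing f; there f belongs to the enlarged group, and the
  radical clause of \<open>tower_ext\<close> descends one p-th root at a time.\<close>

lemma radical_homogeneous:
  assumes char: "ring_char K > 0 \<Longrightarrow> primary_part D (ring_char K) = {\<one>\<^bsub>D\<^esub>}"
    and ess: "essential_extension H U" and p: "Factorial_Ring.prime (p::nat)" "p_group p D"
    and no4: "\<not> has_new_order_4 K U \<iota>"
    and f: "f \<in> carrier A" "f \<noteq> \<zero>\<^bsub>A\<^esub>" "f [^]\<^bsub>A\<^esub> (p ^ k) \<in> UA"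
  shows "f \<in> UA"
proof (cases "add_pow K p \<one> = \<zero>")
  case True
  have "f \<in> KA"
  proof (rule mem_of_homogeneous[OF KA_subfield subset_refl f(1)])
    fix d assume "f d \<noteq> \<zero>"
    then have d: "d \<in> carrier D" by (rule A_carrierD(2)[OF f(1)])
    obtain j where j: "x d [^]\<^bsub>U\<^esub> (p ^ j) \<in> H" by (rule p_group_pow[OF p(2) x_closed[OF d]])
    have pw: "d [^]\<^bsub>D\<^esub> (p ^ j) = \<one>\<^bsub>D\<^esub>"
      using j H_iff[of "x d [^]\<^bsub>U\<^esub> (p ^ j)"] cls_pow[OF x_closed[OF d], of "p ^ j"] d by simp
    have "d = \<one>\<^bsub>D\<^esub>" by (rule primary_classes_trivial[OF char p(1) True d pw])
    then have "x d \<in> H" using H_iff[OF x_closed[OF d]] d by simp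
    then show "hom_unit (x d) \<in> KA" using d by (simp add: hom_unit_KA_iff)
  qed
  then show ?thesis using f(2) by (rule KA_UA)
next
  case False
  have tor: "\<exists>n>0. u [^]\<^bsub>U\<^esub> (n::nat) \<in> H \<and> (\<forall>q. Factorial_Ring.prime q \<longrightarrow> q dvd n \<longrightarrow> q \<in> {p})" if u: "u \<in> carrier U" for u
  proof -
    obtain j where j: "u [^]\<^bsub>U\<^esub> (p ^ j) \<in> H" by (rule p_group_pow[OF p(2) u])
    have "q = p" if "Factorial_Ring.prime q" "q dvd p ^ j" for q
      using that p(1) prime_dvd_power primes_dvd_imp_eq by blast
    then show ?thesis using j prime_gt_0_nat[OF p(1)] by (intro exI[of _ "p ^ j"]) simp
  qed
  have kg: "kummer_group A KA UA {p}"
  proof (rule kummer_group_A)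
    show "u \<in> H" if "u \<in> carrier U" "Factorial_Ring.prime (q::nat)" "u [^]\<^bsub>U\<^esub> q = \<one>\<^bsub>U\<^esub>" for u q
      by (rule essential_imp_prime_order[OF ess that])
  qed (rule tor, assumption, use False in simp)
  have "\<forall>u\<in>UA. u \<otimes>\<^bsub>A\<^esub> u = \<ominus>\<^bsub>A\<^esub> \<one>\<^bsub>A\<^esub> \<longrightarrow> u \<in> KA"
    using no4 new_order_4_iff[OF ess] by blast
  then have base: "A.tower_base {p} KA UA" unfolding A.tower_base_def using kg by blast
  from tower_contains[OF base subset_refl subset_refl f(1)]
  obtain K'' U'' where K: "A.tower_ext {p} KA UA K'' U''" "f \<in> K''" by (elim exE conjE)
  then have kg': "kummer_group A K'' U'' {p}" unfolding A.tower_ext_def A.tower_base_def by simp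
  have rad: "g \<in> UA" if "g \<in> U''" "g [^]\<^bsub>A\<^esub> p \<in> UA" for g
    using K(1) that unfolding A.tower_ext_def by simp
  have "g [^]\<^bsub>A\<^esub> (p ^ j) \<in> UA \<Longrightarrow> g \<in> UA" if g: "g \<in> U''" for g j
  proof (induction j)
    case 0
    then show ?case using kummer_group.U_carrier[OF kg' g] by simp
  next
    case (Suc j)
    have gc: "g \<in> carrier A" by (rule kummer_group.U_carrier[OF kg' g])
    have "(g [^]\<^bsub>A\<^esub> (p ^ j)) [^]\<^bsub>A\<^esub> p \<in> UA" using Suc.prems gc by (simp add: A.nat_pow_pow mult.commute)
    then have "g [^]\<^bsub>A\<^esub> (p ^ j) \<in> UA" by (rule rad[OF kummer_group.U_pow[OF kg' g]])
    then show ?case by (rule Suc.IH)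
  qed
  moreover have "f \<in> U''" by (rule kummer_group.K_U[OF kg' K(2) f(2)])
  ultimately show ?thesis using f(3) by blast
qed

text \<open>The hypothesis \<open>rad\<close> carries one inclusion: a class killed by a power of p
  has a representative with a homogeneous p-power. The other inclusion holds because the grading
  group is a p-group.\<close>

lemma primary_part_unit_quotient:
  assumes p: "p_group p D"
    and rad: "\<And>f k. f \<in> Units A \<Longrightarrow> f [^]\<^bsub>A\<^esub> (p ^ k) \<in> UA \<Longrightarrow> f \<in> UA"
  shows "primary_part (unit_quotient K U \<iota> x) p = homog_quotient K U \<iota> x"
proof -
  let ?G = "units_of A" and ?S = "scalar_units K U \<iota> x"
  interpret G: comm_group ?G by (rule A.units_comm_group)
  have Gc: "carrier ?G = Units A" by (simp add: units_of_carrier)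
  have HU: "H \<subseteq> carrier U" by (rule subgroup.subset[OF H_subgroup])
  have S: "?S = hom_unit ` H" by (rule scalar_units_eq)
  have hom: "group_hom U ?G hom_unit"
  proof (intro group_hom.intro group_hom_axioms.intro U.is_group G.is_group homI)
    show "\<And>u. u \<in> carrier U \<Longrightarrow> hom_unit u \<in> carrier ?G" by (simp add: Gc hom_unit_Units)
    show "\<And>u v. u \<in> carrier U \<Longrightarrow> v \<in> carrier U \<Longrightarrow> hom_unit (u \<otimes>\<^bsub>U\<^esub> v) = hom_unit u \<otimes>\<^bsub>?G\<^esub> hom_unit v"
      by (simp add: units_of_mult hom_unit_mult)
  qed
  have sub: "subgroup ?S ?G" unfolding S by (rule group_hom.subgroup_img_is_subgroup[OF hom H_subgroup])
  have coset: "(?S #>\<^bsub>?G\<^esub> f) [^]\<^bsub>unit_quotient K U \<iota> x\<^esub> (n::nat) = ?S #>\<^bsub>?G\<^esub> (f [^]\<^bsub>A\<^esub> n)" if "f \<in> Units A" for f n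
    unfolding unit_quotient_def using G.coset_pow[OF sub, of f n] that by (simp add: Gc A.units_of_pow)
  have one: "\<one>\<^bsub>unit_quotient K U \<iota> x\<^esub> = ?S" by (simp add: unit_quotient_def)
  have inS: "?S #>\<^bsub>?G\<^esub> f = ?S \<longleftrightarrow> f \<in> ?S" if "f \<in> Units A" for f
    using G.coset_join1[OF _ _ sub, of f] G.coset_join2[OF _ sub, of f] that by (auto simp: Gc)
  have carr: "carrier (unit_quotient K U \<iota> x) = (\<lambda>f. ?S #>\<^bsub>?G\<^esub> f) ` Units A"
    by (simp add: unit_quotient_def carrier_FactGroup Gc)
  show ?thesis
  proof (intro equalityI subsetI)
    fix Z assume "Z \<in> primary_part (unit_quotient K U \<iota> x) p"
    then obtain k where k: "Z \<in> carrier (unit_quotient K U \<iota> x)"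
      "Z [^]\<^bsub>unit_quotient K U \<iota> x\<^esub> (p ^ k) = \<one>\<^bsub>unit_quotient K U \<iota> x\<^esub>"
      unfolding primary_part_def by blast
    obtain f where f: "f \<in> Units A" "Z = ?S #>\<^bsub>?G\<^esub> f" using k(1) unfolding carr by blast
    have "?S #>\<^bsub>?G\<^esub> (f [^]\<^bsub>A\<^esub> (p ^ k)) = ?S" using k(2) unfolding f(2) coset[OF f(1)] one .
    then have "f [^]\<^bsub>A\<^esub> (p ^ k) \<in> ?S" using inS[OF A.Units_pow_closed[OF f(1)]] by simp
    then have "f [^]\<^bsub>A\<^esub> (p ^ k) \<in> UA" unfolding S UA_def using HU by blast
    then have "f \<in> UA" by (rule rad[OF f(1)])
    then show "Z \<in> homog_quotient K U \<iota> x" unfolding f(2) homog_quotient_def UA_def by blast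
  next
    fix Z assume "Z \<in> homog_quotient K U \<iota> x"
    then obtain u where u: "u \<in> carrier U" "Z = ?S #>\<^bsub>?G\<^esub> hom_unit u" unfolding homog_quotient_def by blast
    obtain k where k: "u [^]\<^bsub>U\<^esub> (p ^ k) \<in> H" by (rule p_group_pow[OF p u(1)])
    \<comment> \<open>The exponent obtained for u may be p^0, while membership in the primary part
      asks for a positive k.\<close>
    have "u [^]\<^bsub>U\<^esub> (p ^ Suc k) = (u [^]\<^bsub>U\<^esub> (p ^ k)) [^]\<^bsub>U\<^esub> p"
      using u(1) by (simp add: U.nat_pow_pow mult.commute)
    moreover have "v [^]\<^bsub>U\<^esub> n \<in> H" if "v \<in> H" for v and n :: nat
      using that subgroup.one_closed[OF H_subgroup] subgroup.m_closed[OF H_subgroup] by (induction n) auto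
    ultimately have "u [^]\<^bsub>U\<^esub> (p ^ Suc k) \<in> H" using k by simp
    then have "hom_unit u [^]\<^bsub>A\<^esub> (p ^ Suc k) \<in> ?S" unfolding S hom_unit_pow[OF u(1), symmetric] by blast
    then have "Z [^]\<^bsub>unit_quotient K U \<iota> x\<^esub> (p ^ Suc k) = \<one>\<^bsub>unit_quotient K U \<iota> x\<^esub>"
      unfolding u(2) coset[OF hom_unit_Units[OF u(1)]] one
      using inS[OF A.Units_pow_closed[OF hom_unit_Units[OF u(1)]]] by blast
    moreover have "Z \<in> carrier (unit_quotient K U \<iota> x)" unfolding carr u(2) using hom_unit_Units[OF u(1)] by blast
    ultimately show "Z \<in> primary_part (unit_quotient K U \<iota> x) p"
      unfolding primary_part_def by (intro CollectI conjI exI[of _ "Suc k"]) auto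
  qed
qed

text \<open>The class of an element of order 4 has an order that divides 4 and is a power of the odd
  prime p, so the class is trivial.\<close>

lemma odd_p_group_no_new_order_4:
  assumes p: "Factorial_Ring.prime (p::nat)" "p \<ge> 3" "p_group p D" and ess: "essential_extension H U"
  shows "\<not> has_new_order_4 K U \<iota>"
proof
  assume "has_new_order_4 K U \<iota>"
  then obtain u where u: "u \<in> carrier U" "group.ord U u = 4" "u \<notin> H" unfolding has_new_order_4_def by blast
  have c: "cls u \<in> carrier D" using u(1) by simp
  obtain k where k: "group.ord D (cls u) = p ^ k" using p(3) c unfolding p_group_def by blast
  have "u [^]\<^bsub>U\<^esub> (4::nat) = \<one>\<^bsub>U\<^esub>" using U.pow_ord_eq_1[OF u(1)] u(2) by simp
  then have "cls u [^]\<^bsub>D\<^esub> (4::nat) = \<one>\<^bsub>D\<^esub>" using cls_pow[OF u(1), of 4] cls_one by simp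
  then have d: "p ^ k dvd 4" using D.pow_eq_id[OF c] k by simp
  have "k = 0"
  proof (rule ccontr)
    assume "k \<noteq> 0"
    then have "p dvd p ^ k" by simp
    then have "p dvd 4" using d dvd_trans by blast
    then have "p dvd 2 ^ 2" by simp
    then have "p dvd 2" using p(1) prime_dvd_power by blast
    then show False using p(2) dvd_imp_le[of p 2] by simp
  qed
  then have "cls u = \<one>\<^bsub>D\<^esub>" using k D.pow_ord_eq_1[OF c] c by simp
  then show False using H_iff[OF u(1)] u(3) by simp
qed

end

theorem theorem2p9:
  fixes K :: "('k, 'm) ring_scheme" and U :: "('u, 'n) monoid_scheme"
    and \<iota> :: "'k \<Rightarrow> 'u" and x :: "'u set \<Rightarrow> 'u"
  assumes "field K" and "comm_group U" and "\<iota> \<in> mon (units_of K) U"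
    and "is_rep_system K U \<iota> x"
    and "ring_char K > 0 \<Longrightarrow>
           primary_part (grading_group K U \<iota>) (ring_char K) = {\<one>\<^bsub>grading_group K U \<iota>\<^esub>}"
  shows "(field (universal_algebra K U \<iota> x) \<longleftrightarrow>
            essential_extension (base_units K \<iota>) U \<and>
            (has_new_order_4 K U \<iota> \<longrightarrow> \<not> minus_4_is_fourth_power K U \<iota>)) \<and>
         (field (universal_algebra K U \<iota> x) \<longrightarrow>
            (\<forall>p::nat. Factorial_Ring.prime p \<and> p \<ge> 3 \<and> p_group p (grading_group K U \<iota>) \<longrightarrow>
               primary_part (unit_quotient K U \<iota> x) p = homog_quotient K U \<iota> x) \<and>
            (p_group 2 (grading_group K U \<iota>) \<and> \<not> has_new_order_4 K U \<iota> \<longrightarrow>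
               primary_part (unit_quotient K U \<iota> x) 2 = homog_quotient K U \<iota> x))"
proof -
  interpret graded_extension K U \<iota> x
    using assms(1-4) by (intro graded_extension.intro graded_extension_axioms.intro)
  have prim: "primary_part (unit_quotient K U \<iota> x) p = homog_quotient K U \<iota> x"
    if A: "field (universal_algebra K U \<iota> x)"
      and p: "Factorial_Ring.prime p" "p_group p (grading_group K U \<iota>)"
      and no4: "essential_extension (base_units K \<iota>) U \<Longrightarrow> \<not> has_new_order_4 K U \<iota>" for p :: nat
  proof (rule primary_part_unit_quotient[OF p(2)])
    have ess: "essential_extension (base_units K \<iota>) U" by (rule field_imp_essential[OF A])
    interpret F: field "universal_algebra K U \<iota> x" by (rule A)
    fix f k
    assume f: "f \<in> Units (universal_algebra K U \<iota> x)"
      "f [^]\<^bsub>universal_algebra K U \<iota> x\<^esub> (p ^ k) \<in> UA"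
    then have "f \<in> carrier (universal_algebra K U \<iota> x)" "f \<noteq> \<zero>\<^bsub>universal_algebra K U \<iota> x\<^esub>"
      by (auto simp: F.field_Units)
    from radical_homogeneous[OF assms(5) ess p no4[OF ess] this f(2)]
    show "f \<in> UA" by simp
  qed
  have iff: "field (universal_algebra K U \<iota> x) \<longleftrightarrow> essential_extension (base_units K \<iota>) U \<and>
      (has_new_order_4 K U \<iota> \<longrightarrow> \<not> minus_4_is_fourth_power K U \<iota>)"
    by (rule field_iff[OF assms(5)])
  show ?thesis
  proof (intro conjI impI allI iff, elim conjE)
    fix p :: nat
    assume "field (universal_algebra K U \<iota> x)" and p: "Factorial_Ring.prime p" "p \<ge> 3"
      "p_group p (grading_group K U \<iota>)"
    then show "primary_part (unit_quotient K U \<iota> x) p = homog_quotient K U \<iota> x"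
      using prim[of p] odd_p_group_no_new_order_4[OF p] by blast
  next
    assume "field (universal_algebra K U \<iota> x)" "p_group 2 (grading_group K U \<iota>) \<and> \<not> has_new_order_4 K U \<iota>"
    then show "primary_part (unit_quotient K U \<iota> x) 2 = homog_quotient K U \<iota> x"
      using prim[OF _ two_is_prime_nat] by blast
  qed
qed

end
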